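(* Let $(\Omega,\Sigma,\lambda)$ be a finite measure space whose measure algebra has a nonzero atomless part, let $Z=L^1(\lambda)$, and let $\operatorname{DP}(Z)$ denote the algebra of Dunford--Pettis operators on $Z$. There is $S\in\operatorname{DP}(Z)$ with $\|S\|=1$ such that $$\|S-ST\|\ge1\quad\text{and}\quad\|S-TS\|\ge1\qquad\text{for every }T\in\operatorname{DP}(Z).$$ In particular, $\operatorname{DP}(Z)$ has neither a right nor a left approximate identity.
   Context: Scalars are complex. A bounded operator is Dunford--Pettis if it maps weakly null sequences to norm-null sequences. The measure algebra has a nonzero atomless part if there is a measurable set of positive measure containing no atom of $\lambda$. A right (respectively left) approximate identity in a Banach algebra $J$ is a net $(e_\alpha)\subseteq J$ with $\|ae_\alpha-a\|\to0$ (respectively $\|e_\alpha a-a\|\to 0$) for every $a\in J$; the net is not assumed bounded. *)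

theory Defs
  imports "HOL-Analysis.Analysis"
begin

section \<open>Complex normed spaces with an explicit carrier\<close>

text \<open>
  The space $L^1(\lambda)$ depends on a measure, which is a term, so it is not a type.
  A complex normed space is therefore given by a carrier set together with its operations.
\<close>

record 'v normed_sp =
  carr :: "'v set"
  vadd :: "'v \<Rightarrow> 'v \<Rightarrow> 'v"
  smul :: "complex \<Rightarrow> 'v \<Rightarrow> 'v"
  vnorm :: "'v \<Rightarrow> real"

definition vminus :: "'v normed_sp \<Rightarrow> 'v \<Rightarrow> 'v \<Rightarrow> 'v" where
  "vminus Z u v = vadd Z u (smul Z (-1) v)"

definition bounded_functional :: "'v normed_sp \<Rightarrow> ('v \<Rightarrow> complex) \<Rightarrow> bool" where
  "bounded_functional Z \<phi> \<longleftrightarrow>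
     (\<forall>u\<in>carr Z. \<forall>v\<in>carr Z. \<phi> (vadd Z u v) = \<phi> u + \<phi> v) \<and>
     (\<forall>c. \<forall>u\<in>carr Z. \<phi> (smul Z c u) = c * \<phi> u) \<and>
     (\<exists>C. \<forall>u\<in>carr Z. cmod (\<phi> u) \<le> C * vnorm Z u)"

text \<open>
  An operator is represented by a total function; only its values on the carrier matter
  in every notion below.
\<close>

definition bounded_operator :: "'v normed_sp \<Rightarrow> ('v \<Rightarrow> 'v) \<Rightarrow> bool" where
  "bounded_operator Z T \<longleftrightarrow>
     (\<forall>u\<in>carr Z. T u \<in> carr Z) \<and>
     (\<forall>u\<in>carr Z. \<forall>v\<in>carr Z. T (vadd Z u v) = vadd Z (T u) (T v)) \<and>
     (\<forall>c. \<forall>u\<in>carr Z. T (smul Z c u) = smul Z c (T u)) \<and>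
     (\<exists>C. \<forall>u\<in>carr Z. vnorm Z (T u) \<le> C * vnorm Z u)"

definition op_norm :: "'v normed_sp \<Rightarrow> ('v \<Rightarrow> 'v) \<Rightarrow> real" where
  "op_norm Z T = (SUP u\<in>{u \<in> carr Z. vnorm Z u \<le> 1}. vnorm Z (T u))"

definition op_minus :: "'v normed_sp \<Rightarrow> ('v \<Rightarrow> 'v) \<Rightarrow> ('v \<Rightarrow> 'v) \<Rightarrow> 'v \<Rightarrow> 'v" where
  "op_minus Z S T = (\<lambda>u. vminus Z (S u) (T u))"

definition weakly_null :: "'v normed_sp \<Rightarrow> (nat \<Rightarrow> 'v) \<Rightarrow> bool" where
  "weakly_null Z x \<longleftrightarrow> (\<forall>n. x n \<in> carr Z) \<and>
     (\<forall>\<phi>. bounded_functional Z \<phi> \<longrightarrow> (\<lambda>n. \<phi> (x n)) \<longlonglongrightarrow> 0)"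

definition norm_null :: "'v normed_sp \<Rightarrow> (nat \<Rightarrow> 'v) \<Rightarrow> bool" where
  "norm_null Z x \<longleftrightarrow> (\<forall>n. x n \<in> carr Z) \<and> (\<lambda>n. vnorm Z (x n)) \<longlonglongrightarrow> 0"

definition DP :: "'v normed_sp \<Rightarrow> ('v \<Rightarrow> 'v) set" where
  "DP Z = {T. bounded_operator Z T \<and>
     (\<forall>x. weakly_null Z x \<longrightarrow> norm_null Z (\<lambda>n. T (x n)))}"


section \<open>Approximate identities in algebras of operators\<close>

definition directed_set :: "'i set \<Rightarrow> ('i \<times> 'i) set \<Rightarrow> bool" where
  "directed_set D r \<longleftrightarrow> D \<noteq> {} \<and> preorder_on D r \<and>
     (\<forall>i\<in>D. \<forall>j\<in>D. \<exists>k\<in>D. (i, k) \<in> r \<and> (j, k) \<in> r)"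

definition net_null :: "'i set \<Rightarrow> ('i \<times> 'i) set \<Rightarrow> ('i \<Rightarrow> real) \<Rightarrow> bool" where
  "net_null D r a \<longleftrightarrow> (\<forall>\<epsilon>>0. \<exists>i0\<in>D. \<forall>i\<in>D. (i0, i) \<in> r \<longrightarrow> \<bar>a i\<bar> < \<epsilon>)"

definition right_approx_identity ::
  "'v normed_sp \<Rightarrow> ('v \<Rightarrow> 'v) set \<Rightarrow> 'i set \<Rightarrow> ('i \<times> 'i) set \<Rightarrow> ('i \<Rightarrow> 'v \<Rightarrow> 'v) \<Rightarrow> bool" where
  "right_approx_identity Z J D r e \<longleftrightarrow> directed_set D r \<and> (\<forall>i\<in>D. e i \<in> J) \<and>
     (\<forall>A\<in>J. net_null D r (\<lambda>i. op_norm Z (op_minus Z (A \<circ> e i) A)))"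

definition left_approx_identity ::
  "'v normed_sp \<Rightarrow> ('v \<Rightarrow> 'v) set \<Rightarrow> 'i set \<Rightarrow> ('i \<times> 'i) set \<Rightarrow> ('i \<Rightarrow> 'v \<Rightarrow> 'v) \<Rightarrow> bool" where
  "left_approx_identity Z J D r e \<longleftrightarrow> directed_set D r \<and> (\<forall>i\<in>D. e i \<in> J) \<and>
     (\<forall>A\<in>J. net_null D r (\<lambda>i. op_norm Z (op_minus Z (e i \<circ> A) A)))"


section \<open>The complex space $L^1$ of a measure\<close>

definition ae_eq :: "'a measure \<Rightarrow> (('a \<Rightarrow> complex) \<times> ('a \<Rightarrow> complex)) set" where
  "ae_eq M = {(f, g). integrable M f \<and> integrable M g \<and> (AE x in M. f x = g x)}"

definition ae_class :: "'a measure \<Rightarrow> ('a \<Rightarrow> complex) \<Rightarrow> ('a \<Rightarrow> complex) set" where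
  "ae_class M f = ae_eq M `` {f}"

text \<open>The operations act on representatives; the lemmas below show independence of the choice.\<close>

definition L1 :: "'a measure \<Rightarrow> ('a \<Rightarrow> complex) set normed_sp" where
  "L1 M = \<lparr>
     carr = {f. integrable M f} // ae_eq M,
     vadd = (\<lambda>u v. \<Union>f\<in>u. \<Union>g\<in>v. ae_class M (\<lambda>x. f x + g x)),
     smul = (\<lambda>c u. \<Union>f\<in>u. ae_class M (\<lambda>x. c * f x)),
     vnorm = (\<lambda>u. the_elem ((\<lambda>f. \<integral>x. cmod (f x) \<partial>M) ` u))\<rparr>"

lemma equiv_ae_eq: "equiv {f. integrable M f} (ae_eq M)"
proof (rule equivI)
  show "refl_on {f. integrable M f} (ae_eq M)"
    by (auto simp: refl_on_def ae_eq_def)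
  show "sym (ae_eq M)"
    by (simp add: sym_def ae_eq_def eq_commute)
  show "trans (ae_eq M)"
  proof (rule transI)
    fix f g h assume "(f, g) \<in> ae_eq M" "(g, h) \<in> ae_eq M"
    then have *: "integrable M f" "integrable M h" "AE x in M. f x = g x" "AE x in M. g x = h x"
      by (simp_all add: ae_eq_def)
    from *(3,4) have "AE x in M. f x = h x" by eventually_elim simp
    with * show "(f, h) \<in> ae_eq M" by (simp add: ae_eq_def)
  qed
  show "ae_eq M \<subseteq> {f. integrable M f} \<times> {f. integrable M f}"
    by (auto simp: ae_eq_def)
qed

lemma mem_ae_class:
  "g \<in> ae_class M f \<longleftrightarrow> integrable M f \<and> integrable M g \<and> (AE x in M. f x = g x)"
  by (auto simp: ae_class_def ae_eq_def)

lemma ae_class_self: "integrable M f \<Longrightarrow> f \<in> ae_class M f"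
  by (simp add: mem_ae_class)

lemma ae_class_cong:
  assumes "integrable M f" "integrable M g" "AE x in M. f x = g x"
  shows "ae_class M f = ae_class M g"
  unfolding ae_class_def using assms
  by (intro equiv_class_eq[OF equiv_ae_eq]) (simp add: ae_eq_def)

lemma carr_L1: "carr (L1 M) = ae_class M ` {f. integrable M f}"
  by (auto simp: L1_def quotient_def ae_class_def)

lemma vadd_L1:
  assumes f: "integrable M f" and g: "integrable M g"
  shows "vadd (L1 M) (ae_class M f) (ae_class M g) = ae_class M (\<lambda>x. f x + g x)"
proof -
  have "ae_class M (\<lambda>x. f' x + g' x) = ae_class M (\<lambda>x. f x + g x)"
    if "f' \<in> ae_class M f" "g' \<in> ae_class M g" for f' g'
  proof (rule ae_class_cong)
    have "AE x in M. f x = f' x" "AE x in M. g x = g' x"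
      using that by (simp_all add: mem_ae_class)
    then show "AE x in M. f' x + g' x = f x + g x"
      by eventually_elim simp
  qed (use that f g in \<open>auto simp: mem_ae_class\<close>)
  then have "(\<Union>f'\<in>ae_class M f. \<Union>g'\<in>ae_class M g. ae_class M (\<lambda>x. f' x + g' x))
      = (\<Union>f'\<in>ae_class M f. \<Union>g'\<in>ae_class M g. ae_class M (\<lambda>x. f x + g x))"
    by (intro SUP_cong refl)
  also have "\<dots> = ae_class M (\<lambda>x. f x + g x)"
    using ae_class_self[OF f] ae_class_self[OF g] by blast
  finally show ?thesis
    by (simp add: L1_def)
qed

lemma smul_L1:
  assumes f: "integrable M f"
  shows "smul (L1 M) c (ae_class M f) = ae_class M (\<lambda>x. c * f x)"
proof -
  have "ae_class M (\<lambda>x. c * f' x) = ae_class M (\<lambda>x. c * f x)" if "f' \<in> ae_class M f" for f'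
  proof (rule ae_class_cong)
    have "AE x in M. f x = f' x"
      using that by (simp add: mem_ae_class)
    then show "AE x in M. c * f' x = c * f x"
      by eventually_elim simp
  qed (use that f in \<open>auto simp: mem_ae_class\<close>)
  then have "(\<Union>f'\<in>ae_class M f. ae_class M (\<lambda>x. c * f' x))
      = (\<Union>f'\<in>ae_class M f. ae_class M (\<lambda>x. c * f x))"
    by (intro SUP_cong refl)
  also have "\<dots> = ae_class M (\<lambda>x. c * f x)"
    using ae_class_self[OF f] by blast
  finally show ?thesis
    by (simp add: L1_def)
qed

lemma vnorm_L1:
  assumes f: "integrable M f"
  shows "vnorm (L1 M) (ae_class M f) = (\<integral>x. cmod (f x) \<partial>M)"
proof -
  have "(\<integral>x. cmod (f' x) \<partial>M) = (\<integral>x. cmod (f x) \<partial>M)" if "f' \<in> ae_class M f" for f'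
  proof (rule integral_cong_AE)
    have "AE x in M. f x = f' x"
      using that by (simp add: mem_ae_class)
    then show "AE x in M. cmod (f' x) = cmod (f x)"
      by eventually_elim simp
  qed (use that f in \<open>auto simp: mem_ae_class\<close>)
  then have "(\<lambda>f'. \<integral>x. cmod (f' x) \<partial>M) ` ae_class M f = (\<lambda>f'. \<integral>x. cmod (f x) \<partial>M) ` ae_class M f"
    by (intro image_cong refl)
  also have "\<dots> = {\<integral>x. cmod (f x) \<partial>M}"
    using ae_class_self[OF f] by blast
  finally have "(\<lambda>f'. \<integral>x. cmod (f' x) \<partial>M) ` ae_class M f = {\<integral>x. cmod (f x) \<partial>M}" .
  then show ?thesis
    by (simp add: L1_def)
qed


section \<open>Atoms\<close>

definition is_atom :: "'a measure \<Rightarrow> 'a set \<Rightarrow> bool" where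
  "is_atom M B \<longleftrightarrow> B \<in> sets M \<and> emeasure M B > 0 \<and>
     (\<forall>C\<in>sets M. C \<subseteq> B \<longrightarrow> emeasure M C = 0 \<or> emeasure M (B - C) = 0)"

definition has_atomless_part :: "'a measure \<Rightarrow> bool" where
  "has_atomless_part M \<longleftrightarrow>
     (\<exists>A\<in>sets M. emeasure M A > 0 \<and> (\<forall>B. B \<subseteq> A \<longrightarrow> \<not> is_atom M B))"

end

theory Submission
  imports Defs
begin

text \<open>
  Let \<open>r i\<close> be Rademacher functions on an atomless set \<open>A\<close> and \<open>walsh F\<close> their products. The operator
  \<open>S\<close> is the biased coin operator: convolution with the Riesz product of \<open>1 + eps i * r i\<close>, so that
  \<open>S (walsh F) = Eps F * walsh F\<close> with \<open>Eps F\<close> the product of the \<open>eps i\<close>. It is a contraction because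
  the kernel is nonnegative, and it is Dunford--Pettis because weakly null sequences are uniformly
  integrable and \<open>eps i\<close> tends to 0 (on bounded functions \<open>S\<close> is a uniform limit of finite rank
  operators). If the squares of the \<open>eps i\<close> sum to infinity, the Riesz product over a suitable block
  \<open>B\<close> of indices, arbitrarily far out, is almost concentrated on a set of small measure. The
  indicator of that set, expanded in Walsh functions, is a test kernel for the trace: for
  \<open>V = S - S T\<close> as well as for \<open>V = S - T S\<close>, the diagonal coefficients of \<open>V\<close> are those of \<open>S\<close> times
  \<open>1\<close> minus the diagonal coefficients of \<open>T\<close>, and the latter tend to 0 along nonempty \<open>F\<close> moving to
  infinity since \<open>walsh F\<close> is then weakly null. Hence the trace is almost 1, while it is at most \<open>norm V\<close>.
\<close>

section \<open>Integrable functions\<close>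

text \<open>The obstacle is that \<open>T\<close> has no relation to the Walsh system: of its matrix
  only the diagonal entries far out are known to be small. Testing the norm on a single vector would
  involve off-diagonal entries, which a trace does not see. Even on the diagonal the entry at
  \<open>{}\<close> stays uncontrolled, so the test kernel must have a small mean; this is why the
  set that carries the Riesz product has to be small. How far out the other entries become small
  depends on \<open>T\<close> and on the size of the kernel, so that size must be bounded before the
  position of the block is chosen.

  The two demands on \<open>eps\<close> pull in opposite directions. By Kakutani's dichotomy,
  summable squares would turn the Riesz product into an integrable density; \<open>S\<close> would
  be a norm limit of finite rank operators, and averaging over the remaining coordinates would act
  as an approximate unit for it. Divergence of the squares makes the product singular, and
  \<open>eps i\<close> tending to 0 is what still keeps \<open>S\<close> Dunford--Pettis.\<close>

lemma integrable_tail_small: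
  fixes f :: "'a \<Rightarrow> complex"
  assumes f: "integrable M f" and e: "e > 0"
  obtains C where "C > 0" "(\<integral>x. indicator {x. cmod (f x) > C} x * cmod (f x) \<partial>M) < e"
proof -
  have [measurable]: "f \<in> borel_measurable M" using f by simp
  have "(\<lambda>n. \<integral>x. indicator {x. cmod (f x) > real n} x * cmod (f x) \<partial>M) \<longlonglongrightarrow> (\<integral>x. 0 \<partial>M)"
  proof (rule integral_dominated_convergence[where w="\<lambda>x. cmod (f x)"])
    show "AE x in M. (\<lambda>n. indicator {x. cmod (f x) > real n} x * cmod (f x)) \<longlonglongrightarrow> 0"
    proof (rule AE_I2, rule tendsto_eventually)
      fix x
      obtain N where N: "cmod (f x) < real N" using reals_Archimedean2 by blast
      show "eventually (\<lambda>n. indicator {x. cmod (f x) > real n} x * cmod (f x) = 0) sequentially"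
        unfolding eventually_sequentially using N
        by (intro exI[of _ N]) (auto simp: indicator_def)
    qed
  qed (use f in \<open>auto simp: indicator_def\<close>)
  then have "eventually (\<lambda>n. (\<integral>x. indicator {x. cmod (f x) > real n} x * cmod (f x) \<partial>M) < e) sequentially"
    using e by (simp add: order_tendstoD(2))
  then obtain N where N: "\<And>n. n \<ge> N \<Longrightarrow> (\<integral>x. indicator {x. cmod (f x) > real n} x * cmod (f x) \<partial>M) < e"
    unfolding eventually_sequentially by blast
  show ?thesis
    by (rule that[of "real (Suc N)"]) (use N[of "Suc N"] in auto)
qed

lemma (in finite_measure) integral_absolutely_continuous:
  fixes f :: "'a \<Rightarrow> complex"
  assumes f: "integrable M f" and e: "e > 0"
  obtains d where "d > 0"
    "\<And>E. E \<in> sets M \<Longrightarrow> measure M E < d \<Longrightarrow> (\<integral>x. indicator E x * cmod (f x) \<partial>M) \<le> e"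
proof -
  have [measurable]: "f \<in> borel_measurable M" using f by simp
  obtain C where C: "C > 0" "(\<integral>x. indicator {x. cmod (f x) > C} x * cmod (f x) \<partial>M) < e/2"
    using integrable_tail_small[OF f, of "e/2"] e by auto
  show ?thesis
  proof (rule that[of "e / (2*C)"])
    show "e / (2*C) > 0" using e C by simp
    fix E assume E[measurable]: "E \<in> sets M" and small: "measure M E < e / (2*C)"
    have i1: "integrable M (\<lambda>x. indicator {x. cmod (f x) > C} x * cmod (f x))"
      by (rule Bochner_Integration.integrable_bound[OF f]) (auto simp: indicator_def)
    have i2: "integrable M (\<lambda>x. C * indicator E x)"
      by (intro integrable_mult_right integrable_real_indicator) (auto simp: emeasure_eq_measure)
    have i3: "integrable M (\<lambda>x. indicator E x * cmod (f x))"
      by (rule Bochner_Integration.integrable_bound[OF f]) (auto simp: indicator_def)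
    have "(\<integral>x. indicator E x * cmod (f x) \<partial>M)
        \<le> (\<integral>x. indicator {x. cmod (f x) > C} x * cmod (f x) + C * indicator E x \<partial>M)"
      by (rule integral_mono[OF i3 Bochner_Integration.integrable_add[OF i1 i2]])
         (use C(1) in \<open>auto simp: indicator_def\<close>)
    also have "\<dots> = (\<integral>x. indicator {x. cmod (f x) > C} x * cmod (f x) \<partial>M) + C * measure M E"
      using i1 i2 E by (simp add: Bochner_Integration.integral_add)
    also have "\<dots> \<le> e/2 + C * (e / (2*C))"
      using C small by (intro add_mono mult_left_mono) auto
    also have "\<dots> = e" using C(1) by simp
    finally show "(\<integral>x. indicator E x * cmod (f x) \<partial>M) \<le> e" .
  qed
qed

text \<open>Riesz--Fischer for functions: a subsequence with geometrically small increments
  converges absolutely almost everywhere, and the Cauchy property carries the limit over to the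
  whole sequence. It supplies the limit that defines \<open>riesz_op\<close>.\<close>

lemma L1_complete:
  fixes s :: "nat \<Rightarrow> 'a \<Rightarrow> complex"
  assumes s: "\<And>n. integrable M (s n)"
    and Cauchy: "\<And>e. e > 0 \<Longrightarrow> \<exists>N. \<forall>m\<ge>N. \<forall>n\<ge>N. (\<integral>x. cmod (s m x - s n x) \<partial>M) < e"
  obtains h where "integrable M h" "(\<lambda>n. \<integral>x. cmod (s n x - h x) \<partial>M) \<longlonglongrightarrow> 0"
proof -
  have "\<exists>k. \<forall>j. (\<forall>m\<ge>k j. \<forall>n\<ge>k j. (\<integral>x. cmod (s m x - s n x) \<partial>M) < (1/2)^j) \<and> k j \<le> k (Suc j)"
  proof (rule dependent_nat_choice)
    show "\<exists>x. \<forall>m\<ge>x. \<forall>n\<ge>x. (\<integral>x. cmod (s m x - s n x) \<partial>M) < (1/2)^0"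
      using Cauchy[of 1] by auto
  next
    fix x n
    obtain N where "\<forall>m\<ge>N. \<forall>k\<ge>N. (\<integral>x. cmod (s m x - s k x) \<partial>M) < (1/2)^Suc n"
      using Cauchy[of "(1/2)^Suc n"] by auto
    then show "\<exists>y. (\<forall>m\<ge>y. \<forall>k\<ge>y. (\<integral>x. cmod (s m x - s k x) \<partial>M) < (1/2)^Suc n) \<and> x \<le> y"
      by (intro exI[of _ "max N x"]) auto
  qed
  then obtain k where k: "\<And>j m n. m \<ge> k j \<Longrightarrow> n \<ge> k j \<Longrightarrow> (\<integral>x. cmod (s m x - s n x) \<partial>M) < (1/2)^j"
    and kS: "\<And>j. k j \<le> k (Suc j)" by blast
  define d where "d j x = s (k (Suc j)) x - s (k j) x" for j x
  have d[simp]: "integrable M (d j)" for j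
    unfolding d_def using s by simp
  have [measurable]: "d j \<in> borel_measurable M" for j by (rule borel_measurable_integrable[OF d])
  have dbound: "(\<integral>x. cmod (d j x) \<partial>M) \<le> (1/2)^j" for j
    unfolding d_def using k[of j "k (Suc j)" "k j"] kS[of j] by simp
  have sm: "summable (\<lambda>j. (1/2::real)^j)" by (simp add: summable_geometric)
  have sumd: "summable (\<lambda>j. \<integral>x. cmod (d (j+i) x) \<partial>M)" for i
    by (rule summable_ignore_initial_segment, rule summable_comparison_test'[OF sm, of 0])
       (use dbound in auto)
  have AE: "AE x in M. summable (\<lambda>j. cmod (d j x))"
  proof -
    have "(\<integral>\<^sup>+x. (\<Sum>j. ennreal (cmod (d j x))) \<partial>M) = (\<Sum>j. \<integral>\<^sup>+x. ennreal (cmod (d j x)) \<partial>M)"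
      by (rule nn_integral_suminf) measurable
    also have "\<dots> = (\<Sum>j. ennreal (\<integral>x. cmod (d j x) \<partial>M))"
      by (intro arg_cong[where f=suminf] ext nn_integral_eq_integral integrable_norm d) auto
    also have "\<dots> \<noteq> \<infinity>"
      using sumd[of 0] by (simp add: ennreal_suminf_neq_top)
    finally have "AE x in M. (\<Sum>j. ennreal (cmod (d j x))) \<noteq> \<infinity>"
      by (intro nn_integral_PInf_AE) auto
    then show ?thesis
      by eventually_elim (auto intro: summable_suminf_not_top)
  qed
  define h where "h x = s (k 0) x + (\<Sum>j. d j x)" for x
  have ih: "integrable M h"
    unfolding h_def using s by (intro Bochner_Integration.integrable_add integrable_suminf AE)
      (use sumd[of 0] in simp_all)
  have hk: "(\<integral>x. cmod (s (k i) x - h x) \<partial>M) \<le> 2 * (1/2)^i" for i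
  proof -
    have AEi: "AE x in M. summable (\<lambda>j. norm (cmod (d (j+i) x)))"
      using AE by eventually_elim (simp add: summable_iff_shift[of "\<lambda>j. cmod (d j _)"])
    have ii: "integrable M (\<lambda>x. \<Sum>j. cmod (d (j+i) x))"
      by (rule integrable_suminf[OF _ AEi]) (use sumd[of i] in simp_all)
    have "AE x in M. cmod (s (k i) x - h x) \<le> (\<Sum>j. cmod (d (j+i) x))"
      using AE
    proof eventually_elim
      fix x assume a: "summable (\<lambda>j. cmod (d j x))"
      have "(\<Sum>j<i. d j x) = s (k i) x - s (k 0) x"
        unfolding d_def by (induction i) auto
      moreover have "(\<Sum>j. d j x) = (\<Sum>j. d (j+i) x) + (\<Sum>j<i. d j x)"
        by (rule suminf_split_initial_segment) (use a in \<open>rule summable_norm_cancel\<close>)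
      ultimately have "s (k i) x - h x = - (\<Sum>j. d (j+i) x)"
        by (simp add: h_def)
      then show "cmod (s (k i) x - h x) \<le> (\<Sum>j. cmod (d (j+i) x))"
        using summable_norm[of "\<lambda>j. d (j+i) x"] a
        by (simp add: summable_iff_shift[of "\<lambda>j. cmod (d j _)"])
    qed
    then have "(\<integral>x. cmod (s (k i) x - h x) \<partial>M) \<le> (\<integral>x. (\<Sum>j. cmod (d (j+i) x)) \<partial>M)"
      using ih s by (intro integral_mono_AE ii) auto
    also have "\<dots> = (\<Sum>j. \<integral>x. cmod (d (j+i) x) \<partial>M)"
      by (rule integral_suminf[OF _ AEi]) (use sumd[of i] in simp_all)
    also have "\<dots> \<le> (\<Sum>j. (1/2)^(j+i))"
      by (intro suminf_le dbound sumd) (use sm in \<open>simp add: summable_iff_shift\<close>)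
    also have "\<dots> = 2 * (1/2)^i"
      using suminf_geometric[of "1/2::real"] sm by (simp add: power_add suminf_mult2[symmetric] suminf_divide)
    finally show ?thesis .
  qed
  have "(\<lambda>n. \<integral>x. cmod (s n x - h x) \<partial>M) \<longlonglongrightarrow> 0"
  proof (rule LIMSEQ_I)
    fix e :: real assume "e > 0"
    then obtain i where i: "(1/2::real)^i < e/3"
      using real_arch_pow_inv[of "e/3" "1/2"] by auto
    have "norm ((\<integral>x. cmod (s n x - h x) \<partial>M) - 0) < e" if "n \<ge> k i" for n
    proof -
      have "(\<integral>x. cmod (s n x - h x) \<partial>M) \<le> (\<integral>x. cmod (s n x - s (k i) x) + cmod (s (k i) x - h x) \<partial>M)"
        using s ih by (intro integral_mono) (auto intro!: norm_triangle_le_diff simp: norm_diff_triangle_ineq dist_triangle[of _ _ "s (k i) _", unfolded dist_norm] norm_diff_triangle_le)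
      also have "\<dots> = (\<integral>x. cmod (s n x - s (k i) x) \<partial>M) + (\<integral>x. cmod (s (k i) x - h x) \<partial>M)"
        using s ih by (intro Bochner_Integration.integral_add) auto
      also have "\<dots> < e" using k[of i n "k i"] that hk[of i] i by linarith
      finally show ?thesis by (simp add: integral_nonneg_AE)
    qed
    then show "\<exists>N. \<forall>n\<ge>N. norm ((\<integral>x. cmod (s n x - h x) \<partial>M) - 0) < e" by blast
  qed
  then show ?thesis using ih that by blast
qed

lemma integrable_mult_bounded:
  fixes f g :: "'a \<Rightarrow> complex"
  assumes "integrable M f" "g \<in> borel_measurable M" "\<And>x. cmod (g x) \<le> C"
  shows "integrable M (\<lambda>x. g x * f x)"
proof (rule Bochner_Integration.integrable_bound)
  show "integrable M (\<lambda>x. C * cmod (f x))" using assms(1) by simp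
  show "AE x in M. norm (g x * f x) \<le> norm (C * cmod (f x))"
    using assms(3) by (auto simp: norm_mult abs_mult intro!: mult_right_mono order_trans[OF assms(3) abs_ge_self])
qed (use assms in auto)

text \<open>A gliding hump: \<open>\<phi>\<close> is rebuilt on smaller and smaller sets \<open>E\<^sub>j\<close>, each time with the sign
  that makes the integral against \<open>u (k j)\<close> large.\<close>

lemma (in finite_measure) weakly_null_uniformly_absolutely_continuous:
  fixes u :: "nat \<Rightarrow> 'a \<Rightarrow> complex"
  assumes u: "\<And>n. integrable M (u n)"
    and null: "\<And>\<phi>. \<phi> \<in> borel_measurable M \<Longrightarrow> (\<And>x. cmod (\<phi> x) \<le> 1) \<Longrightarrow>
                 (\<lambda>n. \<integral>x. \<phi> x * u n x \<partial>M) \<longlonglongrightarrow> 0"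
    and e: "e > 0"
  obtains d where "d > 0"
    "\<And>n E. E \<in> sets M \<Longrightarrow> measure M E < d \<Longrightarrow> (\<integral>x. indicator E x * cmod (u n x) \<partial>M) \<le> e"
proof (rule ccontr)
  have [measurable]: "u n \<in> borel_measurable M" for n by (rule borel_measurable_integrable[OF u])
  have iE: "integrable M (\<lambda>x. indicator E x * cmod (u n x))" if [measurable]: "E \<in> sets M" for E n
    by (rule Bochner_Integration.integrable_bound[OF u[of n]]) (auto simp: indicator_def)
  assume "\<not> thesis"
  note not_thesis = this and thesisI = that
  then have bad: "\<exists>n E. E \<in> sets M \<and> measure M E < d \<and> (\<integral>x. indicator E x * cmod (u n x) \<partial>M) > e"
    if "d > 0" for d
    using thesisI[OF that] not_thesis by (meson not_le)
  \<comment> \<open>In a state \<open>(\<phi>, k, d)\<close> the function \<phi> detects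
    \<open>u k\<close>, and \<open>d\<close> is a tolerance: altering \<phi> by at most 2 on a set
    of measure below \<open>d\<close> changes the integral by at most \<open>2 * (e / 4)\<close>, so
    half of \<open>e\<close> survives.\<close>
  define ok where "ok = (\<lambda>(\<phi>, k, d). \<phi> \<in> borel_measurable M \<and> (\<forall>x. cmod (\<phi> x) \<le> 1) \<and> d > 0
     \<and> e < cmod (\<integral>x. \<phi> x * u k x \<partial>M)
     \<and> (\<forall>E\<in>sets M. measure M E < d \<longrightarrow> (\<integral>x. indicator E x * cmod (u k x) \<partial>M) \<le> e / 4))"
  \<comment> \<open>The bounds \<open>d / 4\<close> and \<open>d' \<le> d / 2\<close> make the
    measures of all later exceptional sets sum to at most \<open>d / 2\<close>.\<close>
  define step where "step = (\<lambda>(\<phi>::'a\<Rightarrow>complex, k::nat, d::real) (\<phi>', k', d').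
     k < k' \<and> d' \<le> d / 2 \<and>
     (\<exists>E\<in>sets M. measure M E < d / 4 \<and> (\<forall>x. x \<notin> E \<longrightarrow> \<phi>' x = \<phi> x)))"
  \<comment> \<open>The premises leave out the lower bound contained in \<open>ok\<close>, so that
    the recursion can start from the zero function, which is not an \<open>ok\<close> state
    itself.\<close>
  have next_state: "\<exists>s. ok s \<and> step (\<phi>, k, d) s"
    if \<phi>[measurable]: "\<phi> \<in> borel_measurable M" and \<phi>1: "\<And>x. cmod (\<phi> x) \<le> 1" and d: "d > 0" for \<phi> k d
  proof -
    have "\<exists>\<delta>>0. \<forall>n\<le>k. \<forall>E\<in>sets M. measure M E < \<delta> \<longrightarrow> (\<integral>x. indicator E x * cmod (u n x) \<partial>M) \<le> e" for k
    proof (induction k)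
      case 0
      then show ?case using integral_absolutely_continuous[OF u[of 0] e] by (metis le_zero_eq)
    next
      case (Suc k)
      then obtain \<delta> where 1: "\<delta> > 0"
        "\<And>n E. n \<le> k \<Longrightarrow> E \<in> sets M \<Longrightarrow> measure M E < \<delta> \<Longrightarrow> (\<integral>x. indicator E x * cmod (u n x) \<partial>M) \<le> e" by blast
      obtain \<delta>' where 2: "\<delta>' > 0"
        "\<And>E. E \<in> sets M \<Longrightarrow> measure M E < \<delta>' \<Longrightarrow> (\<integral>x. indicator E x * cmod (u (Suc k) x) \<partial>M) \<le> e"
        using integral_absolutely_continuous[OF u[of "Suc k"] e] by metis
      show ?case
        by (rule exI[of _ "min \<delta> \<delta>'"]) (use 1 2 in \<open>auto simp: le_Suc_eq\<close>)
    qed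
    then obtain \<delta> where \<delta>: "\<delta> > 0"
      "\<And>n E. n \<le> k \<Longrightarrow> E \<in> sets M \<Longrightarrow> measure M E < \<delta> \<Longrightarrow> (\<integral>x. indicator E x * cmod (u n x) \<partial>M) \<le> e" by blast
    obtain n E where E[measurable]: "E \<in> sets M" and Es: "measure M E < min \<delta> (d/4)"
      and big: "(\<integral>x. indicator E x * cmod (u n x) \<partial>M) > e"
      using bad[of "min \<delta> (d/4)"] \<delta> d by auto
    \<comment> \<open>A common \<delta> serves all indices up to \<open>k\<close>, so a set that
      violates the bound must belong to a later index.\<close>
    have kn: "k < n" using \<delta>(2)[of n E] E Es big by fastforce
    define \<psi> where "\<psi> \<theta> x = (if x \<in> E then \<theta> * cnj (sgn (u n x)) else \<phi> x)" for \<theta> x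
    have \<psi>[measurable]: "\<psi> \<theta> \<in> borel_measurable M" for \<theta>
    proof -
      have [measurable]: "cnj \<in> borel_measurable borel"
        by (intro borel_measurable_continuous_onI continuous_intros)
      have [measurable]: "(\<lambda>x. cnj (u n x /\<^sub>R cmod (u n x))) \<in> borel_measurable M"
        by (rule measurable_compose[of _ _ borel]) simp_all
      show ?thesis
        unfolding \<psi>_def sgn_div_norm by measurable
    qed
    have \<psi>1: "cmod (\<psi> \<theta> x) \<le> 1" if "cmod \<theta> \<le> 1" for \<theta> x
      using \<phi>1[of x] that by (auto simp: \<psi>_def norm_mult norm_sgn)
    define I where "I = (\<integral>x. indicator E x * cmod (u n x) \<partial>M)"
    define X where "X = (\<integral>x. (indicator (-E) x * \<phi> x) * u n x \<partial>M)"
    have iX: "integrable M (\<lambda>x. (indicator (-E) x * \<phi> x) * u n x)"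
      by (rule integrable_mult_bounded[OF u, where C=1]) (use \<phi>1 in \<open>auto simp: indicator_def\<close>)
    have int: "(\<integral>x. \<psi> \<theta> x * u n x \<partial>M) = \<theta> * of_real I + X" for \<theta>
    proof -
      have s: "cnj (sgn z) * z = of_real (cmod z)" for z :: complex
      proof -
        have "cnj (sgn z) * z = (z * cnj z) / of_real (cmod z)" by (simp add: sgn_eq)
        also have "\<dots> = of_real (cmod z)"
          by (simp add: complex_norm_square[symmetric] power2_eq_square)
        finally show ?thesis .
      qed
      have "(\<integral>x. \<psi> \<theta> x * u n x \<partial>M)
          = (\<integral>x. \<theta> * of_real (indicator E x * cmod (u n x)) + (indicator (-E) x * \<phi> x) * u n x \<partial>M)"
        by (rule Bochner_Integration.integral_cong) (auto simp: \<psi>_def indicator_def s mult.assoc)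
      also have "\<dots> = \<theta> * of_real I + X"
        unfolding I_def X_def using iX iE[OF E, of n]
        by (subst Bochner_Integration.integral_add) (auto simp del: of_real_mult)
      finally show ?thesis .
    qed
    \<comment> \<open>The values for the two signs are \<open>I + X\<close> and
      \<open>X - I\<close>; their difference has modulus \<open>2 * I\<close>, so they cannot both
      be smaller than \<open>I\<close>.\<close>
    have "\<exists>\<theta>\<in>{1,-1}. I \<le> cmod (\<theta> * of_real I + X)"
    proof (rule ccontr)
      assume "\<not> ?thesis"
      then have "cmod (of_real I + X) + cmod (of_real I - X) < 2 * I"
        using norm_minus_commute[of X "of_real I"] by auto
      moreover have "cmod ((of_real I + X) + (of_real I - X)) \<le> cmod (of_real I + X) + cmod (of_real I - X)"
        by (rule norm_triangle_ineq)
      moreover have "cmod ((of_real I + X) + (of_real I - X)) = 2 * \<bar>I\<bar>"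
        by (simp flip: of_real_add)
      ultimately show False by auto
    qed
    then obtain \<theta> where \<theta>: "cmod \<theta> \<le> 1" "I \<le> cmod (\<theta> * of_real I + X)"
      by (metis insertE norm_minus_cancel norm_one order_refl singletonD)
    obtain \<delta>' where \<delta>': "\<delta>' > 0"
        "\<And>E. E \<in> sets M \<Longrightarrow> measure M E < \<delta>' \<Longrightarrow> (\<integral>x. indicator E x * cmod (u n x) \<partial>M) \<le> e/4"
      using integral_absolutely_continuous[OF u[of n], of "e/4"] e by auto
    have "ok (\<psi> \<theta>, n, min \<delta>' (d/2))"
      using \<delta>' d \<psi>1[OF \<theta>(1)] big \<theta>(2) by (auto simp: ok_def int I_def)
    moreover have "step (\<phi>, k, d) (\<psi> \<theta>, n, min \<delta>' (d/2))"
      using kn E Es by (auto simp: step_def \<psi>_def intro!: bexI[of _ E])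
    ultimately show ?thesis by blast
  qed
  have "\<exists>s. \<forall>n. ok (s n) \<and> step (s n) (s (Suc n))"
  proof (rule dependent_nat_choice)
    show "\<exists>s. ok s"
      using next_state[of "\<lambda>_. 0" 1 0] by auto
    show "\<exists>t. ok t \<and> step s t" if "ok s" for s
      using next_state[of "fst s" "snd (snd s)" "fst (snd s)"] that
      by (auto simp: ok_def split_beta)
  qed
  then obtain s where s: "\<And>n. ok (s n)" "\<And>n. step (s n) (s (Suc n))" by blast
  define \<phi> where "\<phi> n = fst (s n)" for n
  define k where "k n = fst (snd (s n))" for n
  define d where "d n = snd (snd (s n))" for n
  have sn: "s n = (\<phi> n, k n, d n)" for n by (simp add: \<phi>_def k_def d_def)
  have [measurable]: "\<phi> n \<in> borel_measurable M" for n
    using s(1)[of n] by (simp add: sn ok_def)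
  have \<phi>1: "cmod (\<phi> n x) \<le> 1" and d0: "d n > 0" and big: "e < cmod (\<integral>x. \<phi> n x * u (k n) x \<partial>M)"
    and small: "\<And>E. E \<in> sets M \<Longrightarrow> measure M E < d n \<Longrightarrow> (\<integral>x. indicator E x * cmod (u (k n) x) \<partial>M) \<le> e/4"
    for n x using s(1)[of n] by (auto simp: sn ok_def)
  have kS: "k n < k (Suc n)" and dS: "d (Suc n) \<le> d n / 2"
    and ex: "\<exists>E\<in>sets M. measure M E < d n / 4 \<and> (\<forall>x. x \<notin> E \<longrightarrow> \<phi> (Suc n) x = \<phi> n x)" for n
    using s(2)[of n] by (auto simp: sn step_def)
  obtain E where E[measurable]: "\<And>n. E n \<in> sets M" and Em: "\<And>n. measure M (E n) < d n / 4"
    and \<phi>E: "\<And>n x. x \<notin> E n \<Longrightarrow> \<phi> (Suc n) x = \<phi> n x"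
    using ex by metis
  have dn: "d (n + i) \<le> d n * (1/2)^i" for n i
  proof (induction i)
    case (Suc i)
    then show ?case using dS[of "n+i"] by simp
  qed simp
  define U where "U n = (\<Union>i. E (n + i))" for n
  have [measurable]: "U n \<in> sets M" for n unfolding U_def by measurable
  have Um: "measure M (U n) < d n" for n
  proof -
    have b: "measure M (E (n + i)) \<le> d n / 4 * (1/2)^i" for i
      using Em[of "n+i"] dn[of n i] by simp
    have sm: "summable (\<lambda>i. d n / 4 * (1/2)^i)" by (intro summable_mult summable_geometric) simp
    have sE: "summable (\<lambda>i. measure M (E (n+i)))"
      by (rule summable_comparison_test'[OF sm, of 0]) (use b in auto)
    have "measure M (U n) \<le> (\<Sum>i. measure M (E (n+i)))"
      unfolding U_def by (rule finite_measure_subadditive_countably) (use sE in auto)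
    also have "\<dots> \<le> (\<Sum>i. d n / 4 * (1/2)^i)"
      by (rule suminf_le[OF b sE sm])
    also have "\<dots> = d n / 2"
      by (subst suminf_mult) (simp_all add: suminf_geometric summable_geometric)
    finally show ?thesis using d0[of n] by simp
  qed
  \<comment> \<open>At points of infinitely many \<open>E n\<close> there may be no limit. Whatever
    \<open>lim\<close> returns there, the cutoff keeps \<Phi> bounded by 1 everywhere and
    measurable.\<close>
  define \<Phi> where "\<Phi> x = (if cmod (lim (\<lambda>n. \<phi> n x)) \<le> 1 then lim (\<lambda>n. \<phi> n x) else 0)" for x
  have \<Phi>m[measurable]: "\<Phi> \<in> borel_measurable M" unfolding \<Phi>_def by measurable
  have \<Phi>1: "cmod (\<Phi> x) \<le> 1" for x by (simp add: \<Phi>_def)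
  have \<Phi>U: "\<Phi> x = \<phi> n x" if "x \<notin> U n" for x n
  proof -
    have "\<phi> (n + i) x = \<phi> n x" for i
    proof (induction i)
      case (Suc i)
      have "x \<notin> E (n + i)" using that by (auto simp: U_def)
      then show ?case using \<phi>E Suc by simp
    qed simp
    then have "(\<lambda>i. \<phi> (i + n) x) \<longlonglongrightarrow> \<phi> n x" by (simp add: add.commute)
    then have "(\<lambda>i. \<phi> i x) \<longlonglongrightarrow> \<phi> n x" by (rule LIMSEQ_offset)
    then show ?thesis using \<phi>1[of n x] by (simp add: \<Phi>_def limI)
  qed
  have large: "cmod (\<integral>x. \<Phi> x * u (k n) x \<partial>M) \<ge> e / 2" for n
  proof -
    have i1: "integrable M (\<lambda>x. \<phi> n x * u (k n) x)" "integrable M (\<lambda>x. \<Phi> x * u (k n) x)"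
      using \<phi>1 \<Phi>1 by (auto intro!: integrable_mult_bounded[OF u, where C=1])
    have "cmod ((\<integral>x. \<phi> n x * u (k n) x \<partial>M) - (\<integral>x. \<Phi> x * u (k n) x \<partial>M))
        = cmod (\<integral>x. \<phi> n x * u (k n) x - \<Phi> x * u (k n) x \<partial>M)"
      using i1 by simp
    also have "\<dots> \<le> (\<integral>x. cmod (\<phi> n x * u (k n) x - \<Phi> x * u (k n) x) \<partial>M)"
      by (rule integral_norm_bound)
    also have "\<dots> \<le> (\<integral>x. 2 * (indicator (U n) x * cmod (u (k n) x)) \<partial>M)"
    proof (rule integral_mono)
      fix x
      show "cmod (\<phi> n x * u (k n) x - \<Phi> x * u (k n) x) \<le> 2 * (indicator (U n) x * cmod (u (k n) x))"
      proof (cases "x \<in> U n")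
        case True
        have "cmod (\<phi> n x - \<Phi> x) \<le> 2"
          using norm_triangle_ineq4[of "\<phi> n x" "\<Phi> x"] \<phi>1[of n x] \<Phi>1[of x] by linarith
        then show ?thesis using True
          by (simp add: left_diff_distrib[symmetric] norm_mult mult_right_mono)
      qed (use \<Phi>U in simp)
    qed (use i1 iE in auto)
    also have "\<dots> \<le> 2 * (e/4)"
      using small[of "U n" n] Um[of n] by simp
    finally have "cmod ((\<integral>x. \<phi> n x * u (k n) x \<partial>M) - (\<integral>x. \<Phi> x * u (k n) x \<partial>M)) \<le> e/2" by simp
    then show ?thesis
      using big[of n] norm_triangle_ineq2[of "\<integral>x. \<phi> n x * u (k n) x \<partial>M" "\<integral>x. \<Phi> x * u (k n) x \<partial>M"] by linarith
  qed
  have "strict_mono k" using kS by (simp add: strict_mono_Suc_iff)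
  then have "(\<lambda>n. \<integral>x. \<Phi> x * u (k n) x \<partial>M) \<longlonglongrightarrow> 0"
    using LIMSEQ_subseq_LIMSEQ[OF null[OF \<Phi>m \<Phi>1]] by (simp add: o_def)
  then have "eventually (\<lambda>n. cmod (\<integral>x. \<Phi> x * u (k n) x \<partial>M) < e/2) sequentially"
    using e by (intro order_tendstoD(2)[OF tendsto_norm_zero]) auto
  then show False
    using large by (auto simp: eventually_sequentially not_less[symmetric])
qed

section \<open>Rademacher functions on a set without atoms\<close>

context finite_measure
begin

text \<open>A set that is not an atom splits into two parts of positive measure, and the smaller one
  has at most half of the measure; iteration makes the measure as small as desired but keeps it
  positive.\<close>

lemma atomless_small_subset:
  assumes atomless: "\<And>B. B \<subseteq> A \<Longrightarrow> \<not> is_atom M B"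
    and A: "A \<in> sets M" "measure M A > 0" and e: "e > 0"
  obtains C where "C \<in> sets M" "C \<subseteq> A" "measure M C > 0" "measure M C \<le> e"
proof -
  have split: "\<exists>C\<in>sets M. C \<subseteq> B \<and> measure M C > 0 \<and> measure M C \<le> measure M B / 2"
    if B: "B \<in> sets M" "B \<subseteq> A" "measure M B > 0" for B
  proof -
    have "\<not> is_atom M B" using atomless B by blast
    then obtain C where C: "C \<in> sets M" "C \<subseteq> B" "measure M C \<noteq> 0" "measure M (B - C) \<noteq> 0"
      using B by (auto simp: is_atom_def emeasure_eq_measure)
    have "measure M B = measure M C + measure M (B - C)"
      using C B finite_measure_Diff[of B C] by simp
    moreover have "measure M C > 0" "measure M (B - C) > 0"
      using C by (simp_all add: zero_less_measure_iff)
    ultimately show ?thesis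
      using C B by (cases "measure M C \<le> measure M B / 2") (auto intro: bexI[of _ C] bexI[of _ "B - C"])
  qed
  have "\<exists>C\<in>sets M. C \<subseteq> A \<and> measure M C > 0 \<and> measure M C \<le> measure M A * (1/2)^n" for n
  proof (induction n)
    case 0
    then show ?case using A by auto
  next
    case (Suc n)
    then obtain B where B: "B \<in> sets M" "B \<subseteq> A" "measure M B > 0" "measure M B \<le> measure M A * (1/2)^n"
      by blast
    from split[OF B(1-3)] obtain C where "C \<in> sets M" "C \<subseteq> B" "measure M C > 0" "measure M C \<le> measure M B / 2"
      by blast
    then show ?case using B by (intro bexI[of _ C]) auto
  qed
  moreover obtain n where "(1/2::real)^n < e / measure M A"
    using real_arch_pow_inv[of "e / measure M A" "1/2"] A e by auto
  then have "measure M A * (1/2)^n \<le> e" using A by (simp add: field_simps)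
  ultimately show ?thesis using that by (meson order_trans)
qed

text \<open>Greedy exhaustion: each step adds at least half of what can still be added.\<close>

lemma atomless_half:
  assumes atomless: "\<And>B. B \<subseteq> A \<Longrightarrow> \<not> is_atom M B" and A: "A \<in> sets M"
  obtains H where "H \<in> sets M" "H \<subseteq> A" "measure M H = measure M A / 2"
proof -
  define t where "t = measure M A / 2"
  define cand where "cand E = {C \<in> sets M. C \<subseteq> A - E \<and> measure M (E \<union> C) \<le> t}" for E
  define sz where "sz E = (SUP C\<in>cand E. measure M C)" for E
  have bdd: "bdd_above (measure M ` cand E)" for E
    by (auto intro!: bdd_aboveI[of _ "measure M (space M)"] bounded_measure)
  have t0: "t \<ge> 0" by (simp add: t_def)
  have "\<exists>E. \<forall>n. (E n \<in> sets M \<and> E n \<subseteq> A \<and> measure M (E n) \<le> t) \<and>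
      (\<exists>C\<in>cand (E n). E (Suc n) = E n \<union> C \<and> sz (E n) \<le> 2 * measure M C)"
  proof (rule dependent_nat_choice)
    show "\<exists>E. E \<in> sets M \<and> E \<subseteq> A \<and> measure M E \<le> t"
      by (rule exI[of _ "{}"]) (use t0 in simp)
  next
    fix E assume E: "E \<in> sets M \<and> E \<subseteq> A \<and> measure M E \<le> t"
    have ne: "{} \<in> cand E" using E by (simp add: cand_def)
    have "\<exists>C\<in>cand E. sz E \<le> 2 * measure M C"
    proof (cases "sz E > 0")
      case True
      then have "sz E / 2 < sz E" by simp
      then show ?thesis
        using less_cSUP_iff[OF _ bdd, of E "sz E / 2"] ne unfolding sz_def[symmetric]
        by (force intro: less_imp_le)
    next
      case False
      then show ?thesis using ne by (intro bexI[of _ "{}"]) auto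
    qed
    then obtain C where "C \<in> cand E" "sz E \<le> 2 * measure M C" by blast
    then show "\<exists>E'. (E' \<in> sets M \<and> E' \<subseteq> A \<and> measure M E' \<le> t) \<and> (\<exists>C\<in>cand E. E' = E \<union> C \<and> sz E \<le> 2 * measure M C)"
      using E by (intro exI[of _ "E \<union> C"]) (auto simp: cand_def)
  qed
  then obtain E where E: "\<And>n. E n \<in> sets M" "\<And>n. E n \<subseteq> A" "\<And>n. measure M (E n) \<le> t"
    and step: "\<And>n. \<exists>C\<in>cand (E n). E (Suc n) = E n \<union> C \<and> sz (E n) \<le> 2 * measure M C" by blast
  define H where "H = (\<Union>n. E n)"
  have H: "H \<in> sets M" "H \<subseteq> A" using E by (auto simp: H_def)
  have inc: "incseq E" using step by (intro incseq_SucI) blast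
  have lim: "(\<lambda>n. measure M (E n)) \<longlonglongrightarrow> measure M H"
    unfolding H_def by (rule finite_Lim_measure_incseq) (use E inc in auto)
  have Ht: "measure M H \<le> t" by (rule LIMSEQ_le_const2[OF lim]) (use E in auto)
  have "measure M H = t"
  proof (rule ccontr)
    assume "measure M H \<noteq> t"
    then have lt: "measure M H < t" using Ht by simp
    have mAH: "measure M (A - H) = measure M A - measure M H"
      using H A by (simp add: finite_measure_Diff)
    obtain C where C: "C \<in> sets M" "C \<subseteq> A - H" "measure M C > 0" "measure M C \<le> t - measure M H"
    proof (rule atomless_small_subset[of "A - H" "t - measure M H"])
      show "measure M (A - H) > 0" using mAH lt t0 by (simp only: t_def)
      show "\<not> is_atom M B" if "B \<subseteq> A - H" for B using atomless[of B] that by blast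
    qed (use H A lt in auto)
    \<comment> \<open>The leftover piece \<open>C\<close> is admissible at every stage, so every
      stage gains at least half of its measure; convergence of the measures of \<open>E n\<close>
      forces these gains to 0.\<close>
    have "measure M C \<le> 2 * (measure M (E (Suc n)) - measure M (E n))" for n
    proof -
      have EH: "E n \<subseteq> H" by (auto simp: H_def)
      have "measure M (E n \<union> C) \<le> measure M (E n) + measure M C"
        using E C by (intro measure_Un_le) auto
      also have "\<dots> \<le> measure M H + measure M C"
        using H EH by (simp add: finite_measure_mono)
      finally have "C \<in> cand (E n)" using C EH by (auto simp: cand_def)
      then have "measure M C \<le> sz (E n)" unfolding sz_def by (intro cSUP_upper bdd)
      moreover obtain D where D: "D \<in> cand (E n)" "E (Suc n) = E n \<union> D" "sz (E n) \<le> 2 * measure M D"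
        using step by blast
      moreover have "measure M (E n \<union> D) = measure M (E n) + measure M D"
        using D E by (intro finite_measure_Union) (auto simp: cand_def)
      ultimately show ?thesis by simp
    qed
    moreover have "(\<lambda>n. 2 * (measure M (E (Suc n)) - measure M (E n))) \<longlonglongrightarrow> 2 * (measure M H - measure M H)"
      by (intro tendsto_intros lim LIMSEQ_Suc)
    ultimately have "measure M C \<le> 2 * (measure M H - measure M H)"
      by (intro LIMSEQ_le_const) auto
    then show False using C by simp
  qed
  then show ?thesis using that H by (simp add: t_def)
qed

text \<open>\<open>v\<close> labels the cells that the earlier signs cut out of \<open>A\<close>.\<close>

lemma atomless_balanced_sign:
  fixes v :: "'a \<Rightarrow> nat"
  assumes atomless: "\<And>B. B \<subseteq> A \<Longrightarrow> \<not> is_atom M B" and A: "A \<in> sets M"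
    and v: "v \<in> measurable M (count_space UNIV)" and vN: "\<And>x. v x < N"
  obtains s :: "'a \<Rightarrow> real" where "s \<in> borel_measurable M" "\<And>x. s x = 1 \<or> s x = -1"
    "\<And>k. (\<integral>x. indicator A x * (indicator {x. v x = k} x * s x) \<partial>M) = 0"
proof -
  note [measurable] = A v
  define cell where "cell k = {x \<in> space M. x \<in> A \<and> v x = k}" for k
  have cm[measurable]: "cell k \<in> sets M" for k unfolding cell_def by measurable
  have AM: "x \<in> space M" if "x \<in> A" for x using that A sets.sets_into_space by blast
  have "\<exists>H. H \<in> sets M \<and> H \<subseteq> cell k \<and> measure M H = measure M (cell k) / 2" for k
    by (rule atomless_half[OF _ cm]) (use atomless in \<open>auto simp: cell_def\<close>)
  then obtain H where H[measurable]: "\<And>k. H k \<in> sets M" and Hc: "\<And>k. H k \<subseteq> cell k"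
    and Hm: "\<And>k. measure M (H k) = measure M (cell k) / 2" by metis
  define U where "U = (\<Union>k<N. H k)"
  have [measurable]: "U \<in> sets M" unfolding U_def by measurable
  define s :: "'a \<Rightarrow> real" where "s x = (if x \<in> U then 1 else -1)" for x
  show ?thesis
  proof (rule that[of s])
    show "s \<in> borel_measurable M" unfolding s_def by measurable
    show "s x = 1 \<or> s x = -1" for x by (simp add: s_def)
    fix k
    have UH: "x \<in> U \<longleftrightarrow> x \<in> H k" if "x \<in> cell k" for x
      using that Hc vN[of x] by (auto simp: U_def cell_def)
    have "(\<integral>x. indicator A x * (indicator {x. v x = k} x * s x) \<partial>M)
        = (\<integral>x. 2 * indicator (H k) x - indicator (cell k) x \<partial>M)"
    proof (rule Bochner_Integration.integral_cong)
      fix x assume "x \<in> space M"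
      show "indicator A x * (indicator {x. v x = k} x * s x) = 2 * indicator (H k) x - indicator (cell k) x"
        using UH[of x] Hc[of k] \<open>x \<in> space M\<close> by (auto simp: s_def cell_def indicator_def)
    qed simp
    also have "\<dots> = 0"
      using Hm[of k] H[of k] cm[of k] by (simp add: emeasure_eq_measure)
    finally show "(\<integral>x. indicator A x * (indicator {x. v x = k} x * s x) \<partial>M) = 0" .
  qed
qed

text \<open>The label \<open>v n\<close> encodes the signs \<open>r 0\<close>, ...,
  \<open>r (n - 1)\<close> as a binary number. A product over smaller indices is therefore constant
  on the cells of \<open>v n\<close>, and the factor of largest index integrates to 0 on each of
  them.\<close>

lemma atomless_Rademacher:
  assumes atomless: "\<And>B. B \<subseteq> A \<Longrightarrow> \<not> is_atom M B" and A: "A \<in> sets M"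
  obtains r :: "nat \<Rightarrow> 'a \<Rightarrow> real" where "\<And>n. r n \<in> borel_measurable M"
    "\<And>n x. r n x = 1 \<or> r n x = -1"
    "\<And>F. finite F \<Longrightarrow> F \<noteq> {} \<Longrightarrow> (\<integral>x. indicator A x * (\<Prod>i\<in>F. r i x) \<partial>M) = 0"
proof -
  define P where "P n = (\<lambda>(v :: 'a \<Rightarrow> nat, s :: 'a \<Rightarrow> real). v \<in> measurable M (count_space UNIV) \<and> (\<forall>x. v x < 2^n) \<and>
     s \<in> borel_measurable M \<and> (\<forall>x. s x = 1 \<or> s x = -1) \<and>
     (\<forall>k. (\<integral>x. indicator A x * (indicator {x. v x = k} x * s x) \<partial>M) = 0))" for n :: nat
  define Q where "Q = (\<lambda>(v :: 'a \<Rightarrow> nat, s :: 'a \<Rightarrow> real) (v' :: 'a \<Rightarrow> nat, s' :: 'a \<Rightarrow> real).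
     v' = (\<lambda>x. 2 * v x + (if s x = 1 then 1 else 0)))"
  have "\<exists>p. \<forall>n. P n (p n) \<and> Q (p n) (p (Suc n))"
  proof (rule dependent_nat_choice)
    show "\<exists>p. P 0 p"
    proof (rule atomless_balanced_sign[OF atomless A, of "\<lambda>_. 0" 1])
      fix s :: "'a \<Rightarrow> real"
      assume "s \<in> borel_measurable M" "\<And>x. s x = 1 \<or> s x = -1"
        "\<And>k. (\<integral>x. indicator A x * (indicator {x. (0::nat) = k} x * s x) \<partial>M) = 0"
      then have "P 0 (\<lambda>_. 0, s)" by (simp add: P_def)
      then show ?thesis by blast
    qed auto
  next
    fix p n assume p: "P n p"
    obtain v s where ps: "p = (v, s)" by fastforce
    have [measurable]: "v \<in> measurable M (count_space UNIV)" "s \<in> borel_measurable M" and vn: "\<And>x. v x < 2^n"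
      using p by (auto simp: P_def ps)
    define v' where "v' = (\<lambda>x. 2 * v x + (if s x = 1 then 1 else 0))"
    have v': "v' \<in> measurable M (count_space UNIV)" unfolding v'_def by measurable
    have v'n: "v' x < 2^Suc n" for x using vn[of x] by (auto simp: v'_def)
    show "\<exists>q. P (Suc n) q \<and> Q p q"
      by (rule atomless_balanced_sign[OF atomless A v' v'n])
        (use v' v'n in \<open>auto simp: P_def Q_def ps v'_def[symmetric]\<close>)
  qed
  then obtain p where p: "\<And>n. P n (p n)" "\<And>n. Q (p n) (p (Suc n))" by blast
  define v where "v n = fst (p n)" for n
  define r where "r n = snd (p n)" for n
  have pn: "p n = (v n, r n)" for n by (simp add: v_def r_def)
  have vm[measurable]: "v n \<in> measurable M (count_space UNIV)" and vN: "v n x < 2^n"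
    and rm[measurable]: "r n \<in> borel_measurable M" and r1: "r n x = 1 \<or> r n x = -1"
    and bal: "(\<integral>x. indicator A x * (indicator {x. v n x = k} x * r n x) \<partial>M) = 0" for n x k
    using p(1)[of n] by (auto simp: P_def pn)
  have vS: "v (Suc n) x = 2 * v n x + (if r n x = 1 then 1 else 0)" for n x
    using p(2)[of n] by (simp add: Q_def pn)
  have same: "r i x = r i y" if "v n x = v n y" "i < n" for n i x y
    using that
  proof (induction n)
    case (Suc n)
    have "2 * v n x + (if r n x = 1 then 1 else 0) = 2 * v n y + (if r n y = 1 then 1 else 0)"
      using Suc.prems(1) by (simp only: vS)
    then have "v n x = v n y \<and> (r n x = 1 \<longleftrightarrow> r n y = 1)"
      by (auto split: if_splits) presburger+
    then show ?case using Suc r1[of n x] r1[of n y] by (auto simp: less_Suc_eq)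
  qed simp
  show ?thesis
  proof (rule that[of r])
    fix F :: "nat set" assume F: "finite F" "F \<noteq> {}"
    define n where "n = Max F"
    define G where "G = F - {n}"
    have FG: "F = insert n G" "n \<notin> G" "finite G" using Max_in[OF F] F(1) by (auto simp: G_def n_def)
    have Gn: "i < n" if "i \<in> G" for i
      using that Max_ge[OF F(1), of i] by (auto simp: G_def n_def)
    \<comment> \<open>A point chosen from the cell stands for the sign pattern common to the cell;
      labels that do not occur get the value 0.\<close>
    define w where "w k = (if \<exists>x. v n x = k then \<Prod>i\<in>G. r i (SOME x. v n x = k) else 0)" for k
    have w: "(\<Prod>i\<in>G. r i x) = w (v n x)" for x
    proof -
      have "v n (SOME y. v n y = v n x) = v n x" by (rule someI[of _ x]) simp
      then show ?thesis unfolding w_def using Gn same[of n x "SOME y. v n y = v n x"]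
        by (auto intro!: prod.cong)
    qed
    have "(\<integral>x. indicator A x * (\<Prod>i\<in>F. r i x) \<partial>M)
        = (\<integral>x. (\<Sum>k<2^n. w k * (indicator A x * (indicator {x. v n x = k} x * r n x))) \<partial>M)"
    proof (rule Bochner_Integration.integral_cong)
      fix x
      have "(\<Sum>k<2^n. w k * (indicator A x * (indicator {x. v n x = k} x * r n x)))
          = (\<Sum>k<2^n. if v n x = k then w k * (indicator A x * r n x) else 0)"
        by (intro sum.cong) (auto simp: indicator_def)
      also have "\<dots> = w (v n x) * (indicator A x * r n x)"
        using vN[where n=n and x=x] by (subst sum.delta') auto
      finally show "indicator A x * (\<Prod>i\<in>F. r i x) = (\<Sum>k<2^n. w k * (indicator A x * (indicator {x. v n x = k} x * r n x)))"
        using FG w[of x] by simp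
    qed simp
    also have "\<dots> = (\<Sum>k<2^n. w k * (\<integral>x. indicator A x * (indicator {x. v n x = k} x * r n x) \<partial>M))"
    proof (subst Bochner_Integration.integral_sum)
      fix k
      have "\<bar>r n x\<bar> = 1" for x using r1[of n x] by auto
      then have "integrable M (\<lambda>x. indicator A x * (indicator {x. v n x = k} x * r n x))"
        using A by (intro integrable_const_bound[of _ 1]) (auto simp: indicator_def)
      then show "integrable M (\<lambda>x. w k * (indicator A x * (indicator {x. v n x = k} x * r n x)))" by simp
    qed simp
    also have "\<dots> = 0" using bal by simp
    finally show "(\<integral>x. indicator A x * (\<Prod>i\<in>F. r i x) \<partial>M) = 0" .
  qed (use rm r1 in auto)
qed

end

section \<open>A Riesz product operator\<close>

text \<open>The signs are prescribed at every point, also off \<open>A\<close>, so that squares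
  equal to 1 are identities rather than almost everywhere statements. Vanishing of all mixed means
  expresses independence and fairness of the signs on the normalized set \<open>A\<close>.\<close>

locale rademacher_system = finite_measure M for M :: "'a measure" +
  fixes A :: "'a set" and r :: "nat \<Rightarrow> 'a \<Rightarrow> real"
  assumes A[measurable]: "A \<in> sets M" and A_pos: "measure M A > 0"
    and r_measurable[measurable]: "\<And>n. r n \<in> borel_measurable M"
    and r_sign: "\<And>n x. r n x = 1 \<or> r n x = -1"
    and r_mean: "\<And>F. finite F \<Longrightarrow> F \<noteq> {} \<Longrightarrow> (\<integral>x. indicator A x * (\<Prod>i\<in>F. r i x) \<partial>M) = 0"
begin

abbreviation "a \<equiv> measure M A"

section \<open>Walsh functions: orthogonality, Parseval and Bessel\<close>

definition walsh :: "nat set \<Rightarrow> 'a \<Rightarrow> real" where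
  "walsh F x = indicator A x * (\<Prod>i\<in>F. r i x)"

lemma walsh_measurable[measurable]: "walsh F \<in> borel_measurable M"
  unfolding walsh_def[abs_def] by measurable

lemma abs_prod_r: "\<bar>\<Prod>i\<in>F. r i x\<bar> = 1"
proof -
  have "\<bar>r i x\<bar> = 1" for i using r_sign[of i x] by auto
  then show ?thesis by (simp add: abs_prod)
qed

lemma abs_walsh: "\<bar>walsh F x\<bar> = indicator A x"
  by (simp add: walsh_def abs_mult abs_prod_r)

lemma abs_walsh_le: "\<bar>walsh F x\<bar> \<le> 1"
  by (simp add: abs_walsh indicator_def)

lemma walsh_integrable[simp]: "integrable M (walsh F)"
  by (rule integrable_const_bound[of _ 1]) (auto simp: abs_walsh_le)

lemma walsh_mult:
  assumes "finite F" "finite G"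
  shows "walsh F x * walsh G x = walsh ((F - G) \<union> (G - F)) x"
proof -
  have sq: "r i x * r i x = 1" for i using r_sign[of i x] by auto
  have "(\<Prod>i\<in>F. r i x) = (\<Prod>i\<in>F-G. r i x) * (\<Prod>i\<in>F\<inter>G. r i x)"
    using assms by (subst prod.union_disjoint[symmetric]) (auto intro: prod.cong)
  moreover have "(\<Prod>i\<in>G. r i x) = (\<Prod>i\<in>G-F. r i x) * (\<Prod>i\<in>F\<inter>G. r i x)"
    using assms by (subst prod.union_disjoint[symmetric]) (auto intro: prod.cong)
  moreover have "(\<Prod>i\<in>F\<inter>G. r i x) * (\<Prod>i\<in>F\<inter>G. r i x) = 1"
    by (simp add: prod.distrib[symmetric] sq)
  moreover have "(\<Prod>i\<in>(F-G)\<union>(G-F). r i x) = (\<Prod>i\<in>F-G. r i x) * (\<Prod>i\<in>G-F. r i x)"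
    using assms by (intro prod.union_disjoint) auto
  ultimately show ?thesis
    by (simp add: walsh_def indicator_def)
qed

lemma integral_walsh: "finite F \<Longrightarrow> (\<integral>x. walsh F x \<partial>M) = (if F = {} then a else 0)"
  using r_mean[of F] A by (auto simp: walsh_def)

lemma walsh_orthogonal:
  assumes "finite F" "finite G"
  shows "(\<integral>x. walsh F x * walsh G x \<partial>M) = (if F = G then a else 0)"
  using assms by (auto simp: walsh_mult integral_walsh)

lemma walsh_mult_integrable[simp]:
  assumes "finite F" "finite G"
  shows "integrable M (\<lambda>x. walsh F x * walsh G x)"
  using assms by (simp add: walsh_mult)

text \<open>The weights \<open>t\<close> may depend on a second point, so one expansion covers the
  kernels of the operators, the indicators of cells and the product of square roots. The mean is
  always \<open>a\<close>, since only \<open>F = {}\<close> contributes.\<close>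

lemma riesz_product_expand:
  assumes "finite B"
  shows "indicator A x * (\<Prod>i\<in>B. 1 + t i * r i x) = (\<Sum>F\<in>Pow B. (\<Prod>i\<in>F. t i) * walsh F x)"
proof -
  have "(\<Prod>i\<in>B. t i * r i x + 1) = (\<Sum>F\<in>Pow B. (\<Prod>i\<in>F. t i * r i x) * (\<Prod>i\<in>B-F. 1))"
    by (rule prod_add[OF assms])
  then show ?thesis
    by (simp add: walsh_def prod.distrib sum_distrib_left add.commute mult_ac)
qed

lemma integral_riesz_product:
  assumes "finite B"
  shows "(\<integral>x. indicator A x * (\<Prod>i\<in>B. 1 + t i * r i x) \<partial>M) = a"
proof -
  have "(\<integral>x. indicator A x * (\<Prod>i\<in>B. 1 + t i * r i x) \<partial>M)
      = (\<Sum>F\<in>Pow B. (\<Prod>i\<in>F. t i) * (\<integral>x. walsh F x \<partial>M))"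
    unfolding riesz_product_expand[OF assms] by (subst Bochner_Integration.integral_sum) auto
  also have "\<dots> = (\<Sum>F\<in>Pow B. if F = {} then a else 0)"
    using assms by (intro sum.cong) (auto simp: integral_walsh finite_subset)
  also have "\<dots> = a" using assms by (subst sum.delta) auto
  finally show ?thesis .
qed

lemma parseval:
  assumes "finite \<F>" "\<And>F. F \<in> \<F> \<Longrightarrow> finite F"
  shows "(\<integral>x. (cmod (\<Sum>F\<in>\<F>. c F * of_real (walsh F x)))\<^sup>2 \<partial>M) = a * (\<Sum>F\<in>\<F>. (cmod (c F))\<^sup>2)"
proof -
  have "complex_of_real (\<integral>x. (cmod (\<Sum>F\<in>\<F>. c F * of_real (walsh F x)))\<^sup>2 \<partial>M)
      = (\<integral>x. (\<Sum>F\<in>\<F>. c F * of_real (walsh F x)) * cnj (\<Sum>F\<in>\<F>. c F * of_real (walsh F x)) \<partial>M)"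
    by (subst integral_complex_of_real[symmetric]) (simp only: complex_norm_square)
  also have "\<dots> = (\<integral>x. (\<Sum>F\<in>\<F>. \<Sum>G\<in>\<F>. c F * cnj (c G) * of_real (walsh F x * walsh G x)) \<partial>M)"
    by (simp add: sum_product mult_ac)
  also have "\<dots> = (\<Sum>F\<in>\<F>. \<Sum>G\<in>\<F>. c F * cnj (c G) * of_real (\<integral>x. walsh F x * walsh G x \<partial>M))"
    using assms by (simp del: of_real_mult add: Bochner_Integration.integral_sum)
  also have "\<dots> = (\<Sum>F\<in>\<F>. \<Sum>G\<in>\<F>. if F = G then c F * cnj (c G) * of_real a else 0)"
    using assms by (intro sum.cong) (auto simp: walsh_orthogonal)
  also have "\<dots> = (\<Sum>F\<in>\<F>. c F * cnj (c F) * of_real a)"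
    using assms by (intro sum.cong refl) (simp add: sum.delta)
  also have "\<dots> = of_real (a * (\<Sum>F\<in>\<F>. (cmod (c F))\<^sup>2))"
    by (simp add: sum_distrib_left complex_norm_square mult_ac del: of_real_power)
  finally show ?thesis by (simp only: of_real_eq_iff)
qed

lemma walsh_sum_integrable[simp]: "integrable M (\<lambda>x. \<Sum>F\<in>\<F>. c F * complex_of_real (walsh F x))"
  by (intro Bochner_Integration.integrable_sum integrable_mult_right integrable_of_real walsh_integrable)

text \<open>Cauchy--Schwarz on \<open>A\<close>, in the form that the variance of the modulus over
  \<open>A\<close> is nonnegative: with mean \<open>t\<close> and mean square \<open>s\<close> this
  says \<open>t^2 \<le> s\<close>.\<close>

lemma walsh_sum_L1:
  assumes "finite \<F>" "\<And>F. F \<in> \<F> \<Longrightarrow> finite F"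
  shows "(\<integral>x. cmod (\<Sum>F\<in>\<F>. c F * of_real (walsh F x)) \<partial>M) \<le> a * sqrt (\<Sum>F\<in>\<F>. (cmod (c F))\<^sup>2)"
proof -
  define p where "p x = cmod (\<Sum>F\<in>\<F>. c F * of_real (walsh F x))" for x
  define t where "t = (\<integral>x. p x \<partial>M) / a"
  define s where "s = (\<Sum>F\<in>\<F>. (cmod (c F))\<^sup>2)"
  have t: "(\<integral>x. p x \<partial>M) = a * t" using A_pos by (simp add: t_def)
  have ip: "integrable M p" unfolding p_def by (rule integrable_norm) simp
  have pb: "\<bar>p x\<bar> \<le> (\<Sum>F\<in>\<F>. cmod (c F))" for x
    unfolding p_def abs_norm_cancel
    by (rule order_trans[OF norm_sum]) (auto simp: norm_mult abs_walsh_le mult_left_le intro!: sum_mono)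
  have ip2: "integrable M (\<lambda>x. (p x)\<^sup>2)"
    by (rule integrable_const_bound[of _ "(\<Sum>F\<in>\<F>. cmod (c F))\<^sup>2"])
       (use ip pb in \<open>auto intro!: power_mono simp flip: abs_le_square_iff intro: order_trans[OF pb abs_ge_self]\<close>)
  have iA: "integrable M (\<lambda>x. indicator A x :: real)"
    using A by (intro integrable_real_indicator) (auto simp: emeasure_eq_measure)
  have "0 \<le> (\<integral>x. indicator A x * (p x - t)\<^sup>2 \<partial>M)" by (intro Bochner_Integration.integral_nonneg) simp
  also have "\<dots> = (\<integral>x. (p x)\<^sup>2 - 2 * t * p x + t\<^sup>2 * indicator A x \<partial>M)"
    by (rule Bochner_Integration.integral_cong)
       (auto simp: indicator_def p_def walsh_def power2_diff algebra_simps)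
  also have "\<dots> = a * s - 2 * t * (a * t) + t\<^sup>2 * a"
    using ip ip2 iA parseval[OF assms, of c] A by (simp add: t p_def[symmetric] s_def)
  also have "\<dots> = a * (s - t\<^sup>2)" by (simp add: power2_eq_square algebra_simps)
  finally have "t\<^sup>2 \<le> s" using A_pos by (simp add: zero_le_mult_iff)
  then have "t \<le> sqrt s" by (rule real_le_rsqrt)
  then show ?thesis
    using A_pos t by (simp add: p_def[symmetric] s_def[symmetric])
qed

text \<open>Bessel's inequality by duality: it covers all functionals bounded in the $L^1$ norm.\<close>

lemma dual_bessel:
  assumes "finite \<F>" "\<And>F. F \<in> \<F> \<Longrightarrow> finite F" and C: "C \<ge> 0"
    and le: "(\<Sum>F\<in>\<F>. (cmod (d F))\<^sup>2) \<le> C * (\<integral>x. cmod (\<Sum>F\<in>\<F>. cnj (d F) * of_real (walsh F x)) \<partial>M)"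
  shows "(\<Sum>F\<in>\<F>. (cmod (d F))\<^sup>2) \<le> (C * a)\<^sup>2"
proof -
  define s where "s = (\<Sum>F\<in>\<F>. (cmod (d F))\<^sup>2)"
  have s0: "s \<ge> 0" unfolding s_def by (intro sum_nonneg) simp
  have "s \<le> C * (a * sqrt s)"
    using order_trans[OF le mult_left_mono[OF walsh_sum_L1[OF assms(1,2)] C]] by (simp add: s_def)
  then have le: "sqrt s * sqrt s \<le> (C * a) * sqrt s" using s0 by (simp add: mult.assoc)
  have "sqrt s \<le> C * a"
  proof (cases "s = 0")
    case False
    then have "sqrt s > 0" using s0 by simp
    then show ?thesis by (rule mult_right_le_imp_le[OF le])
  qed (use C A_pos in simp)
  then show ?thesis using s0 by (simp add: s_def[symmetric] sqrt_le_D)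
qed

section \<open>Walsh coefficients\<close>

definition coef :: "nat set \<Rightarrow> ('a \<Rightarrow> complex) \<Rightarrow> complex" where
  "coef F u = (\<integral>x. of_real (walsh F x) * u x \<partial>M)"

lemma walsh_mult_u_integrable[simp]:
  assumes "integrable M u" shows "integrable M (\<lambda>x. complex_of_real (walsh F x) * u x)"
  by (rule integrable_mult_bounded[OF assms, where C=1]) (auto simp: abs_walsh_le)

lemma coef_add: "integrable M u \<Longrightarrow> integrable M v \<Longrightarrow> coef F (\<lambda>x. u x + v x) = coef F u + coef F v"
  by (simp add: coef_def distrib_left)

lemma coef_diff: "integrable M u \<Longrightarrow> integrable M v \<Longrightarrow> coef F (\<lambda>x. u x - v x) = coef F u - coef F v"
  by (simp add: coef_def right_diff_distrib)

lemma coef_mult: "coef F (\<lambda>x. c * u x) = c * coef F u"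
  by (simp add: coef_def mult.left_commute)

lemma coef_bound: "integrable M u \<Longrightarrow> cmod (coef F u) \<le> (\<integral>x. cmod (u x) \<partial>M)"
  unfolding coef_def
  by (rule order_trans[OF integral_norm_bound], rule integral_mono[OF integrable_norm integrable_norm])
     (auto simp: norm_mult abs_walsh_le mult_left_le_one_le)

lemma coef_cong_AE:
  assumes "integrable M u" "integrable M v" "AE x in M. u x = v x"
  shows "coef F u = coef F v"
  unfolding coef_def using assms by (intro integral_cong_AE) auto

lemma coef_walsh_sum:
  assumes "finite \<F>" "\<And>F. F \<in> \<F> \<Longrightarrow> finite F" "finite G"
  shows "coef G (\<lambda>x. \<Sum>F\<in>\<F>. c F * of_real (walsh F x)) = (if G \<in> \<F> then of_real a * c G else 0)"
proof -
  have "coef G (\<lambda>x. \<Sum>F\<in>\<F>. c F * of_real (walsh F x))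
      = (\<integral>x. (\<Sum>F\<in>\<F>. c F * of_real (walsh F x * walsh G x)) \<partial>M)"
    by (simp add: coef_def sum_distrib_left mult_ac)
  also have "\<dots> = (\<Sum>F\<in>\<F>. c F * of_real (\<integral>x. walsh F x * walsh G x \<partial>M))"
    using assms by (simp del: of_real_mult add: Bochner_Integration.integral_sum)
  also have "\<dots> = (\<Sum>F\<in>\<F>. if G = F then of_real a * c F else 0)"
    using assms by (intro sum.cong) (auto simp: walsh_orthogonal)
  finally show ?thesis using assms by (simp add: sum.delta)
qed

lemma coef_walsh:
  assumes "finite F" "finite G"
  shows "coef G (\<lambda>x. of_real (walsh F x)) = (if F = G then of_real a else 0)"
  using coef_walsh_sum[of "{F}" G "\<lambda>_. 1"] assms by auto

text \<open>Integration against \<open>b\<close> is a functional of norm at most \<open>C\<close>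
  for the L1 norm, and its values on the Walsh functions are the coefficients of \<open>b\<close>,
  so duality applies.\<close>

lemma bessel_bounded:
  assumes "finite \<F>" "\<And>F. F \<in> \<F> \<Longrightarrow> finite F" and b: "integrable M b" "\<And>x. cmod (b x) \<le> C"
  shows "(\<Sum>F\<in>\<F>. (cmod (coef F b))\<^sup>2) \<le> (C * a)\<^sup>2"
proof (rule dual_bessel[OF assms(1,2)])
  show C: "C \<ge> 0" using order_trans[OF norm_ge_zero b(2)] .
  let ?p = "\<lambda>x. \<Sum>F\<in>\<F>. cnj (coef F b) * of_real (walsh F x)"
  have [measurable]: "b \<in> borel_measurable M" using b(1) by simp
  have ip: "integrable M (\<lambda>x. b x * ?p x)"
    by (rule integrable_mult_bounded[where C=C]) (use b in auto)
  have "complex_of_real (\<Sum>F\<in>\<F>. (cmod (coef F b))\<^sup>2) = (\<Sum>F\<in>\<F>. cnj (coef F b) * coef F b)"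
    by (simp add: complex_norm_square mult.commute del: of_real_power)
  also have "\<dots> = (\<Sum>F\<in>\<F>. \<integral>x. cnj (coef F b) * (of_real (walsh F x) * b x) \<partial>M)"
    using b by (simp add: coef_def)
  also have "\<dots> = (\<integral>x. (\<Sum>F\<in>\<F>. cnj (coef F b) * (of_real (walsh F x) * b x)) \<partial>M)"
    using b by (intro Bochner_Integration.integral_sum[symmetric]) simp
  also have "\<dots> = (\<integral>x. b x * ?p x \<partial>M)"
    unfolding sum_distrib_left by (intro Bochner_Integration.integral_cong sum.cong refl) (simp add: mult_ac)
  finally have "(\<Sum>F\<in>\<F>. (cmod (coef F b))\<^sup>2) = cmod (\<integral>x. b x * ?p x \<partial>M)"
    by (subst (asm) eq_commute) (simp add: sum_nonneg del: of_real_sum of_real_power)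
  also have "\<dots> \<le> (\<integral>x. cmod (b x * ?p x) \<partial>M)" by (rule integral_norm_bound)
  also have "\<dots> \<le> (\<integral>x. C * cmod (?p x) \<partial>M)"
    by (intro integral_mono integrable_norm ip integrable_mult_right walsh_sum_integrable)
       (use b in \<open>auto simp: norm_mult intro: mult_right_mono\<close>)
  also have "\<dots> = C * (\<integral>x. cmod (?p x) \<partial>M)" by simp
  finally show "(\<Sum>F\<in>\<F>. (cmod (coef F b))\<^sup>2) \<le> C * (\<integral>x. cmod (?p x) \<partial>M)" .
qed

section \<open>Riesz multipliers and their finite stages\<close>

text \<open>With this choice the products of \<open>1 + (eps i)\<^sup>2\<close> over blocks telescope, and the sum of
  \<open>(eps i)\<^sup>2\<close> diverges although \<open>eps i\<close> tends to 0.\<close>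

definition eps :: "nat \<Rightarrow> real" where "eps i = 1 / sqrt (real i + 1)"

definition Eps :: "nat set \<Rightarrow> real" where "Eps F = (\<Prod>i\<in>F. eps i)"

lemma eps_pos: "eps i > 0" and eps_le_1: "eps i \<le> 1"
  by (auto simp: eps_def)

lemma eps_antimono: "i \<le> j \<Longrightarrow> eps j \<le> eps i"
  by (simp add: eps_def frac_le)

lemma eps_tendsto_0: "eps \<longlonglongrightarrow> 0"
  unfolding eps_def
  by (rule real_tendsto_divide_at_top[OF tendsto_const])
     (intro filterlim_compose[OF sqrt_at_top] filterlim_tendsto_add_at_top[OF tendsto_const filterlim_real_sequentially, of 1, unfolded add.commute[of 1]])

lemma Eps_nonneg: "Eps F \<ge> 0" and Eps_le_1: "Eps F \<le> 1"
  unfolding Eps_def using eps_pos eps_le_1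
  by (auto intro!: prod_nonneg prod_le_1 simp: less_imp_le)

text \<open>One index at or above \<open>n\<close> already contributes a factor of at most
  \<open>eps n\<close>, the others at most 1. Hence the multiplier is small off the finite set
  \<open>Pow {..<n}\<close> of frequencies.\<close>

lemma Eps_le:
  assumes "finite F" "\<not> F \<subseteq> {..<n}" shows "Eps F \<le> eps n"
proof -
  obtain i where i: "i \<in> F" "n \<le> i" using assms(2) by force
  then have "Eps F = eps i * Eps (F - {i})"
    using assms(1) by (simp add: Eps_def prod.remove)
  also have "\<dots> \<le> eps i * 1" using Eps_le_1 eps_pos[of i] by (intro mult_left_mono) auto
  also have "\<dots> \<le> eps n" using eps_antimono[OF i(2)] by simp
  finally show ?thesis .
qed

text \<open>Restriction to \<open>A\<close> followed by convolution with the Riesz product over the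
  coordinates below \<open>n\<close>. The factor \<open>1 / a\<close> is there because
  \<open>coef\<close> is not normalized: the coefficient of \<open>walsh F\<close> at
  \<open>F\<close> is \<open>a\<close>.\<close>

definition partial_op :: "nat \<Rightarrow> ('a \<Rightarrow> complex) \<Rightarrow> 'a \<Rightarrow> complex" where
  "partial_op n u x = (\<Sum>F\<in>Pow {..<n}. (of_real (Eps F / a) * coef F u) * of_real (walsh F x))"

lemma partial_op_integrable[simp]: "integrable M (partial_op n u)"
  unfolding partial_op_def[abs_def] by simp

lemma partial_op_measurable[measurable]: "partial_op n u \<in> borel_measurable M"
  by (rule borel_measurable_integrable) simp

lemma partial_op_add: "integrable M u \<Longrightarrow> integrable M v \<Longrightarrow>
   partial_op n (\<lambda>x. u x + v x) x = partial_op n u x + partial_op n v x"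
  by (simp add: partial_op_def coef_add algebra_simps sum.distrib)

lemma partial_op_mult: "partial_op n (\<lambda>x. c * u x) x = c * partial_op n u x"
  by (simp add: partial_op_def coef_mult sum_distrib_left mult_ac)

lemma partial_op_cong_AE:
  assumes "integrable M u" "integrable M v" "AE x in M. u x = v x"
  shows "partial_op n u = partial_op n v"
  unfolding partial_op_def[abs_def] coef_cong_AE[OF assms] ..

text \<open>The kernel of \<open>partial_op n\<close> is a Riesz product, hence nonnegative with all marginals equal
  to \<open>indicator A\<close>.\<close>

lemma partial_op_contraction:
  assumes u: "integrable M u"
  shows "(\<integral>x. cmod (partial_op n u x) \<partial>M) \<le> (\<integral>x. cmod (u x) \<partial>M)"
proof -
  define K where "K x y = (\<Sum>F\<in>Pow {..<n}. (Eps F / a) * walsh F x * walsh F y)" for x y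
  have K: "K x y = indicator A x * (indicator A y * (\<Prod>i<n. 1 + (eps i * r i x) * r i y)) / a" for x y
    unfolding riesz_product_expand[OF finite_lessThan]
    by (simp add: K_def sum_divide_distrib sum_distrib_left prod.distrib Eps_def walsh_def mult_ac)
  have K0: "K x y \<ge> 0" for x y
  proof -
    have "0 \<le> 1 + (eps i * r i x) * r i y" for i
      using r_sign[of i x] r_sign[of i y] eps_pos[of i] eps_le_1[of i] by auto
    then show ?thesis unfolding K using A_pos
      by (intro divide_nonneg_pos mult_nonneg_nonneg prod_nonneg) auto
  qed
  have iu: "integrable M (\<lambda>y. walsh F y * cmod (u y))" for F
    by (rule Bochner_Integration.integrable_bound[OF u]) (use u in \<open>auto simp: abs_mult abs_walsh_le mult_left_le_one_le\<close>)
  define v where "v F = (\<integral>y. walsh F y * cmod (u y) \<partial>M)" for F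
  have K_int: "(\<integral>y. K x y * cmod (u y) \<partial>M) = (\<Sum>F\<in>Pow {..<n}. (Eps F / a * v F) * walsh F x)" for x
  proof -
    have "(\<integral>y. K x y * cmod (u y) \<partial>M)
        = (\<integral>y. (\<Sum>F\<in>Pow {..<n}. (Eps F / a * walsh F x) * (walsh F y * cmod (u y))) \<partial>M)"
      by (simp only: K_def sum_distrib_right mult.assoc)
    also have "\<dots> = (\<Sum>F\<in>Pow {..<n}. \<integral>y. (Eps F / a * walsh F x) * (walsh F y * cmod (u y)) \<partial>M)"
      by (rule Bochner_Integration.integral_sum) (rule integrable_mult_right[OF iu])
    also have "\<dots> = (\<Sum>F\<in>Pow {..<n}. (Eps F / a * walsh F x) * v F)"
      by (simp only: integral_mult_right_zero v_def)
    finally show ?thesis by (simp only: mult_ac)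
  qed
  have "cmod (partial_op n u x) \<le> (\<integral>y. K x y * cmod (u y) \<partial>M)" for x
  proof -
    have "partial_op n u x = (\<Sum>F\<in>Pow {..<n}. \<integral>y. of_real (Eps F / a * walsh F x) * (of_real (walsh F y) * u y) \<partial>M)"
      unfolding partial_op_def coef_def integral_mult_right_zero by (simp only: of_real_mult mult_ac)
    also have "\<dots> = (\<integral>y. (\<Sum>F\<in>Pow {..<n}. of_real (Eps F / a * walsh F x) * (of_real (walsh F y) * u y)) \<partial>M)"
      by (rule Bochner_Integration.integral_sum[symmetric])
         (rule integrable_mult_right[OF walsh_mult_u_integrable[OF u]])
    also have "\<dots> = (\<integral>y. of_real (K x y) * u y \<partial>M)"
      by (simp only: K_def of_real_sum of_real_mult sum_distrib_right mult.assoc)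
    also have "cmod \<dots> \<le> (\<integral>y. cmod (of_real (K x y) * u y) \<partial>M)" by (rule integral_norm_bound)
    also have "\<dots> = (\<integral>y. K x y * cmod (u y) \<partial>M)" using K0 by (simp add: norm_mult)
    finally show ?thesis .
  qed
  then have "(\<integral>x. cmod (partial_op n u x) \<partial>M) \<le> (\<integral>x. (\<Sum>F\<in>Pow {..<n}. (Eps F / a * v F) * walsh F x) \<partial>M)"
    unfolding K_int by (intro integral_mono) auto
  also have "\<dots> = (\<Sum>F\<in>Pow {..<n}. (Eps F / a * v F) * (\<integral>x. walsh F x \<partial>M))"
    by (subst Bochner_Integration.integral_sum) auto
  also have "\<dots> = (\<Sum>F\<in>Pow {..<n}. if F = {} then v {} else 0)"
    using A_pos by (intro sum.cong) (auto simp: integral_walsh finite_subset Eps_def)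
  also have "\<dots> = v {}" by (simp add: sum.delta)
  also have "\<dots> \<le> (\<integral>x. cmod (u x) \<partial>M)"
    unfolding v_def by (intro integral_mono iu integrable_norm u)
      (auto simp: walsh_def indicator_def)
  finally show ?thesis .
qed

text \<open>On the frequencies between the two stages the multiplier is at most
  \<open>eps n\<close>, Bessel bounds the square sum of the coefficients, and the passage back to
  the L1 norm costs only a factor \<open>a\<close>. The bound is uniform in \<open>m\<close> and in
  all \<open>b\<close> bounded by \<open>C\<close>.\<close>

lemma partial_op_tail_bounded:
  assumes b: "integrable M b" "\<And>x. cmod (b x) \<le> C" and nm: "n \<le> m"
  shows "(\<integral>x. cmod (partial_op m b x - partial_op n b x) \<partial>M) \<le> a * C * eps n"
proof -
  let ?\<F> = "Pow {..<m} - Pow {..<n}"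
  have fin: "finite ?\<F>" "\<And>F. F \<in> ?\<F> \<Longrightarrow> finite F" by (auto intro: finite_subset)
  have C0: "C \<ge> 0" using order_trans[OF norm_ge_zero b(2)] .
  let ?c = "\<lambda>F. of_real (Eps F / a) * coef F b"
  have "partial_op m b x - partial_op n b x = (\<Sum>F\<in>?\<F>. ?c F * of_real (walsh F x))" for x
    unfolding partial_op_def using nm by (subst sum_diff) auto
  then have "(\<integral>x. cmod (partial_op m b x - partial_op n b x) \<partial>M) \<le> a * sqrt (\<Sum>F\<in>?\<F>. (cmod (?c F))\<^sup>2)"
    using walsh_sum_L1[OF fin, of ?c] by simp
  also have "\<dots> \<le> a * sqrt ((C * eps n)\<^sup>2)"
  proof (intro mult_left_mono real_sqrt_le_mono)
    have "(\<Sum>F\<in>?\<F>. (cmod (?c F))\<^sup>2) \<le> (\<Sum>F\<in>?\<F>. (eps n / a)\<^sup>2 * (cmod (coef F b))\<^sup>2)"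
    proof (intro sum_mono)
      fix F assume "F \<in> ?\<F>"
      then have "Eps F \<le> eps n" using fin by (intro Eps_le) auto
      then have "cmod (?c F) \<le> eps n / a * cmod (coef F b)"
        using A_pos Eps_nonneg[of F] mult_right_mono[OF divide_right_mono[of "Eps F" "eps n" a], of "cmod (coef F b)"]
        by (simp add: norm_mult norm_divide)
      then show "(cmod (?c F))\<^sup>2 \<le> (eps n / a)\<^sup>2 * (cmod (coef F b))\<^sup>2"
        by (metis norm_ge_zero power_mono power_mult_distrib)
    qed
    also have "\<dots> \<le> (eps n / a)\<^sup>2 * (C * a)\<^sup>2"
      unfolding sum_distrib_left[symmetric] by (intro mult_left_mono bessel_bounded fin b) auto
    also have "\<dots> = (C * eps n)\<^sup>2" using A_pos by (simp add: power_mult_distrib power_divide)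
    finally show "(\<Sum>F\<in>?\<F>. (cmod (?c F))\<^sup>2) \<le> (C * eps n)\<^sup>2" .
  qed simp
  also have "\<dots> = a * C * eps n" using C0 eps_pos[of n] by (simp add: abs_mult)
  finally show ?thesis .
qed

text \<open>Cut \<open>u\<close> on \<open>A\<close> at height \<open>C\<close>: the bounded part
  has a small tail, and the rest is merely contracted by each of the two operators, which explains
  the factor 2. The second term is the one that uniform integrability controls.\<close>

lemma partial_op_tail:
  assumes u: "integrable M u" and C: "C > 0" and nm: "n \<le> m"
  shows "(\<integral>x. cmod (partial_op m u x - partial_op n u x) \<partial>M)
     \<le> a * C * eps n + 2 * (\<integral>x. indicator A x * (indicator {x. cmod (u x) > C} x * cmod (u x)) \<partial>M)"
proof -
  have [measurable]: "u \<in> borel_measurable M" using u by simp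
  define b where "b x = indicator A x * (indicator {x. cmod (u x) \<le> C} x * u x)" for x
  define c where "c x = indicator A x * (indicator {x. cmod (u x) > C} x * u x)" for x
  have ib: "integrable M b" unfolding b_def
    by (rule Bochner_Integration.integrable_bound[OF u]) (auto simp: indicator_def)
  have ic: "integrable M c" unfolding c_def
    by (rule Bochner_Integration.integrable_bound[OF u]) (auto simp: indicator_def)
  have "coef F u = coef F (\<lambda>x. b x + c x)" for F
    unfolding coef_def b_def c_def
    by (rule Bochner_Integration.integral_cong) (auto simp: indicator_def walsh_def)
  then have pu: "partial_op n u x = partial_op n b x + partial_op n c x" for n x
    unfolding partial_op_add[OF ib ic, symmetric] by (simp add: partial_op_def)
  have "(\<integral>x. cmod (partial_op m u x - partial_op n u x) \<partial>M)
      \<le> (\<integral>x. cmod (partial_op m b x - partial_op n b x) + (cmod (partial_op m c x) + cmod (partial_op n c x)) \<partial>M)"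
  proof (rule integral_mono)
    fix x
    have "partial_op m u x - partial_op n u x
        = (partial_op m b x - partial_op n b x) + (partial_op m c x - partial_op n c x)"
      by (simp add: pu)
    also have "cmod \<dots> \<le> cmod (partial_op m b x - partial_op n b x) + (cmod (partial_op m c x) + cmod (partial_op n c x))"
      by (intro order_trans[OF norm_triangle_ineq] add_left_mono norm_triangle_ineq4)
    finally show "cmod (partial_op m u x - partial_op n u x)
        \<le> cmod (partial_op m b x - partial_op n b x) + (cmod (partial_op m c x) + cmod (partial_op n c x))" .
  qed auto
  also have "\<dots> = (\<integral>x. cmod (partial_op m b x - partial_op n b x) \<partial>M)
      + ((\<integral>x. cmod (partial_op m c x) \<partial>M) + (\<integral>x. cmod (partial_op n c x) \<partial>M))"
    by simp
  also have "\<dots> \<le> a * C * eps n + ((\<integral>x. cmod (c x) \<partial>M) + (\<integral>x. cmod (c x) \<partial>M))"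
    using C by (intro add_mono partial_op_contraction ic partial_op_tail_bounded ib nm) (auto simp: b_def indicator_def)
  also have "(\<integral>x. cmod (c x) \<partial>M) = (\<integral>x. indicator A x * (indicator {x. cmod (u x) > C} x * cmod (u x)) \<partial>M)"
    unfolding c_def by (rule Bochner_Integration.integral_cong) (auto simp: indicator_def)
  finally show ?thesis by simp
qed

end

section \<open>Limits in the L1 norm\<close>

lemma L1_limit_unique:
  fixes g h :: "'a \<Rightarrow> complex"
  assumes s: "\<And>n. integrable M (s n)" and g: "integrable M g" and h: "integrable M h"
    and lim: "(\<lambda>n. \<integral>x. cmod (s n x - g x) \<partial>M) \<longlonglongrightarrow> 0" "(\<lambda>n. \<integral>x. cmod (s n x - h x) \<partial>M) \<longlonglongrightarrow> 0"
  shows "AE x in M. g x = h x"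
proof -
  have le: "(\<integral>x. cmod (g x - h x) \<partial>M) \<le> (\<integral>x. cmod (s n x - g x) \<partial>M) + (\<integral>x. cmod (s n x - h x) \<partial>M)" for n
  proof -
    have "(\<integral>x. cmod (g x - h x) \<partial>M) \<le> (\<integral>x. cmod (s n x - g x) + cmod (s n x - h x) \<partial>M)"
    proof (rule integral_mono)
      fix x show "cmod (g x - h x) \<le> cmod (s n x - g x) + cmod (s n x - h x)"
        using norm_triangle_ineq4[of "s n x - h x" "s n x - g x"] by simp
    qed (use s g h in auto)
    then show ?thesis using s g h by simp
  qed
  have "(\<lambda>n. (\<integral>x. cmod (s n x - g x) \<partial>M) + (\<integral>x. cmod (s n x - h x) \<partial>M)) \<longlonglongrightarrow> 0 + 0"
    by (intro tendsto_add lim)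
  then have "(\<integral>x. cmod (g x - h x) \<partial>M) \<le> 0"
    using LIMSEQ_le_const[of _ "0::real"] le by auto
  then have "(\<integral>x. cmod (g x - h x) \<partial>M) = 0"
    by (intro antisym) auto
  then have "AE x in M. cmod (g x - h x) = 0"
    using g h by (subst (asm) integral_nonneg_eq_0_iff_AE) auto
  then show ?thesis by simp
qed

text \<open>The bound is asked only eventually because \<open>partial_op_tail\<close> compares stage
  \<open>n\<close> with later stages only.\<close>

lemma L1_limit_norm_le:
  fixes h :: "'a \<Rightarrow> complex"
  assumes s: "\<And>n. integrable M (s n)" and h: "integrable M h"
    and lim: "(\<lambda>n. \<integral>x. cmod (s n x - h x) \<partial>M) \<longlonglongrightarrow> 0"
    and le: "eventually (\<lambda>n. (\<integral>x. cmod (s n x) \<partial>M) \<le> c) sequentially"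
  shows "(\<integral>x. cmod (h x) \<partial>M) \<le> c"
proof -
  have triangle: "(\<integral>x. cmod (h x) \<partial>M) \<le> (\<integral>x. cmod (s n x) \<partial>M) + (\<integral>x. cmod (s n x - h x) \<partial>M)" for n
  proof -
    have "(\<integral>x. cmod (h x) \<partial>M) \<le> (\<integral>x. cmod (s n x) + cmod (s n x - h x) \<partial>M)"
    proof (rule integral_mono)
      fix x show "cmod (h x) \<le> cmod (s n x) + cmod (s n x - h x)"
        using norm_triangle_ineq4[of "s n x" "s n x - h x"] by simp
    qed (use s h in auto)
    then show ?thesis using s h by simp
  qed
  have "eventually (\<lambda>n. (\<integral>x. cmod (h x) \<partial>M) \<le> c + (\<integral>x. cmod (s n x - h x) \<partial>M)) sequentially"
    using le
  proof eventually_elim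
    case (elim n)
    then show ?case using triangle[of n] by linarith
  qed
  moreover have "(\<lambda>n. c + (\<integral>x. cmod (s n x - h x) \<partial>M)) \<longlonglongrightarrow> c + 0"
    by (intro tendsto_intros lim)
  ultimately show ?thesis
    by (intro tendsto_lowerbound[of _ "c" sequentially]) auto
qed

section \<open>The limit operator on functions and its complete continuity\<close>

context rademacher_system
begin

lemma partial_op_Cauchy:
  assumes u: "integrable M u" and e: "e > 0"
  shows "\<exists>N. \<forall>m\<ge>N. \<forall>n\<ge>N. (\<integral>x. cmod (partial_op m u x - partial_op n u x) \<partial>M) < e"
proof -
  have [measurable]: "u \<in> borel_measurable M" using u by simp
  obtain C where C: "C > 0" "(\<integral>x. indicator {x. cmod (u x) > C} x * cmod (u x) \<partial>M) < e/4"
    using integrable_tail_small[OF u, of "e/4"] e by auto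
  have "(\<integral>x. indicator A x * (indicator {x. cmod (u x) > C} x * cmod (u x)) \<partial>M)
      \<le> (\<integral>x. indicator {x. cmod (u x) > C} x * cmod (u x) \<partial>M)"
    by (rule integral_mono; (rule Bochner_Integration.integrable_bound[OF u])?) (auto simp: indicator_def)
  then have t: "(\<integral>x. indicator A x * (indicator {x. cmod (u x) > C} x * cmod (u x)) \<partial>M) < e/4"
    using C by simp
  have "eventually (\<lambda>n. eps n < e / (2 * (a * C))) sequentially"
    using e C A_pos by (intro order_tendstoD(2)[OF eps_tendsto_0]) auto
  then obtain N where N: "\<And>n. n \<ge> N \<Longrightarrow> eps n < e / (2 * (a * C))"
    by (auto simp: eventually_sequentially)
  have le: "(\<integral>x. cmod (partial_op m u x - partial_op n u x) \<partial>M) < e" if "N \<le> n" "n \<le> m" for m n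
  proof -
    have "a * C * eps n \<le> a * C * (e / (2 * (a * C)))"
      using N[OF that(1)] A_pos C by (intro mult_left_mono) auto
    also have "\<dots> = e / 2" using A_pos C by simp
    finally show ?thesis using partial_op_tail[OF u C(1) that(2)] t by linarith
  qed
  show ?thesis
  proof (intro exI[of _ N] allI impI)
    fix m n assume "N \<le> m" "N \<le> n"
    then show "(\<integral>x. cmod (partial_op m u x - partial_op n u x) \<partial>M) < e"
      using le[of n m] le[of m n] by (cases "n \<le> m") (auto simp: norm_minus_commute)
  qed
qed

text \<open>The choice sees \<open>u\<close> only through the functions
  \<open>partial_op n u\<close>, hence through its coefficients. Inputs that agree almost everywhere
  thus give the very same function, and the operator descends to classes.\<close>

definition riesz_op :: "('a \<Rightarrow> complex) \<Rightarrow> 'a \<Rightarrow> complex" where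
  "riesz_op u = (SOME h. integrable M h \<and> (\<lambda>n. \<integral>x. cmod (partial_op n u x - h x) \<partial>M) \<longlonglongrightarrow> 0)"

lemma
  assumes u: "integrable M u"
  shows riesz_op_integrable[simp]: "integrable M (riesz_op u)"
    and riesz_op_lim: "(\<lambda>n. \<integral>x. cmod (partial_op n u x - riesz_op u x) \<partial>M) \<longlonglongrightarrow> 0"
proof -
  obtain h where "integrable M h" "(\<lambda>n. \<integral>x. cmod (partial_op n u x - h x) \<partial>M) \<longlonglongrightarrow> 0"
    by (rule L1_complete[of M "\<lambda>n. partial_op n u", OF partial_op_integrable partial_op_Cauchy[OF u]])
  then have "\<exists>h. integrable M h \<and> (\<lambda>n. \<integral>x. cmod (partial_op n u x - h x) \<partial>M) \<longlonglongrightarrow> 0"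
    by blast
  then have "integrable M (riesz_op u) \<and> (\<lambda>n. \<integral>x. cmod (partial_op n u x - riesz_op u x) \<partial>M) \<longlonglongrightarrow> 0"
    unfolding riesz_op_def by (rule someI_ex)
  then show "integrable M (riesz_op u)" "(\<lambda>n. \<integral>x. cmod (partial_op n u x - riesz_op u x) \<partial>M) \<longlonglongrightarrow> 0"
    by auto
qed

lemma riesz_op_eqI:
  assumes "integrable M u" "integrable M h" "(\<lambda>n. \<integral>x. cmod (partial_op n u x - h x) \<partial>M) \<longlonglongrightarrow> 0"
  shows "AE x in M. riesz_op u x = h x"
  using assms by (intro L1_limit_unique[of M "\<lambda>n. partial_op n u"] riesz_op_lim) auto

lemma riesz_op_cong_AE:
  assumes "integrable M u" "integrable M v" "AE x in M. u x = v x"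
  shows "riesz_op u = riesz_op v"
  unfolding riesz_op_def partial_op_cong_AE[OF assms] ..

lemma riesz_op_add:
  assumes u: "integrable M u" and v: "integrable M v"
  shows "AE x in M. riesz_op (\<lambda>x. u x + v x) x = riesz_op u x + riesz_op v x"
proof (rule riesz_op_eqI)
  show "(\<lambda>n. \<integral>x. cmod (partial_op n (\<lambda>x. u x + v x) x - (riesz_op u x + riesz_op v x)) \<partial>M) \<longlonglongrightarrow> 0"
  proof (rule tendsto_sandwich[OF _ _ tendsto_const])
    show "(\<lambda>n. (\<integral>x. cmod (partial_op n u x - riesz_op u x) \<partial>M) + (\<integral>x. cmod (partial_op n v x - riesz_op v x) \<partial>M)) \<longlonglongrightarrow> 0"
      using tendsto_add[OF riesz_op_lim[OF u] riesz_op_lim[OF v]] by simp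
    show "eventually (\<lambda>n. (\<integral>x. cmod (partial_op n (\<lambda>x. u x + v x) x - (riesz_op u x + riesz_op v x)) \<partial>M)
       \<le> (\<integral>x. cmod (partial_op n u x - riesz_op u x) \<partial>M) + (\<integral>x. cmod (partial_op n v x - riesz_op v x) \<partial>M)) sequentially"
    proof (rule always_eventually, rule allI)
      fix n
      have "(\<integral>x. cmod (partial_op n (\<lambda>x. u x + v x) x - (riesz_op u x + riesz_op v x)) \<partial>M)
         \<le> (\<integral>x. cmod (partial_op n u x - riesz_op u x) + cmod (partial_op n v x - riesz_op v x) \<partial>M)"
        using u v by (intro integral_mono) (auto simp: partial_op_add norm_diff_triangle_ineq)
      also have "\<dots> = (\<integral>x. cmod (partial_op n u x - riesz_op u x) \<partial>M) + (\<integral>x. cmod (partial_op n v x - riesz_op v x) \<partial>M)"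
        using u v by simp
      finally show "(\<integral>x. cmod (partial_op n (\<lambda>x. u x + v x) x - (riesz_op u x + riesz_op v x)) \<partial>M) \<le> \<dots>" .
    qed
  qed auto
qed (use u v in auto)

lemma riesz_op_mult:
  assumes u: "integrable M u"
  shows "AE x in M. riesz_op (\<lambda>x. c * u x) x = c * riesz_op u x"
proof (rule riesz_op_eqI)
  have "(\<lambda>n. cmod c * (\<integral>x. cmod (partial_op n u x - riesz_op u x) \<partial>M)) \<longlonglongrightarrow> cmod c * 0"
    by (intro tendsto_intros riesz_op_lim u)
  then show "(\<lambda>n. \<integral>x. cmod (partial_op n (\<lambda>x. c * u x) x - c * riesz_op u x) \<partial>M) \<longlonglongrightarrow> 0"
    by (simp add: partial_op_mult right_diff_distrib[symmetric] norm_mult)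
qed (use u in auto)

lemma riesz_op_contraction:
  assumes u: "integrable M u"
  shows "(\<integral>x. cmod (riesz_op u x) \<partial>M) \<le> (\<integral>x. cmod (u x) \<partial>M)"
  by (rule L1_limit_norm_le[OF _ _ riesz_op_lim[OF u]]) (use u in \<open>auto intro: always_eventually partial_op_contraction\<close>)

lemma coef_partial_op:
  assumes F: "finite F" "F \<subseteq> {..<n}"
  shows "coef F (partial_op n u) = of_real (Eps F) * coef F u"
  unfolding partial_op_def[abs_def] using F A_pos
  by (subst coef_walsh_sum) (auto intro: finite_subset)

text \<open>A coefficient is continuous for the L1 norm and constant along
  \<open>partial_op n u\<close> once \<open>F\<close> lies below \<open>n\<close>.\<close>

lemma coef_riesz_op:
  assumes u: "integrable M u" and F: "finite F"
  shows "coef F (riesz_op u) = of_real (Eps F) * coef F u"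
proof -
  obtain N where N: "F \<subseteq> {..<N}" using F finite_nat_iff_bounded by blast
  have "(\<lambda>n. coef F (partial_op n u) - coef F (riesz_op u)) \<longlonglongrightarrow> 0"
  proof (rule Lim_null_comparison[OF _ riesz_op_lim[OF u]], rule always_eventually, rule allI)
    fix n
    show "norm (coef F (partial_op n u) - coef F (riesz_op u)) \<le> (\<integral>x. cmod (partial_op n u x - riesz_op u x) \<partial>M)"
      using u by (subst coef_diff[symmetric]) (auto intro!: coef_bound)
  qed
  moreover have "eventually (\<lambda>n. coef F (partial_op n u) - coef F (riesz_op u)
      = of_real (Eps F) * coef F u - coef F (riesz_op u)) sequentially"
    using eventually_ge_at_top[of N]
  proof eventually_elim
    fix n assume "N \<le> n"
    then have "F \<subseteq> {..<n}" using N by force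
    then show "coef F (partial_op n u) - coef F (riesz_op u) = of_real (Eps F) * coef F u - coef F (riesz_op u)"
      using F by (simp add: coef_partial_op)
  qed
  ultimately have "(\<lambda>n. of_real (Eps F) * coef F u - coef F (riesz_op u)) \<longlonglongrightarrow> 0"
    by (rule Lim_transform_eventually)
  then show ?thesis by (simp add: LIMSEQ_const_iff)
qed

text \<open>When \<open>T\<close> is applied after the operator, coefficients of the image are not
  enough: the image of \<open>walsh F\<close> itself has to be a multiple of \<open>walsh F\<close>.
  Each finite stage achieves this exactly once \<open>F\<close> lies below \<open>n\<close>.\<close>

lemma riesz_op_walsh:
  assumes F: "finite F"
  shows "AE x in M. riesz_op (\<lambda>x. of_real (walsh F x)) x = of_real (Eps F) * of_real (walsh F x)"
proof (rule riesz_op_eqI)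
  obtain N where N: "F \<subseteq> {..<N}" using F finite_nat_iff_bounded by blast
  show "(\<lambda>n. \<integral>x. cmod (partial_op n (\<lambda>x. of_real (walsh F x)) x - of_real (Eps F) * of_real (walsh F x)) \<partial>M) \<longlonglongrightarrow> 0"
  proof (rule tendsto_eventually, rule eventually_mono[OF eventually_ge_at_top[of N]])
    fix n assume "N \<le> n"
    then have Fn: "F \<in> Pow {..<n}" using N by force
    have "partial_op n (\<lambda>x. of_real (walsh F x)) x
        = (\<Sum>G\<in>Pow {..<n}. if F = G then of_real (Eps F) * of_real (walsh F x) else 0)" for x
      unfolding partial_op_def using F A_pos by (intro sum.cong) (auto simp: coef_walsh finite_subset)
    then have "partial_op n (\<lambda>x. of_real (walsh F x)) x = of_real (Eps F) * of_real (walsh F x)" for x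
      using Fn by (simp add: sum.delta)
    then show "(\<integral>x. cmod (partial_op n (\<lambda>x. of_real (walsh F x)) x - of_real (Eps F) * of_real (walsh F x)) \<partial>M) = 0"
      by simp
  qed
qed auto

text \<open>The first \<open>m\<close> signs cut \<open>A\<close> into \<open>2^m\<close> cells of
  equal measure \<open>a / 2^m\<close>, each small enough for the hypothesis. For a weakly null
  sequence this bounds the L1 norms over \<open>A\<close> by the same constant for all members, in
  place of the uniform boundedness principle.\<close>

lemma cell_bound:
  assumes u: "integrable M u" and e: "e \<ge> 0" and d: "a / 2^m < d"
    and small: "\<And>E. E \<in> sets M \<Longrightarrow> measure M E < d \<Longrightarrow> (\<integral>x. indicator E x * cmod (u x) \<partial>M) \<le> e"
  shows "(\<integral>x. indicator A x * cmod (u x) \<partial>M) \<le> 2^m * e"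
proof -
  have [measurable]: "u \<in> borel_measurable M" using u by simp
  define \<sigma> where "\<sigma> I i = (if i \<in> I then 1 else -1 :: real)" for I and i :: nat
  define E where "E I = {x \<in> space M. x \<in> A \<and> (\<forall>i<m. r i x = \<sigma> I i)}" for I
  have [measurable]: "E I \<in> sets M" for I unfolding E_def by measurable
  have AM: "x \<in> space M" if "x \<in> A" for x using that A sets.sets_into_space by blast
  \<comment> \<open>Up to the factor \<open>2^m\<close>, the indicator of a cell is a Riesz product
    with weights 1 and -1, so its measure comes from \<open>integral_riesz_product\<close>.\<close>
  have ind: "indicator (E I) x = indicator A x * (\<Prod>i<m. 1 + \<sigma> I i * r i x) / 2^m" for I x
  proof (cases "x \<in> E I")
    case True
    then have "(\<Prod>i<m. 1 + \<sigma> I i * r i x) = (\<Prod>i<m. 2)"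
      by (intro prod.cong) (auto simp: E_def \<sigma>_def)
    then show ?thesis using True by (simp add: E_def)
  next
    case False
    have "indicator A x * (\<Prod>i<m. 1 + \<sigma> I i * r i x) = 0"
    proof (cases "x \<in> A")
      case True
      then obtain i where "i < m" "r i x \<noteq> \<sigma> I i" using False AM by (auto simp: E_def)
      then show ?thesis using r_sign[of i x] by (auto simp: \<sigma>_def prod_zero_iff intro!: bexI[of _ i])
    qed simp
    then show ?thesis using False by simp
  qed
  have mE: "measure M (E I) = a / 2^m" for I
  proof -
    have "measure M (E I) = (\<integral>x. indicator (E I) x \<partial>M)" by simp
    also have "\<dots> = (\<integral>x. indicator A x * (\<Prod>i<m. 1 + \<sigma> I i * r i x) \<partial>M) / 2^m"
      unfolding ind by simp
    finally show ?thesis by (simp add: integral_riesz_product)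
  qed
  have cover: "indicator A x \<le> (\<Sum>I\<in>Pow {..<m}. indicator (E I) x :: real)" for x
  proof (cases "x \<in> A")
    case True
    let ?I = "{i\<in>{..<m}. r i x = 1}"
    have "x \<in> E ?I" using True AM r_sign by (auto simp: E_def \<sigma>_def)
    then have "(1::real) = indicator (E ?I) x" by simp
    also have "\<dots> \<le> (\<Sum>I\<in>Pow {..<m}. indicator (E I) x)"
      by (rule member_le_sum) auto
    finally show ?thesis using True by simp
  qed (simp add: sum_nonneg)
  have iE: "integrable M (\<lambda>x. indicator (E I) x * cmod (u x))" for I
    by (rule Bochner_Integration.integrable_bound[OF u]) (auto simp: indicator_def)
  have "(\<integral>x. indicator A x * cmod (u x) \<partial>M) \<le> (\<integral>x. (\<Sum>I\<in>Pow {..<m}. indicator (E I) x * cmod (u x)) \<partial>M)"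
  proof (rule integral_mono)
    show "integrable M (\<lambda>x. indicator A x * cmod (u x))"
      by (rule Bochner_Integration.integrable_bound[OF u]) (auto simp: indicator_def)
    show "integrable M (\<lambda>x. \<Sum>I\<in>Pow {..<m}. indicator (E I) x * cmod (u x))"
      by (intro Bochner_Integration.integrable_sum iE)
    fix x show "indicator A x * cmod (u x) \<le> (\<Sum>I\<in>Pow {..<m}. indicator (E I) x * cmod (u x))"
      unfolding sum_distrib_right[symmetric] by (rule mult_right_mono[OF cover]) simp
  qed
  also have "\<dots> = (\<Sum>I\<in>Pow {..<m}. \<integral>x. indicator (E I) x * cmod (u x) \<partial>M)"
    by (intro Bochner_Integration.integral_sum iE)
  also have "\<dots> \<le> (\<Sum>I\<in>Pow {..<m}. e)"
    by (intro sum_mono small) (use mE d in auto)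
  also have "\<dots> = 2^m * e" by (simp add: card_Pow)
  finally show ?thesis .
qed

lemma weakly_null_uniform_tail:
  fixes u :: "nat \<Rightarrow> 'a \<Rightarrow> complex"
  assumes u: "\<And>n. integrable M (u n)"
    and null: "\<And>\<phi>. \<phi> \<in> borel_measurable M \<Longrightarrow> (\<And>x. cmod (\<phi> x) \<le> 1) \<Longrightarrow>
                 (\<lambda>n. \<integral>x. \<phi> x * u n x \<partial>M) \<longlonglongrightarrow> 0"
    and e: "e > 0"
  obtains C where "C > 0"
    "\<And>k. (\<integral>x. indicator A x * (indicator {x. cmod (u k x) > C} x * cmod (u k x)) \<partial>M) \<le> e"
proof -
  have [measurable]: "u n \<in> borel_measurable M" for n by (rule borel_measurable_integrable[OF u])
  obtain d where d: "d > 0"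
    "\<And>n E. E \<in> sets M \<Longrightarrow> measure M E < d \<Longrightarrow> (\<integral>x. indicator E x * cmod (u n x) \<partial>M) \<le> e"
  proof (rule weakly_null_uniformly_absolutely_continuous[of u e])
    show "e > 0" by (rule e)
    show "integrable M (u n)" for n by (rule u)
    show "(\<lambda>n. \<integral>x. \<phi> x * u n x \<partial>M) \<longlonglongrightarrow> 0"
      if "\<phi> \<in> borel_measurable M" "\<And>x. cmod (\<phi> x) \<le> 1" for \<phi>
      by (rule null[OF that])
  qed blast
  obtain m where "(1/2)^m < d / a"
    using real_arch_pow_inv[of "d / a" "1/2"] d A_pos by auto
  then have m: "a / 2^m < d" using A_pos by (simp add: field_simps power_divide)
  \<comment> \<open>Markov's inequality turns the bound \<open>2^m * e\<close> on the norm into a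
    measure of at most \<open>d / 2\<close> for the set above \<open>C\<close>, strictly below the
    threshold \<open>d\<close>.\<close>
  define C where "C = 2 * (2^m * e) / d"
  have C: "C > 0" using d e by (simp add: C_def)
  show ?thesis
  proof (rule that[OF C])
    fix k
    define E where "E = {x \<in> space M. x \<in> A \<and> cmod (u k x) > C}"
    have [measurable]: "E \<in> sets M" unfolding E_def by measurable
    have "C * measure M E = (\<integral>x. C * indicator E x \<partial>M)" by simp
    also have "\<dots> \<le> (\<integral>x. indicator A x * cmod (u k x) \<partial>M)"
    proof (rule integral_mono)
      show "integrable M (\<lambda>x. C * indicator E x)"
        by (intro integrable_mult_right integrable_real_indicator) (auto simp: emeasure_eq_measure)
      show "integrable M (\<lambda>x. indicator A x * cmod (u k x))"
        by (rule Bochner_Integration.integrable_bound[OF u[of k]]) (auto simp: indicator_def)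
    qed (auto simp: E_def indicator_def)
    also have "\<dots> \<le> 2^m * e" by (rule cell_bound[OF u _ m d(2)]) (use e in auto)
    finally have "measure M E \<le> d / 2" using d e by (simp add: C_def field_simps)
    then have "(\<integral>x. indicator E x * cmod (u k x) \<partial>M) \<le> e" using d by auto
    moreover have "(\<integral>x. indicator E x * cmod (u k x) \<partial>M)
        = (\<integral>x. indicator A x * (indicator {x. cmod (u k x) > C} x * cmod (u k x)) \<partial>M)"
      by (rule Bochner_Integration.integral_cong) (auto simp: E_def indicator_def)
    ultimately show "(\<integral>x. indicator A x * (indicator {x. cmod (u k x) > C} x * cmod (u k x)) \<partial>M) \<le> e" by simp
  qed
qed

text \<open>One truncation \<open>n\<close> serves the whole sequence, by the uniform tail. For that
  \<open>n\<close> only finitely many coefficients remain, and each tends to 0, being an integral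
  against a bounded function.\<close>

lemma riesz_op_weakly_null:
  fixes u :: "nat \<Rightarrow> 'a \<Rightarrow> complex"
  assumes u: "\<And>n. integrable M (u n)"
    and null: "\<And>\<phi>. \<phi> \<in> borel_measurable M \<Longrightarrow> (\<And>x. cmod (\<phi> x) \<le> 1) \<Longrightarrow>
                 (\<lambda>n. \<integral>x. \<phi> x * u n x \<partial>M) \<longlonglongrightarrow> 0"
  shows "(\<lambda>k. \<integral>x. cmod (riesz_op (u k) x) \<partial>M) \<longlonglongrightarrow> 0"
proof (rule LIMSEQ_I)
  fix e :: real assume e: "e > 0"
  obtain C where C: "C > 0"
    "\<And>k. (\<integral>x. indicator A x * (indicator {x. cmod (u k x) > C} x * cmod (u k x)) \<partial>M) \<le> e/8"
  proof (rule weakly_null_uniform_tail[of u "e/8"])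
    show "e / 8 > 0" using e by simp
    show "integrable M (u n)" for n by (rule u)
    show "(\<lambda>n. \<integral>x. \<phi> x * u n x \<partial>M) \<longlonglongrightarrow> 0"
      if "\<phi> \<in> borel_measurable M" "\<And>x. cmod (\<phi> x) \<le> 1" for \<phi>
      by (rule null[OF that])
  qed blast
  have "eventually (\<lambda>n. eps n < e / (4 * (a * C))) sequentially"
    using e C A_pos by (intro order_tendstoD(2)[OF eps_tendsto_0]) auto
  then obtain n where "eps n < e / (4 * (a * C))"
    by (auto simp: eventually_sequentially)
  \<comment> \<open>The tail is at most \<open>e / 4\<close> plus twice \<open>e / 8\<close>, which
    is \<open>e / 2\<close>; the other half of \<open>e\<close> is left for the finite part.\<close>
  then have n: "a * C * eps n < e / 4" using A_pos C by (simp add: field_simps)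
  have tail: "(\<integral>x. cmod (riesz_op (u k) x - partial_op n (u k) x) \<partial>M) \<le> e / 2" for k
  proof (rule L1_limit_norm_le[where s="\<lambda>m x. partial_op m (u k) x - partial_op n (u k) x"])
    show "(\<lambda>m. \<integral>x. cmod ((partial_op m (u k) x - partial_op n (u k) x) - (riesz_op (u k) x - partial_op n (u k) x)) \<partial>M) \<longlonglongrightarrow> 0"
      using riesz_op_lim[OF u[of k]] by simp
    show "eventually (\<lambda>m. (\<integral>x. cmod (partial_op m (u k) x - partial_op n (u k) x) \<partial>M) \<le> e / 2) sequentially"
      using eventually_ge_at_top[of n]
    proof eventually_elim
      fix m assume "n \<le> m"
      then show "(\<integral>x. cmod (partial_op m (u k) x - partial_op n (u k) x) \<partial>M) \<le> e / 2"
        using partial_op_tail[OF u[of k] C(1), of n m] n C(2)[of k] by linarith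
    qed
  qed (use u in auto)
  have co: "(\<lambda>k. coef F (u k)) \<longlonglongrightarrow> 0" for F
    unfolding coef_def by (rule null) (auto simp: abs_walsh_le)
  have "(\<lambda>k. a * sqrt (\<Sum>F\<in>Pow {..<n}. (cmod (of_real (Eps F / a) * coef F (u k)))\<^sup>2))
      \<longlonglongrightarrow> a * sqrt (\<Sum>F\<in>Pow {..<n}. (cmod (of_real (Eps F / a) * 0))\<^sup>2)"
    by (intro tendsto_intros co)
  then have "eventually (\<lambda>k. a * sqrt (\<Sum>F\<in>Pow {..<n}. (cmod (of_real (Eps F / a) * coef F (u k)))\<^sup>2) < e/2) sequentially"
    using e by (intro order_tendstoD(2)) auto
  then have "eventually (\<lambda>k. norm ((\<integral>x. cmod (riesz_op (u k) x) \<partial>M) - 0) < e) sequentially"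
  proof eventually_elim
    fix k assume k: "a * sqrt (\<Sum>F\<in>Pow {..<n}. (cmod (of_real (Eps F / a) * coef F (u k)))\<^sup>2) < e/2"
    have "(\<integral>x. cmod (riesz_op (u k) x) \<partial>M)
        \<le> (\<integral>x. cmod (riesz_op (u k) x - partial_op n (u k) x) + cmod (partial_op n (u k) x) \<partial>M)"
    proof (rule integral_mono)
      fix x show "cmod (riesz_op (u k) x) \<le> cmod (riesz_op (u k) x - partial_op n (u k) x) + cmod (partial_op n (u k) x)"
        using norm_triangle_ineq[of "riesz_op (u k) x - partial_op n (u k) x" "partial_op n (u k) x"] by simp
    qed (use u in auto)
    also have "\<dots> = (\<integral>x. cmod (riesz_op (u k) x - partial_op n (u k) x) \<partial>M) + (\<integral>x. cmod (partial_op n (u k) x) \<partial>M)"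
      using u by simp
    also have "\<dots> < e/2 + e/2"
      using walsh_sum_L1[of "Pow {..<n}" "\<lambda>F. of_real (Eps F / a) * coef F (u k)"] k tail[of k]
      by (intro add_le_less_mono) (auto simp: partial_op_def finite_subset)
    finally show "norm ((\<integral>x. cmod (riesz_op (u k) x) \<partial>M) - 0) < e" by simp
  qed
  then show "\<exists>no. \<forall>k\<ge>no. norm ((\<integral>x. cmod (riesz_op (u k) x) \<partial>M) - 0) < e"
    by (simp add: eventually_sequentially)
qed

end

section \<open>Operators on \<open>L1 M\<close> through representatives\<close>

definition rep :: "('a \<Rightarrow> complex) set \<Rightarrow> 'a \<Rightarrow> complex" where
  "rep v = (SOME f. f \<in> v)"

lemma rep_ae_class:
  assumes "integrable M f"
  shows "integrable M (rep (ae_class M f))" "AE x in M. f x = rep (ae_class M f) x"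
proof -
  have "rep (ae_class M f) \<in> ae_class M f"
    unfolding rep_def by (rule someI[of _ f]) (rule ae_class_self[OF assms])
  then show "integrable M (rep (ae_class M f))" "AE x in M. f x = rep (ae_class M f) x"
    by (auto simp: mem_ae_class)
qed

lemma ae_class_in_carr: "integrable M f \<Longrightarrow> ae_class M f \<in> carr (L1 M)"
  by (simp add: carr_L1)

lemma rep_carr:
  assumes "v \<in> carr (L1 M)"
  shows "integrable M (rep v)" "ae_class M (rep v) = v"
proof -
  obtain f where f: "integrable M f" "v = ae_class M f" using assms by (auto simp: carr_L1)
  then show "integrable M (rep v)" using rep_ae_class[OF f(1)] by simp
  show "ae_class M (rep v) = v"
    unfolding f(2) using rep_ae_class[OF f(1)] f(1) by (intro ae_class_cong) (auto elim: eventually_mono)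
qed

lemma vnorm_rep: "v \<in> carr (L1 M) \<Longrightarrow> vnorm (L1 M) v = (\<integral>x. cmod (rep v x) \<partial>M)"
  by (metis rep_carr vnorm_L1)

lemma vnorm_L1_nonneg: "v \<in> carr (L1 M) \<Longrightarrow> vnorm (L1 M) v \<ge> 0"
  by (simp add: vnorm_rep)

lemma vadd_in_carr: "u \<in> carr (L1 M) \<Longrightarrow> v \<in> carr (L1 M) \<Longrightarrow> vadd (L1 M) u v \<in> carr (L1 M)"
  by (auto simp: carr_L1 vadd_L1 intro!: imageI)

lemma smul_in_carr: "u \<in> carr (L1 M) \<Longrightarrow> smul (L1 M) c u \<in> carr (L1 M)"
  by (auto simp: carr_L1 smul_L1 intro!: imageI)

lemma vminus_L1:
  assumes "integrable M f" "integrable M g"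
  shows "vminus (L1 M) (ae_class M f) (ae_class M g) = ae_class M (\<lambda>x. f x - g x)"
  using assms by (simp add: vminus_def smul_L1 vadd_L1)

lemma vnorm_smul: "u \<in> carr (L1 M) \<Longrightarrow> vnorm (L1 M) (smul (L1 M) c u) = cmod c * vnorm (L1 M) u"
  by (auto simp: carr_L1 smul_L1 vnorm_L1 norm_mult)

lemma vnorm_vadd_le:
  assumes "u \<in> carr (L1 M)" "v \<in> carr (L1 M)"
  shows "vnorm (L1 M) (vadd (L1 M) u v) \<le> vnorm (L1 M) u + vnorm (L1 M) v"
proof -
  obtain f g where f: "integrable M f" "u = ae_class M f" and g: "integrable M g" "v = ae_class M g"
    using assms by (auto simp: carr_L1)
  have "(\<integral>x. cmod (f x + g x) \<partial>M) \<le> (\<integral>x. cmod (f x) + cmod (g x) \<partial>M)"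
    using f g by (intro integral_mono norm_triangle_ineq) auto
  then show ?thesis using f g by (simp add: vadd_L1 vnorm_L1)
qed

lemma vnorm_vminus_commute:
  assumes "u \<in> carr (L1 M)" "v \<in> carr (L1 M)"
  shows "vnorm (L1 M) (vminus (L1 M) u v) = vnorm (L1 M) (vminus (L1 M) v u)"
  using assms by (auto simp: carr_L1 vminus_L1 vnorm_L1 norm_minus_commute)

section \<open>Functionals given by bounded functions\<close>

definition pairing :: "'a measure \<Rightarrow> ('a \<Rightarrow> complex) \<Rightarrow> ('a \<Rightarrow> complex) set \<Rightarrow> complex" where
  "pairing M \<phi> v = (\<integral>x. \<phi> x * rep v x \<partial>M)"

lemma pairing_ae_class:
  assumes f: "integrable M f" and \<phi>[measurable]: "\<phi> \<in> borel_measurable M"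
  shows "pairing M \<phi> (ae_class M f) = (\<integral>x. \<phi> x * f x \<partial>M)"
proof -
  note rep = rep_ae_class[OF f]
  have [measurable]: "f \<in> borel_measurable M" "rep (ae_class M f) \<in> borel_measurable M"
    using f rep by auto
  have "AE x in M. \<phi> x * rep (ae_class M f) x = \<phi> x * f x"
    using rep(2) by eventually_elim simp
  then show ?thesis
    unfolding pairing_def by (intro integral_cong_AE) auto
qed

lemma pairing_bound:
  assumes v: "v \<in> carr (L1 M)" and [measurable]: "\<phi> \<in> borel_measurable M" and \<phi>: "\<And>x. cmod (\<phi> x) \<le> C"
  shows "cmod (pairing M \<phi> v) \<le> C * vnorm (L1 M) v"
proof -
  have "cmod (pairing M \<phi> v) \<le> (\<integral>x. cmod (\<phi> x * rep v x) \<partial>M)"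
    unfolding pairing_def by (rule integral_norm_bound)
  also have "\<dots> \<le> (\<integral>x. C * cmod (rep v x) \<partial>M)"
    using rep_carr(1)[OF v] integrable_mult_bounded[OF rep_carr(1)[OF v] _ \<phi>]
    by (intro integral_mono integrable_norm) (auto simp: norm_mult intro: mult_right_mono \<phi>)
  finally show ?thesis using v by (simp add: vnorm_rep)
qed

text \<open>Through this, weak nullity of classes becomes the test against bounded functions from
  which the estimates on representatives start.\<close>

lemma bounded_functional_pairing:
  assumes [measurable]: "\<phi> \<in> borel_measurable M" and \<phi>: "\<And>x. cmod (\<phi> x) \<le> C"
  shows "bounded_functional (L1 M) (pairing M \<phi>)"
proof -
  have i: "integrable M (\<lambda>x. \<phi> x * f x)" if "integrable M f" for f
    by (rule integrable_mult_bounded[OF that _ \<phi>]) simp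
  have "pairing M \<phi> (vadd (L1 M) u v) = pairing M \<phi> u + pairing M \<phi> v"
    if "u \<in> carr (L1 M)" "v \<in> carr (L1 M)" for u v
    using that by (auto simp: carr_L1 vadd_L1 pairing_ae_class distrib_left i)
  moreover have "pairing M \<phi> (smul (L1 M) c u) = c * pairing M \<phi> u" if "u \<in> carr (L1 M)" for c u
    using that by (auto simp: carr_L1 smul_L1 pairing_ae_class mult.left_commute)
  ultimately show ?thesis
    unfolding bounded_functional_def by (auto intro!: exI[of _ C] pairing_bound \<phi>)
qed

lemma bounded_functional_comp:
  assumes \<psi>: "bounded_functional (L1 M) \<psi>" and V: "bounded_operator (L1 M) V"
  shows "bounded_functional (L1 M) (\<lambda>v. \<psi> (V v))"
proof -
  obtain C where C: "\<And>u. u \<in> carr (L1 M) \<Longrightarrow> cmod (\<psi> u) \<le> C * vnorm (L1 M) u"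
    using \<psi> unfolding bounded_functional_def by blast
  obtain D where D: "\<And>u. u \<in> carr (L1 M) \<Longrightarrow> vnorm (L1 M) (V u) \<le> D * vnorm (L1 M) u"
    using V unfolding bounded_operator_def by blast
  have VZ: "V u \<in> carr (L1 M)" if "u \<in> carr (L1 M)" for u
    using V that unfolding bounded_operator_def by blast+
  have "cmod (\<psi> (V u)) \<le> (\<bar>C\<bar> * D) * vnorm (L1 M) u" if u: "u \<in> carr (L1 M)" for u
  proof -
    have "cmod (\<psi> (V u)) \<le> \<bar>C\<bar> * vnorm (L1 M) (V u)"
      by (rule order_trans[OF C[OF VZ[OF u]] mult_right_mono[OF abs_ge_self]]) (rule vnorm_L1_nonneg[OF VZ[OF u]])
    also have "\<dots> \<le> \<bar>C\<bar> * (D * vnorm (L1 M) u)" by (intro mult_left_mono D u) simp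
    finally show ?thesis by (simp add: mult.assoc)
  qed
  then have "\<exists>K. \<forall>u\<in>carr (L1 M). cmod (\<psi> (V u)) \<le> K * vnorm (L1 M) u" by blast
  then show ?thesis using \<psi> V VZ by (simp add: bounded_functional_def bounded_operator_def)
qed

lemma bounded_functional_sum:
  fixes f :: "'b \<Rightarrow> 'a \<Rightarrow> complex"
  assumes \<psi>: "bounded_functional (L1 M) \<psi>" and I: "finite I" and f: "\<And>i. i \<in> I \<Longrightarrow> integrable M (f i)"
  shows "\<psi> (ae_class M (\<lambda>x. \<Sum>i\<in>I. c i * f i x)) = (\<Sum>i\<in>I. c i * \<psi> (ae_class M (f i)))"
  using I f
proof (induction I rule: finite_induct)
  case empty
  \<comment> \<open>The zero class equals 0 times itself, so homogeneity makes \<psi> vanish on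
    it.\<close>
  have "smul (L1 M) 0 (ae_class M (\<lambda>_. 0)) = ae_class M (\<lambda>_. 0)" by (simp add: smul_L1)
  moreover have "\<psi> (smul (L1 M) 0 (ae_class M (\<lambda>_. 0))) = 0 * \<psi> (ae_class M (\<lambda>_. 0))"
    using \<psi> ae_class_in_carr[of M "\<lambda>_. 0"] unfolding bounded_functional_def by blast
  ultimately show ?case by simp
next
  case (insert i I)
  have 1: "integrable M (\<lambda>x. c i * f i x)" "integrable M (\<lambda>x. \<Sum>i\<in>I. c i * f i x)"
    using insert by auto
  have "ae_class M (\<lambda>x. \<Sum>i\<in>insert i I. c i * f i x)
      = vadd (L1 M) (smul (L1 M) (c i) (ae_class M (f i))) (ae_class M (\<lambda>x. \<Sum>i\<in>I. c i * f i x))"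
    using insert 1 by (simp add: smul_L1 vadd_L1)
  also have "\<psi> \<dots> = \<psi> (smul (L1 M) (c i) (ae_class M (f i))) + \<psi> (ae_class M (\<lambda>x. \<Sum>i\<in>I. c i * f i x))"
    using \<psi> 1 insert.prems by (simp add: bounded_functional_def ae_class_in_carr smul_in_carr)
  also have "\<psi> (smul (L1 M) (c i) (ae_class M (f i))) = c i * \<psi> (ae_class M (f i))"
    using \<psi> insert.prems by (simp add: bounded_functional_def ae_class_in_carr)
  finally show ?case using insert by simp
qed

section \<open>Operator norm and algebra of bounded operators\<close>

lemma op_norm_bound:
  assumes V: "bounded_operator (L1 M) V" and u: "u \<in> carr (L1 M)"
  shows "vnorm (L1 M) (V u) \<le> op_norm (L1 M) V * vnorm (L1 M) u"
proof -
  obtain D where D: "\<And>u. u \<in> carr (L1 M) \<Longrightarrow> vnorm (L1 M) (V u) \<le> D * vnorm (L1 M) u"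
    using V unfolding bounded_operator_def by blast
  have "vnorm (L1 M) (V u) \<le> \<bar>D\<bar>" if "u \<in> carr (L1 M)" "vnorm (L1 M) u \<le> 1" for u
  proof -
    have "D * vnorm (L1 M) u \<le> \<bar>D\<bar> * 1"
      using that vnorm_L1_nonneg[OF that(1)] by (intro mult_mono) auto
    then show ?thesis using D[OF that(1)] by simp
  qed
  \<comment> \<open>The real supremum in \<open>op_norm\<close> is an upper bound only once the
    values on the unit ball are known to be bounded; this must precede the scaling.\<close>
  then have bdd: "bdd_above ((\<lambda>u. vnorm (L1 M) (V u)) ` {u \<in> carr (L1 M). vnorm (L1 M) u \<le> 1})"
    by (auto intro!: bdd_aboveI[of _ "\<bar>D\<bar>"])
  have upper: "vnorm (L1 M) (V u) \<le> op_norm (L1 M) V" if "u \<in> carr (L1 M)" "vnorm (L1 M) u \<le> 1" for u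
    unfolding op_norm_def by (rule cSUP_upper[OF _ bdd]) (use that in simp)
  show "vnorm (L1 M) (V u) \<le> op_norm (L1 M) V * vnorm (L1 M) u"
  proof (cases "vnorm (L1 M) u = 0")
    case True
    then show ?thesis using D[OF u] by simp
  next
    case False
    define k where "k = vnorm (L1 M) u"
    have k: "k > 0" using False vnorm_L1_nonneg[OF u] by (simp add: k_def)
    have VZ: "V u \<in> carr (L1 M)" and Vs: "V (smul (L1 M) (of_real (1/k)) u) = smul (L1 M) (of_real (1/k)) (V u)"
      using V u unfolding bounded_operator_def by blast+
    have "vnorm (L1 M) (V (smul (L1 M) (of_real (1/k)) u)) \<le> op_norm (L1 M) V"
      using k by (intro upper smul_in_carr u) (simp add: vnorm_smul[OF u] k_def[symmetric] norm_divide)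
    then have "1/k * vnorm (L1 M) (V u) \<le> op_norm (L1 M) V"
      using k unfolding Vs vnorm_smul[OF VZ] by (simp add: norm_divide)
    then show ?thesis using k by (simp add: k_def[symmetric] field_simps)
  qed
qed

lemma bounded_operator_comp:
  assumes S: "bounded_operator (L1 M) S" and T: "bounded_operator (L1 M) T"
  shows "bounded_operator (L1 M) (S \<circ> T)"
proof -
  obtain C where C: "\<And>u. u \<in> carr (L1 M) \<Longrightarrow> vnorm (L1 M) (S u) \<le> C * vnorm (L1 M) u"
    using S unfolding bounded_operator_def by blast
  obtain D where D: "\<And>u. u \<in> carr (L1 M) \<Longrightarrow> vnorm (L1 M) (T u) \<le> D * vnorm (L1 M) u"
    using T unfolding bounded_operator_def by blast
  have TZ: "T u \<in> carr (L1 M)" if "u \<in> carr (L1 M)" for u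
    using T that unfolding bounded_operator_def by blast+
  have "vnorm (L1 M) (S (T u)) \<le> (\<bar>C\<bar> * D) * vnorm (L1 M) u" if u: "u \<in> carr (L1 M)" for u
  proof -
    have "vnorm (L1 M) (S (T u)) \<le> \<bar>C\<bar> * vnorm (L1 M) (T u)"
      by (rule order_trans[OF C[OF TZ[OF u]] mult_right_mono[OF abs_ge_self]]) (rule vnorm_L1_nonneg[OF TZ[OF u]])
    also have "\<dots> \<le> \<bar>C\<bar> * (D * vnorm (L1 M) u)" by (intro mult_left_mono D u) simp
    finally show ?thesis by (simp add: mult.assoc)
  qed
  then have "\<exists>K. \<forall>u\<in>carr (L1 M). vnorm (L1 M) (S (T u)) \<le> K * vnorm (L1 M) u" by blast
  then show ?thesis using S T TZ by (simp add: bounded_operator_def)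
qed

lemma bounded_operator_minus:
  assumes S: "bounded_operator (L1 M) S" and T: "bounded_operator (L1 M) T"
  shows "bounded_operator (L1 M) (op_minus (L1 M) S T)"
proof -
  obtain C where C: "\<And>u. u \<in> carr (L1 M) \<Longrightarrow> vnorm (L1 M) (S u) \<le> C * vnorm (L1 M) u"
    using S unfolding bounded_operator_def by blast
  obtain D where D: "\<And>u. u \<in> carr (L1 M) \<Longrightarrow> vnorm (L1 M) (T u) \<le> D * vnorm (L1 M) u"
    using T unfolding bounded_operator_def by blast
  have Z: "S u \<in> carr (L1 M)" "T u \<in> carr (L1 M)" if "u \<in> carr (L1 M)" for u
    using S T that unfolding bounded_operator_def by blast+
  have add: "vminus (L1 M) (vadd (L1 M) u v) (vadd (L1 M) u' v') = vadd (L1 M) (vminus (L1 M) u u') (vminus (L1 M) v v')"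
    if "u \<in> carr (L1 M)" "v \<in> carr (L1 M)" "u' \<in> carr (L1 M)" "v' \<in> carr (L1 M)" for u v u' v'
    using that by (auto simp: carr_L1 vadd_L1 vminus_L1 algebra_simps)
  have mult: "vminus (L1 M) (smul (L1 M) c u) (smul (L1 M) c u') = smul (L1 M) c (vminus (L1 M) u u')"
    if "u \<in> carr (L1 M)" "u' \<in> carr (L1 M)" for c u u'
    using that by (auto simp: carr_L1 smul_L1 vminus_L1 algebra_simps)
  have "vnorm (L1 M) (vminus (L1 M) (S u) (T u)) \<le> (C + D) * vnorm (L1 M) u" if u: "u \<in> carr (L1 M)" for u
  proof -
    have "vnorm (L1 M) (vminus (L1 M) (S u) (T u)) \<le> vnorm (L1 M) (S u) + vnorm (L1 M) (T u)"
      unfolding vminus_def using vnorm_vadd_le[OF Z(1)[OF u] smul_in_carr[OF Z(2)[OF u], of "-1"]]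
      by (simp add: vnorm_smul[OF Z(2)[OF u]])
    then show ?thesis using C[OF u] D[OF u] by (simp add: distrib_right)
  qed
  then have "\<exists>K. \<forall>u\<in>carr (L1 M). vnorm (L1 M) (vminus (L1 M) (S u) (T u)) \<le> K * vnorm (L1 M) u" by blast
  moreover have "vminus (L1 M) (S u) (T u) \<in> carr (L1 M)" if "u \<in> carr (L1 M)" for u
    using Z[OF that] by (simp add: vminus_def vadd_in_carr smul_in_carr)
  ultimately show ?thesis using S T Z by (simp add: bounded_operator_def op_minus_def add mult)
qed

section \<open>Functions on the discrete cube\<close>

text \<open>The induction rests on interpolation in one coordinate: for \<open>t j\<close> equal to
  1 or -1, \<open>h t\<close> is the combination of \<open>h (t(j := 1))\<close> and
  \<open>h (t(j := -1))\<close> with weights \<open>(1 + t j) / 2\<close> and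
  \<open>(1 - t j) / 2\<close>. Freezing the coordinates outside \<open>B\<close> at 1 lets
  \<open>h\<close> be arbitrary, for instance a thresholded product.\<close>

lemma cube_function_expand:
  fixes h :: "(nat \<Rightarrow> real) \<Rightarrow> real"
  assumes "finite B"
  shows "\<exists>c. \<forall>t. (\<forall>i. t i = 1 \<or> t i = -1) \<longrightarrow>
     h (\<lambda>i. if i \<in> B then t i else 1) = (\<Sum>F\<in>Pow B. c F * (\<Prod>i\<in>F. t i))"
  using assms
proof (induction B arbitrary: h rule: finite_induct)
  case empty
  show ?case by (rule exI[of _ "\<lambda>_. h (\<lambda>_. 1)"]) simp
next
  case (insert j B)
  obtain c1 where c1: "\<And>t. (\<forall>i. t i = 1 \<or> t i = -1) \<Longrightarrow>
      h ((\<lambda>i. if i \<in> B then t i else 1)(j := 1)) = (\<Sum>F\<in>Pow B. c1 F * (\<Prod>i\<in>F. t i))"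
    using insert.IH[of "\<lambda>t. h (t(j := 1))"] by blast
  obtain c2 where c2: "\<And>t. (\<forall>i. t i = 1 \<or> t i = -1) \<Longrightarrow>
      h ((\<lambda>i. if i \<in> B then t i else 1)(j := -1)) = (\<Sum>F\<in>Pow B. c2 F * (\<Prod>i\<in>F. t i))"
    using insert.IH[of "\<lambda>t. h (t(j := -1))"] by blast
  define c where "c F = (if j \<in> F then (c1 (F - {j}) - c2 (F - {j})) / 2 else (c1 F + c2 F) / 2)" for F
  have "h (\<lambda>i. if i \<in> insert j B then t i else 1) = (\<Sum>F\<in>Pow (insert j B). c F * (\<Prod>i\<in>F. t i))"
    if t: "\<forall>i. t i = 1 \<or> t i = -1" for t
  proof -
    have "(\<Sum>F\<in>Pow (insert j B). c F * (\<Prod>i\<in>F. t i))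
        = (\<Sum>F\<in>Pow B. c F * (\<Prod>i\<in>F. t i)) + (\<Sum>F\<in>insert j ` Pow B. c F * (\<Prod>i\<in>F. t i))"
      unfolding Pow_insert using insert.hyps by (intro sum.union_disjoint) auto
    also have "(\<Sum>F\<in>insert j ` Pow B. c F * (\<Prod>i\<in>F. t i)) = (\<Sum>F\<in>Pow B. c (insert j F) * (\<Prod>i\<in>insert j F. t i))"
    proof (subst sum.reindex)
      show "inj_on (insert j) (Pow B)" using insert.hyps by (auto simp: inj_on_def)
    qed simp
    also have "\<dots> = (\<Sum>F\<in>Pow B. (c1 F - c2 F) / 2 * (t j * (\<Prod>i\<in>F. t i)))"
    proof (intro sum.cong refl)
      fix F assume "F \<in> Pow B"
      then have "finite F" "j \<notin> F" using insert.hyps by (auto intro: finite_subset)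
      then show "c (insert j F) * (\<Prod>i\<in>insert j F. t i) = (c1 F - c2 F) / 2 * (t j * (\<Prod>i\<in>F. t i))"
        by (simp add: c_def)
    qed
    also have "(\<Sum>F\<in>Pow B. c F * (\<Prod>i\<in>F. t i)) = (\<Sum>F\<in>Pow B. (c1 F + c2 F) / 2 * (\<Prod>i\<in>F. t i))"
      using insert.hyps by (intro sum.cong refl) (auto simp: c_def)
    also have "\<dots> + (\<Sum>F\<in>Pow B. (c1 F - c2 F) / 2 * (t j * (\<Prod>i\<in>F. t i)))
        = (\<Sum>F\<in>Pow B. (1 + t j) / 2 * (c1 F * (\<Prod>i\<in>F. t i)) + (1 - t j) / 2 * (c2 F * (\<Prod>i\<in>F. t i)))"
      unfolding sum.distrib[symmetric] by (intro sum.cong refl) (simp add: field_simps)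
    also have "\<dots> = (1 + t j) / 2 * h ((\<lambda>i. if i \<in> B then t i else 1)(j := 1))
        + (1 - t j) / 2 * h ((\<lambda>i. if i \<in> B then t i else 1)(j := -1))"
      by (simp only: sum.distrib sum_distrib_left[symmetric] c1[OF t] c2[OF t])
    also have "\<dots> = h ((\<lambda>i. if i \<in> B then t i else 1)(j := t j))"
      using t[rule_format, of j] by auto
    also have "(\<lambda>i. if i \<in> B then t i else 1)(j := t j) = (\<lambda>i. if i \<in> insert j B then t i else 1)"
      by auto
    finally show ?thesis by simp
  qed
  then show ?case by blast
qed

section \<open>Trace estimate and lower bound for norms\<close>

context rademacher_system
begin

lemma coef_rep_ae_class:
  assumes "integrable M u" shows "coef F (rep (ae_class M u)) = coef F u"
  using rep_ae_class[OF assms] assms by (intro coef_cong_AE) (auto elim: eventually_mono)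

abbreviation "walsh_class F \<equiv> ae_class M (\<lambda>x. complex_of_real (walsh F x))"

lemma walsh_class_in_carr: "walsh_class F \<in> carr (L1 M)"
  by (simp add: ae_class_in_carr)

text \<open>Nuclear duality: the trace of \<open>V\<close> against the kernel \<open>c\<close> is the average over \<open>y\<close> of
  the pairings of \<open>V (f\<^sub>y)\<close> with \<open>\<phi>\<^sub>y\<close>, where \<open>f\<^sub>y\<close> is the normalized cell of \<open>y\<close> and \<open>\<phi>\<^sub>y\<close> is
  the translate of the polynomial \<open>c\<close> by \<open>y\<close>.\<close>

lemma trace_bound:
  assumes V: "bounded_operator (L1 M) V" and B: "finite B"
    and c: "\<And>t. (\<And>i. t i = 1 \<or> t i = -1) \<Longrightarrow> \<bar>\<Sum>F\<in>Pow B. c F * (\<Prod>i\<in>F. t i)\<bar> \<le> 1"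
  shows "cmod (\<Sum>F\<in>Pow B. of_real (c F) * coef F (rep (V (walsh_class F)))) \<le> op_norm (L1 M) V * a"
proof -
  define D where "D F G = coef F (rep (V (walsh_class G)))" for F G
  define \<phi> where "\<phi> y x = (\<Sum>F\<in>Pow B. complex_of_real (c F * walsh F y) * of_real (walsh F x))" for y x
  define f where "f y x = (\<Sum>G\<in>Pow B. complex_of_real (walsh G y) * of_real (walsh G x))" for y x
  define Q where "Q y = (\<Sum>F\<in>Pow B. \<Sum>G\<in>Pow B. of_real (c F * (walsh F y * walsh G y)) * D F G)" for y
  have VZ: "V u \<in> carr (L1 M)" if "u \<in> carr (L1 M)" for u
    using V that unfolding bounded_operator_def by blast
  have \<phi>m[measurable]: "\<phi> y \<in> borel_measurable M" for y unfolding \<phi>_def by measurable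
  have fi: "integrable M (f y)" for y unfolding f_def by simp
  have \<phi>1: "cmod (\<phi> y x) \<le> 1" for y x
  proof (cases "x \<in> A \<and> y \<in> A")
    case True
    \<comment> \<open>The product of the sign patterns of \<open>x\<close> and \<open>y\<close> is
      again a point of the cube, and \<open>walsh F y * walsh F x\<close> is the character of
      \<open>F\<close> there; so the hypothesis on \<open>c\<close> applies.\<close>
    define t where "t i = r i y * r i x" for i
    have t: "t i = 1 \<or> t i = -1" for i using r_sign[of i x] r_sign[of i y] by (auto simp: t_def)
    have "\<phi> y x = of_real (\<Sum>F\<in>Pow B. c F * (\<Prod>i\<in>F. t i))"
      using True by (simp add: \<phi>_def walsh_def t_def prod.distrib mult.assoc)
    then show ?thesis using c[OF t] by (simp del: of_real_sum)
  qed (auto simp: \<phi>_def walsh_def)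
  have pair: "pairing M (\<phi> y) v = (\<Sum>F\<in>Pow B. of_real (c F * walsh F y) * coef F (rep v))"
    if v: "v \<in> carr (L1 M)" for y v
  proof -
    have "pairing M (\<phi> y) v = (\<integral>x. (\<Sum>F\<in>Pow B. of_real (c F * walsh F y) * (of_real (walsh F x) * rep v x)) \<partial>M)"
      unfolding pairing_def \<phi>_def by (simp only: sum_distrib_right mult.assoc)
    also have "\<dots> = (\<Sum>F\<in>Pow B. \<integral>x. of_real (c F * walsh F y) * (of_real (walsh F x) * rep v x) \<partial>M)"
      by (rule Bochner_Integration.integral_sum)
         (rule integrable_mult_right[OF walsh_mult_u_integrable[OF rep_carr(1)[OF v]]])
    finally show ?thesis by (simp only: integral_mult_right_zero coef_def)
  qed
  have Q: "Q y = pairing M (\<phi> y) (V (ae_class M (f y)))" for y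
  proof -
    have bf: "bounded_functional (L1 M) (\<lambda>v. pairing M (\<phi> y) (V v))"
      by (rule bounded_functional_comp[OF bounded_functional_pairing[OF \<phi>m \<phi>1] V])
    have "pairing M (\<phi> y) (V (ae_class M (f y)))
        = (\<Sum>G\<in>Pow B. of_real (walsh G y) * pairing M (\<phi> y) (V (walsh_class G)))"
      unfolding f_def using B by (intro bounded_functional_sum[OF bf]) auto
    also have "\<dots> = (\<Sum>G\<in>Pow B. \<Sum>F\<in>Pow B. of_real (c F * (walsh F y * walsh G y)) * D F G)"
      by (intro sum.cong refl)
         (simp add: pair[OF VZ[OF walsh_class_in_carr]] sum_distrib_left D_def mult_ac)
    also have "\<dots> = Q y" unfolding Q_def by (rule sum.swap)
    finally show ?thesis by simp
  qed
  \<comment> \<open>With signs as weights the Riesz product is nonnegative, so the norm is just its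
    integral, which is \<open>a\<close> whatever the size of \<open>B\<close>.\<close>
  have fnorm: "vnorm (L1 M) (ae_class M (f y)) = a" if y: "y \<in> A" for y
  proof -
    have "cmod (f y x) = indicator A x * (\<Prod>i\<in>B. 1 + r i y * r i x)" for x
    proof -
      have nonneg: "0 \<le> indicator A x * (\<Prod>i\<in>B. 1 + r i y * r i x)"
      proof (intro mult_nonneg_nonneg prod_nonneg)
        show "0 \<le> 1 + r i y * r i x" for i using r_sign[of i x] r_sign[of i y] by auto
      qed simp
      have "f y x = of_real (indicator A x * (\<Prod>i\<in>B. 1 + r i y * r i x))"
        unfolding riesz_product_expand[OF B] f_def using y by (simp add: walsh_def)
      then show ?thesis using nonneg by (simp only: norm_of_real abs_of_nonneg)
    qed
    then show ?thesis using fi integral_riesz_product[OF B] by (simp add: vnorm_L1)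
  qed
  have N0: "op_norm (L1 M) V \<ge> 0"
  proof -
    have "0 \<le> op_norm (L1 M) V * vnorm (L1 M) (walsh_class {})"
      using op_norm_bound[OF V walsh_class_in_carr[of "{}"]] vnorm_L1_nonneg[OF VZ[OF walsh_class_in_carr]]
      by (rule order_trans[rotated])
    moreover have "vnorm (L1 M) (walsh_class {}) = a"
      using A by (simp add: vnorm_L1 abs_walsh)
    ultimately show ?thesis using A_pos by (simp add: zero_le_mult_iff)
  qed
  have Qle: "cmod (Q y) \<le> op_norm (L1 M) V * a * indicator A y" for y
  proof (cases "y \<in> A")
    case True
    have "cmod (Q y) \<le> 1 * vnorm (L1 M) (V (ae_class M (f y)))"
      unfolding Q by (rule pairing_bound[OF VZ[OF ae_class_in_carr[OF fi]] \<phi>m \<phi>1])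
    also have "\<dots> \<le> op_norm (L1 M) V * a"
      using op_norm_bound[OF V ae_class_in_carr[OF fi[of y]]] by (simp add: fnorm[OF True])
    finally show ?thesis using True by simp
  qed (simp add: Q_def walsh_def)
  have Qi: "integrable M (\<lambda>y. complex_of_real (c F * (walsh F y * walsh G y)) * D F G)"
    if "F \<in> Pow B" "G \<in> Pow B" for F G
  proof -
    have "finite F" "finite G" using that B by (auto intro: finite_subset)
    then show ?thesis
      by (intro integrable_mult_left integrable_of_real integrable_mult_right) simp
  qed
  have "(\<integral>y. Q y \<partial>M) = (\<Sum>F\<in>Pow B. \<integral>y. (\<Sum>G\<in>Pow B. of_real (c F * (walsh F y * walsh G y)) * D F G) \<partial>M)"
    unfolding Q_def by (rule Bochner_Integration.integral_sum) (intro Bochner_Integration.integrable_sum Qi)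
  also have "\<dots> = (\<Sum>F\<in>Pow B. \<Sum>G\<in>Pow B. \<integral>y. of_real (c F * (walsh F y * walsh G y)) * D F G \<partial>M)"
    by (intro sum.cong refl Bochner_Integration.integral_sum Qi)
  also have "\<dots> = (\<Sum>F\<in>Pow B. \<Sum>G\<in>Pow B. if F = G then of_real (c F * a) * D F G else 0)"
  proof (intro sum.cong refl)
    fix F G assume "F \<in> Pow B" "G \<in> Pow B"
    then have "finite F" "finite G" using B by (auto intro: finite_subset)
    have eq: "(\<integral>y. of_real (c F * (walsh F y * walsh G y)) * D F G \<partial>M)
        = of_real (c F * (\<integral>y. walsh F y * walsh G y \<partial>M)) * D F G"
      by (simp only: integral_mult_left_zero integral_complex_of_real integral_mult_right_zero)
    show "(\<integral>y. of_real (c F * (walsh F y * walsh G y)) * D F G \<partial>M) = (if F = G then of_real (c F * a) * D F G else 0)"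
      unfolding eq walsh_orthogonal[OF \<open>finite F\<close> \<open>finite G\<close>] by simp
  qed
  also have "\<dots> = (\<Sum>F\<in>Pow B. of_real (c F * a) * D F F)"
    using B by (intro sum.cong refl) (simp add: sum.delta)
  also have "\<dots> = of_real a * (\<Sum>F\<in>Pow B. of_real (c F) * D F F)"
    by (simp add: sum_distrib_left mult_ac)
  finally have "a * cmod (\<Sum>F\<in>Pow B. of_real (c F) * D F F) = cmod (\<integral>y. Q y \<partial>M)"
    using A_pos by (simp add: norm_mult)
  also have "\<dots> \<le> (\<integral>y. cmod (Q y) \<partial>M)" by (rule integral_norm_bound)
  also have "\<dots> \<le> (\<integral>y. op_norm (L1 M) V * a * indicator A y \<partial>M)"
  proof (rule integral_mono)
    show "integrable M (\<lambda>y. cmod (Q y))" unfolding Q_def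
      by (intro integrable_norm Bochner_Integration.integrable_sum Qi)
    show "integrable M (\<lambda>y. op_norm (L1 M) V * a * indicator A y)"
      using A by (intro integrable_mult_right integrable_real_indicator) (auto simp: emeasure_eq_measure)
  qed (rule Qle)
  \<comment> \<open>The \<open>a\<close> on the left comes from orthogonality and is cancelled by
    the one from integrating over \<open>y \<in> A\<close>; the factor that stays is the norm of the
    class of \<open>f y\<close>.\<close>
  also have "\<dots> = a * (op_norm (L1 M) V * a)" using A by simp
  finally show ?thesis using A_pos by (simp add: D_def)
qed

text \<open>The test function is the indicator of the event that the Riesz product \<open>g\<close> over a block is
  at least 1. Both errors are controlled by the Hellinger affinity, the integral of \<open>sqrt g\<close>, and
  the bound \<open>K\<close> does not depend on the position \<open>N\<close> of the block.\<close>

lemma block_test_function: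
  assumes d: "d > 0"
  obtains K where "K > 0"
    "\<And>N. \<exists>B c. finite B \<and> B \<subseteq> {N..} \<and>
       (\<forall>t. (\<forall>i. t i = 1 \<or> t i = -1) \<longrightarrow> \<bar>\<Sum>F\<in>Pow B. c F * (\<Prod>i\<in>F. t i)\<bar> \<le> 1) \<and>
       \<bar>c {}\<bar> \<le> d \<and> 1 - d \<le> (\<Sum>F\<in>Pow B. c F * Eps F) \<and> (\<Sum>F\<in>Pow B. \<bar>c F\<bar> * Eps F) \<le> K"
proof -
  \<comment> \<open>The affinity \<open>p\<close> will satisfy \<open>p ^ 8 \<le> 1 / R\<close>. The
    exponent 8 is the price for comparing \<open>P i\<close> with
    \<open>1 / (1 + (eps i)\<^sup>2)\<close>, whose products telescope.\<close>
  obtain R :: nat where R: "R > 0" "1 / real R < d^8"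
    using reals_Archimedean[of "d^8"] d by (metis inverse_eq_divide zero_less_Suc zero_less_power)
  show ?thesis
  proof (rule that[of "(1 + real R) / 2"])
    show "(1 + real R) / 2 > 0" by simp
    fix N :: nat
    \<comment> \<open>Telescoping gives \<open>(L + 1) / (N + 1)\<close>, and the \<open>- 1\<close>
      makes this exactly \<open>R\<close> for every \<open>N\<close>; hence the final bound does not
      depend on \<open>N\<close>.\<close>
    define L where "L = R * (N + 1) - 1"
    define B where "B = {N..<L}"
    have fB[simp]: "finite B" by (simp add: B_def)
    have "real L + 1 = real R * (real N + 1)"
      using R(1) by (simp add: L_def of_nat_diff algebra_simps)
    moreover have NL: "N \<le> L" using R(1) by (cases R) (auto simp: L_def)
    moreover have "(\<Prod>i\<in>{N..<L}. 1 + (eps i)\<^sup>2) = (real L + 1) / (real N + 1)" using NL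
    proof (induction L rule: dec_induct)
      case (step n)
      have "1 + (eps n)\<^sup>2 = (real n + 2) / (real n + 1)"
        by (simp add: eps_def power_divide field_simps)
      then show ?case using step by (simp add: prod.atLeastLessThan_Suc)
    qed simp
    ultimately have prodR: "(\<Prod>i\<in>B. 1 + (eps i)\<^sup>2) = real R"
      by (simp add: B_def)
    \<comment> \<open>For a sign \<open>t\<close>,
      \<open>sqrt (1 + eps i * t) = P i + Q i * t\<close>. So \<open>P i\<close> is the mean of the
      square root, that is the Hellinger affinity of one biased coin with a fair one.\<close>
    define P where "P i = (sqrt (1 + eps i) + sqrt (1 - eps i)) / 2" for i
    define Q where "Q i = (sqrt (1 + eps i) - sqrt (1 - eps i)) / 2" for i
    have P_pos: "P i > 0" for i
      using eps_pos[of i] eps_le_1[of i] by (simp add: P_def add_pos_nonneg)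
    \<comment> \<open>With \<open>x = (eps i)\<^sup>2\<close> one has
      \<open>(P i)\<^sup>2 \<le> 1 - x / 4 \<le> exp (- x / 4)\<close>; the fourth power removes the
      4 and leaves \<open>exp (- x)\<close>.\<close>
    have P8: "P i ^ 8 \<le> 1 / (1 + (eps i)\<^sup>2)" for i
    proof -
      define x where "x = (eps i)\<^sup>2"
      have x: "0 < x" "x \<le> 1" using eps_pos[of i] eps_le_1[of i] by (auto simp: x_def power_le_one)
      have "(P i)\<^sup>2 = (1 + sqrt (1 + eps i) * sqrt (1 - eps i)) / 2"
        using eps_pos[of i] eps_le_1[of i] by (simp add: P_def power2_eq_square field_simps)
      also have "sqrt (1 + eps i) * sqrt (1 - eps i) = sqrt (1 - x)"
        by (simp add: x_def real_sqrt_mult[symmetric] power2_eq_square algebra_simps)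
      also have "sqrt (1 - x) \<le> 1 - x / 2"
        using x by (intro real_le_lsqrt) (auto simp: power2_eq_square field_simps)
      finally have "(P i)\<^sup>2 \<le> 1 - x / 4" by simp
      also have "\<dots> \<le> exp (- x / 4)" using exp_ge_add_one_self[of "- x / 4"] by simp
      finally have "((P i)\<^sup>2) ^ 4 \<le> exp (- x / 4) ^ 4" by (intro power_mono) auto
      also have "\<dots> = exp (- x)" using exp_of_nat_mult[of 4 "- x / 4"] by simp
      also have "\<dots> = 1 / exp x" by (simp add: exp_minus inverse_eq_divide)
      also have "\<dots> \<le> 1 / (1 + x)" using x exp_ge_add_one_self[of x] by (intro divide_left_mono) auto
      finally show ?thesis by (simp add: x_def power_mult[symmetric])
    qed
    define p where "p = (\<Prod>i\<in>B. P i)"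
    have "p ^ 8 = (\<Prod>i\<in>B. P i ^ 8)" by (simp add: p_def prod_power_distrib)
    also have "\<dots> \<le> (\<Prod>i\<in>B. 1 / (1 + (eps i)\<^sup>2))"
      using P8 by (intro prod_mono) auto
    also have "\<dots> = 1 / real R" by (simp add: prod_dividef prodR)
    finally have "p ^ 8 < d ^ 8" using R by simp
    then have pd: "p < d" by (rule power_less_imp_less_base) (use d in simp)
    define g where "g t = (\<Prod>i\<in>B. 1 + eps i * t i)" for t :: "nat \<Rightarrow> real"
    define h where "h t = (if g t \<ge> 1 then 1 else 0 :: real)" for t
    obtain c where c: "\<And>t. (\<And>i. t i = 1 \<or> t i = -1) \<Longrightarrow>
        h (\<lambda>i. if i \<in> B then t i else 1) = (\<Sum>F\<in>Pow B. c F * (\<Prod>i\<in>F. t i))"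
      using cube_function_expand[OF fB, of h] by blast
    have "g (\<lambda>i. if i \<in> B then t i else 1) = g t" for t
      unfolding g_def by (intro prod.cong) auto
    then have hc: "h t = (\<Sum>F\<in>Pow B. c F * (\<Prod>i\<in>F. t i))" if "\<And>i. t i = 1 \<or> t i = -1" for t
      using c[OF that] by (simp add: h_def)
    have g0: "g t \<ge> 0" and sq: "sqrt (g t) = (\<Prod>i\<in>B. P i + Q i * t i)" if t: "\<And>i. t i = 1 \<or> t i = -1" for t
    proof -
      have "0 \<le> 1 + eps i * t i" for i
        using t[of i] eps_pos[of i] eps_le_1[of i] by auto
      then show "g t \<ge> 0" unfolding g_def by (intro prod_nonneg) auto
      have "sqrt (1 + eps i * t i) = P i + Q i * t i" for i
        using t[of i] by (auto simp: P_def Q_def field_simps)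
      moreover have "sqrt (\<Prod>i\<in>C. f i) = (\<Prod>i\<in>C. sqrt (f i))" for f and C :: "nat set"
        by (induction C rule: infinite_finite_induct) (auto simp: real_sqrt_mult)
      ultimately show "sqrt (g t) = (\<Prod>i\<in>B. P i + Q i * t i)"
        by (simp add: g_def)
    qed
    define \<rho> where "\<rho> x i = r i x" for x i
    have \<rho>: "\<rho> x i = 1 \<or> \<rho> x i = -1" for x i using r_sign by (simp add: \<rho>_def)
    have g\<rho>0: "g (\<rho> x) \<ge> 0" for x by (rule g0) (rule \<rho>)
    have h_exp: "indicator A x * h (\<rho> x) = (\<Sum>F\<in>Pow B. c F * walsh F x)" for x
      by (simp add: hc[OF \<rho>] walsh_def \<rho>_def sum_distrib_left mult_ac)
    have g_exp: "indicator A x * g (\<rho> x) = (\<Sum>F\<in>Pow B. Eps F * walsh F x)" for x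
      unfolding g_def \<rho>_def riesz_product_expand[OF fB] by (simp add: Eps_def)
    \<comment> \<open>Taking out the factors \<open>P i\<close> leaves a Riesz product, of integral
      \<open>a\<close>, so the square root has integral \<open>p * a\<close>.\<close>
    have s_exp: "indicator A x * sqrt (g (\<rho> x)) = p * (indicator A x * (\<Prod>i\<in>B. 1 + Q i / P i * r i x))" for x
    proof -
      have "P i + Q i * r i x = P i * (1 + Q i / P i * r i x)" for i
        using P_pos[of i] by (simp add: field_simps)
      then show ?thesis by (simp add: sq[OF \<rho>] \<rho>_def p_def prod.distrib mult_ac)
    qed
    have finF: "finite F" if "F \<in> Pow B" for F using that finite_subset[OF _ fB] by auto
    have int_s: "(\<integral>x. indicator A x * sqrt (g (\<rho> x)) \<partial>M) = p * a"
      unfolding s_exp integral_mult_right_zero integral_riesz_product[OF fB] ..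
    have i_s: "integrable M (\<lambda>x. indicator A x * sqrt (g (\<rho> x)))"
      unfolding s_exp riesz_product_expand[OF fB]
      by (intro integrable_mult_right Bochner_Integration.integrable_sum walsh_integrable)
    have i_g: "integrable M (\<lambda>x. indicator A x * g (\<rho> x))"
      unfolding g_exp by (intro integrable_mult_right Bochner_Integration.integrable_sum walsh_integrable)
    have i_h: "integrable M (\<lambda>x. indicator A x * h (\<rho> x))"
      unfolding h_exp by (intro integrable_mult_right Bochner_Integration.integrable_sum walsh_integrable)
    have int_g: "(\<integral>x. indicator A x * g (\<rho> x) \<partial>M) = a"
      using integral_riesz_product[OF fB, of eps] by (simp add: g_def \<rho>_def)
    have int_h: "(\<integral>x. indicator A x * h (\<rho> x) \<partial>M) = a * c {}"
    proof -
      have "(\<integral>x. indicator A x * h (\<rho> x) \<partial>M) = (\<Sum>F\<in>Pow B. c F * (\<integral>x. walsh F x \<partial>M))"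
        unfolding h_exp by (subst Bochner_Integration.integral_sum) auto
      also have "\<dots> = (\<Sum>F\<in>Pow B. if F = {} then a * c {} else 0)"
        using finF by (intro sum.cong) (auto simp: integral_walsh)
      finally show ?thesis by (simp add: sum.delta)
    qed
    have prod_exp: "(indicator A x * h (\<rho> x)) * (\<Sum>G\<in>Pow B. e G * walsh G x)
        = (\<Sum>F\<in>Pow B. \<Sum>G\<in>Pow B. c F * e G * (walsh F x * walsh G x))" for e x
      unfolding h_exp by (simp add: sum_product mult_ac)
    have i_prod: "integrable M (\<lambda>x. (indicator A x * h (\<rho> x)) * (\<Sum>G\<in>Pow B. e G * walsh G x))" for e
      unfolding prod_exp using finF
      by (intro Bochner_Integration.integrable_sum integrable_mult_right walsh_mult_integrable)
    \<comment> \<open>The weights \<open>e\<close> are kept general: on \<open>A\<close> the second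
      factor is \<open>g\<close> for \<open>Eps\<close> and \<open>h\<close> for
      \<open>c\<close>.\<close>
    have int_prod: "(\<integral>x. (indicator A x * h (\<rho> x)) * (\<Sum>G\<in>Pow B. e G * walsh G x) \<partial>M)
        = a * (\<Sum>F\<in>Pow B. c F * e F)" for e
    proof -
      have i: "integrable M (\<lambda>x. c F * e G * (walsh F x * walsh G x))" if "F \<in> Pow B" "G \<in> Pow B" for F G
        by (intro integrable_mult_right walsh_mult_integrable finF that)
      have "(\<integral>x. (indicator A x * h (\<rho> x)) * (\<Sum>G\<in>Pow B. e G * walsh G x) \<partial>M)
          = (\<Sum>F\<in>Pow B. \<integral>x. (\<Sum>G\<in>Pow B. c F * e G * (walsh F x * walsh G x)) \<partial>M)"
        unfolding prod_exp
        by (rule Bochner_Integration.integral_sum) (intro Bochner_Integration.integrable_sum i)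
      also have "\<dots> = (\<Sum>F\<in>Pow B. \<Sum>G\<in>Pow B. \<integral>x. c F * e G * (walsh F x * walsh G x) \<partial>M)"
        by (intro sum.cong refl Bochner_Integration.integral_sum i)
      also have "\<dots> = (\<Sum>F\<in>Pow B. \<Sum>G\<in>Pow B. c F * e G * (\<integral>x. walsh F x * walsh G x \<partial>M))"
        by (simp only: integral_mult_right_zero)
      also have "\<dots> = (\<Sum>F\<in>Pow B. \<Sum>G\<in>Pow B. if F = G then c F * e G * a else 0)"
        using finF by (intro sum.cong) (auto simp: walsh_orthogonal)
      also have "\<dots> = (\<Sum>F\<in>Pow B. c F * e F * a)"
        by (intro sum.cong refl) (simp add: sum.delta)
      finally show ?thesis by (simp add: sum_distrib_left mult_ac)
    qed
    have iA: "integrable M (\<lambda>x. indicator A x :: real)"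
      using A by (intro integrable_real_indicator) (auto simp: emeasure_eq_measure)
    have c0: "\<bar>c {}\<bar> \<le> d"
    proof -
      have "0 \<le> a * c {}" unfolding int_h[symmetric]
        by (intro Bochner_Integration.integral_nonneg) (simp add: h_def)
      \<comment> \<open>Here \<open>h \<le> sqrt g\<close>, because \<open>g \<ge> 1\<close>
        wherever \<open>h\<close> is 1.\<close>
      moreover have "a * c {} \<le> p * a" unfolding int_h[symmetric] int_s[symmetric]
      proof (rule integral_mono[OF i_h i_s])
        fix x show "indicator A x * h (\<rho> x) \<le> indicator A x * sqrt (g (\<rho> x))"
          using g\<rho>0[of x] by (intro mult_left_mono) (auto simp: h_def)
      qed
      ultimately show ?thesis using A_pos pd by (simp add: zero_le_mult_iff mult.commute)
    qed
    have cE: "1 - d \<le> (\<Sum>F\<in>Pow B. c F * Eps F)"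
    proof -
      have "(\<integral>x. indicator A x * g (\<rho> x) \<partial>M)
          \<le> (\<integral>x. (indicator A x * h (\<rho> x)) * (\<Sum>G\<in>Pow B. Eps G * walsh G x) + indicator A x * sqrt (g (\<rho> x)) \<partial>M)"
      proof (rule integral_mono[OF i_g Bochner_Integration.integrable_add[OF i_prod i_s]])
        fix x
        \<comment> \<open>Multiplication by \<open>h\<close> loses only the part where
          \<open>g < 1\<close>, and there \<open>g \<le> sqrt g\<close>.\<close>
        have "g (\<rho> x) \<le> h (\<rho> x) * g (\<rho> x) + sqrt (g (\<rho> x))"
        proof (cases "g (\<rho> x) \<ge> 1")
          case True
          then show ?thesis by (simp add: h_def)
        next
          case False
          then have "(g (\<rho> x))\<^sup>2 \<le> g (\<rho> x)"
            using g\<rho>0[of x] by (simp add: power2_eq_square mult_left_le)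
          then show ?thesis using False by (simp add: h_def real_le_rsqrt)
        qed
        then show "indicator A x * g (\<rho> x)
            \<le> (indicator A x * h (\<rho> x)) * (\<Sum>G\<in>Pow B. Eps G * walsh G x) + indicator A x * sqrt (g (\<rho> x))"
          unfolding g_exp[symmetric] by (auto simp: indicator_def)
      qed
      then have "a \<le> a * (\<Sum>F\<in>Pow B. c F * Eps F) + p * a"
        using i_prod[of Eps] i_s by (simp add: int_g int_prod int_s)
      then have "a * 1 \<le> a * ((\<Sum>F\<in>Pow B. c F * Eps F) + p)" by (simp add: algebra_simps)
      then have "1 \<le> (\<Sum>F\<in>Pow B. c F * Eps F) + p"
        using A_pos by (simp only: mult_le_cancel_left_pos)
      then show ?thesis using pd by simp
    qed
    have cK: "(\<Sum>F\<in>Pow B. \<bar>c F\<bar> * Eps F) \<le> (1 + real R) / 2"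
    proof -
      \<comment> \<open>Since \<open>h\<close> is an indicator, \<open>h * h \<le> 1\<close>; by
        orthogonality this bounds the square sum of \<open>c\<close> by 1.\<close>
      have "a * (\<Sum>F\<in>Pow B. c F * c F) \<le> (\<integral>x. indicator A x \<partial>M)"
        unfolding int_prod[symmetric]
        by (rule integral_mono[OF i_prod iA]) (auto simp: h_exp[symmetric] h_def indicator_def)
      then have c2: "(\<Sum>F\<in>Pow B. (c F)\<^sup>2) \<le> 1" using A A_pos by (simp add: power2_eq_square)
      have "(\<Prod>i\<in>B. (eps i)\<^sup>2 + 1) = (\<Sum>F\<in>Pow B. (\<Prod>i\<in>F. (eps i)\<^sup>2) * (\<Prod>i\<in>B-F. 1))"
        by (rule prod_add[OF fB])
      then have E2: "(\<Sum>F\<in>Pow B. (Eps F)\<^sup>2) = real R"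
        using prodR by (simp add: Eps_def prod_power_distrib add.commute)
      \<comment> \<open>The square sums of \<open>c\<close> and \<open>Eps\<close> are at most 1 and
        equal to \<open>R\<close>, so the inequality of arithmetic and geometric means gives the
        constant \<open>(1 + R) / 2\<close>.\<close>
      have "(\<Sum>F\<in>Pow B. \<bar>c F\<bar> * Eps F) \<le> (\<Sum>F\<in>Pow B. ((c F)\<^sup>2 + (Eps F)\<^sup>2) / 2)"
      proof (rule sum_mono)
        fix F
        have "0 \<le> (\<bar>c F\<bar> - Eps F)\<^sup>2" by simp
        then show "\<bar>c F\<bar> * Eps F \<le> ((c F)\<^sup>2 + (Eps F)\<^sup>2) / 2"
          by (simp add: power2_diff)
      qed
      also have "\<dots> = ((\<Sum>F\<in>Pow B. (c F)\<^sup>2) + (\<Sum>F\<in>Pow B. (Eps F)\<^sup>2)) / 2"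
        by (simp add: sum.distrib sum_divide_distrib[symmetric])
      finally show ?thesis using c2 E2 by simp
    qed
    have "\<bar>\<Sum>F\<in>Pow B. c F * (\<Prod>i\<in>F. t i)\<bar> \<le> 1" if "\<forall>i. t i = 1 \<or> t i = -1" for t
      using hc[of t] that by (simp add: h_def split: if_splits)
    then show "\<exists>B c. finite B \<and> B \<subseteq> {N..} \<and>
       (\<forall>t. (\<forall>i. t i = 1 \<or> t i = -1) \<longrightarrow> \<bar>\<Sum>F\<in>Pow B. c F * (\<Prod>i\<in>F. t i)\<bar> \<le> 1) \<and>
       \<bar>c {}\<bar> \<le> d \<and> 1 - d \<le> (\<Sum>F\<in>Pow B. c F * Eps F) \<and> (\<Sum>F\<in>Pow B. \<bar>c F\<bar> * Eps F) \<le> (1 + real R) / 2"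
      using c0 cE cK by (intro exI[of _ B] exI[of _ c]) (auto simp: B_def)
  qed
qed

text \<open>This isolates what \<open>S - S T\<close> and \<open>S - T S\<close> have in common, the
  shape of their diagonal coefficients. A norm below 1 would leave a fixed gap to the trace bound,
  while the errors on a far block can be made smaller than any gap.\<close>

lemma op_norm_ge_1:
  fixes \<tau> :: "nat set \<Rightarrow> complex"
  assumes V: "bounded_operator (L1 M) V"
    and VF: "\<And>F. finite F \<Longrightarrow> coef F (rep (V (walsh_class F))) = of_real (Eps F) * (of_real a - \<tau> F)"
    and \<tau>: "\<And>\<theta>. \<theta> > 0 \<Longrightarrow> \<exists>N. \<forall>F. finite F \<longrightarrow> F \<noteq> {} \<longrightarrow> F \<subseteq> {N..} \<longrightarrow> cmod (\<tau> F) \<le> \<theta>"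
  shows "op_norm (L1 M) V \<ge> 1"
proof (rule ccontr)
  assume less: "\<not> ?thesis"
  define gap where "gap = a - op_norm (L1 M) V * a"
  have gap: "gap > 0"
    using less A_pos by (simp add: gap_def)
  \<comment> \<open>The loss is \<open>d * a\<close>, as the weighted sum reaches only
    \<open>1 - d\<close>, plus \<open>d * cmod (\<tau> {})\<close> from the uncontrolled empty set;
    together this is \<open>d * s\<close>, a third of the gap.\<close>
  define s where "s = a + cmod (\<tau> {})"
  define d where "d = gap / (3 * s)"
  have pos: "s > 0" using A_pos by (simp add: s_def add_pos_nonneg)
  then have d: "d > 0" using gap by (simp add: d_def)
  have dgap: "d * s = gap / 3" using pos by (simp add: d_def)
  obtain K where K: "K > 0" and blocks: "\<And>N. \<exists>B c. finite B \<and> B \<subseteq> {N..} \<and>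
       (\<forall>t. (\<forall>i. t i = 1 \<or> t i = -1) \<longrightarrow> \<bar>\<Sum>F\<in>Pow B. c F * (\<Prod>i\<in>F. t i)\<bar> \<le> 1) \<and>
       \<bar>c {}\<bar> \<le> d \<and> 1 - d \<le> (\<Sum>F\<in>Pow B. c F * Eps F) \<and> (\<Sum>F\<in>Pow B. \<bar>c F\<bar> * Eps F) \<le> K"
    by (rule block_test_function[OF d]) (rule that)
  \<comment> \<open>The constant \<open>K\<close> depends on \<open>d\<close> alone. So \<theta>,
    and then the position \<open>N\<close> beyond which \<tau> is at most \<theta>, can be fixed
    before the block is taken.\<close>
  define \<theta> where "\<theta> = gap / (3 * K)"
  have \<theta>: "\<theta> > 0" using gap K by (simp add: \<theta>_def)
  obtain N where N: "\<And>F. finite F \<Longrightarrow> F \<noteq> {} \<Longrightarrow> F \<subseteq> {N..} \<Longrightarrow> cmod (\<tau> F) \<le> \<theta>"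
    using \<tau>[OF \<theta>] by blast
  obtain B c where B: "finite B" "B \<subseteq> {N..}"
    and c1: "\<And>t. (\<And>i. t i = 1 \<or> t i = -1) \<Longrightarrow> \<bar>\<Sum>F\<in>Pow B. c F * (\<Prod>i\<in>F. t i)\<bar> \<le> 1"
    and c: "\<bar>c {}\<bar> \<le> d" "1 - d \<le> (\<Sum>F\<in>Pow B. c F * Eps F)" "(\<Sum>F\<in>Pow B. \<bar>c F\<bar> * Eps F) \<le> K"
    using blocks[of N] by blast
  have finF: "finite F" if "F \<in> Pow B" for F using that finite_subset[OF _ B(1)] by auto
  define X where "X = (\<Sum>F\<in>Pow B. of_real (c F * Eps F) * \<tau> F)"
  have X: "cmod X \<le> d * cmod (\<tau> {}) + K * \<theta>"
  proof -
    have "cmod X \<le> (\<Sum>F\<in>Pow B. cmod (of_real (c F * Eps F) * \<tau> F))"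
      unfolding X_def by (rule norm_sum)
    also have "\<dots> = (\<Sum>F\<in>Pow B. \<bar>c F\<bar> * Eps F * cmod (\<tau> F))"
      by (simp add: norm_mult abs_mult Eps_nonneg)
    also have "\<dots> = \<bar>c {}\<bar> * cmod (\<tau> {}) + (\<Sum>F\<in>Pow B - {{}}. \<bar>c F\<bar> * Eps F * cmod (\<tau> F))"
      using B(1) by (subst sum.remove[of _ "{}"]) (auto simp: Eps_def)
    also have "\<dots> \<le> d * cmod (\<tau> {}) + (\<Sum>F\<in>Pow B - {{}}. \<bar>c F\<bar> * Eps F * \<theta>)"
      using c(1) finF B(2) Eps_nonneg
      by (intro add_mono mult_right_mono sum_mono mult_left_mono N) auto
    also have "\<dots> = d * cmod (\<tau> {}) + (\<Sum>F\<in>Pow B - {{}}. \<bar>c F\<bar> * Eps F) * \<theta>"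
      by (simp add: sum_distrib_right)
    also have "\<dots> \<le> d * cmod (\<tau> {}) + (\<Sum>F\<in>Pow B. \<bar>c F\<bar> * Eps F) * \<theta>"
      using \<theta> B(1) Eps_nonneg by (intro add_left_mono mult_right_mono sum_mono2) auto
    also have "\<dots> \<le> d * cmod (\<tau> {}) + K * \<theta>"
      using \<theta> c(3) by (intro add_left_mono mult_right_mono) auto
    finally show ?thesis .
  qed
  have "(\<Sum>F\<in>Pow B. of_real (c F) * coef F (rep (V (walsh_class F))))
      = (\<Sum>F\<in>Pow B. of_real a * of_real (c F * Eps F) - of_real (c F * Eps F) * \<tau> F)"
    using finF by (intro sum.cong refl) (simp add: VF algebra_simps)
  also have "\<dots> = of_real (a * (\<Sum>F\<in>Pow B. c F * Eps F)) - X"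
    by (simp add: sum_subtractf X_def sum_distrib_left)
  finally have "cmod (of_real (a * (\<Sum>F\<in>Pow B. c F * Eps F)) - X) \<le> op_norm (L1 M) V * a"
    using trace_bound[OF V B(1) c1] by simp
  moreover have "cmod (of_real (a * (\<Sum>F\<in>Pow B. c F * Eps F)) - X) \<ge> cmod (of_real (a * (\<Sum>F\<in>Pow B. c F * Eps F))) - cmod X"
    by (rule norm_triangle_ineq2)
  moreover have "cmod (of_real (a * (\<Sum>F\<in>Pow B. c F * Eps F))) \<ge> a * (1 - d)"
    using c(2) A_pos unfolding norm_of_real by (intro order_trans[OF _ abs_ge_self] mult_left_mono) auto
  ultimately have "a * (1 - d) - (d * cmod (\<tau> {}) + K * \<theta>) \<le> op_norm (L1 M) V * a"
    using X by linarith
  then have "gap \<le> d * s + K * \<theta>"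
    by (simp add: gap_def s_def algebra_simps)
  also have "\<dots> = gap / 3 + gap / 3" using dgap K by (simp add: \<theta>_def)
  finally show False using gap by simp
qed

text \<open>By duality the values of a bounded functional on the Walsh classes are square summable,
  so only finitely many sets carry a value of modulus at least \<open>e\<close>. Their union is
  bounded, and a nonempty set beyond that bound is not among them.\<close>

lemma walsh_weakly_null:
  assumes F: "\<And>n. finite (F n)" "\<And>n. F n \<noteq> {}" "\<And>n. F n \<subseteq> {n..}"
  shows "weakly_null (L1 M) (\<lambda>n. walsh_class (F n))"
  unfolding weakly_null_def
proof (intro conjI allI impI walsh_class_in_carr)
  fix \<psi> assume \<psi>: "bounded_functional (L1 M) \<psi>"
  obtain C where C: "\<And>u. u \<in> carr (L1 M) \<Longrightarrow> cmod (\<psi> u) \<le> C * vnorm (L1 M) u"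
    using \<psi> unfolding bounded_functional_def by blast
  define d where "d G = \<psi> (walsh_class G)" for G
  have bessel: "(\<Sum>G\<in>\<F>. (cmod (d G))\<^sup>2) \<le> (\<bar>C\<bar> * a)\<^sup>2"
    if \<F>: "finite \<F>" "\<And>G. G \<in> \<F> \<Longrightarrow> finite G" for \<F>
  proof (rule dual_bessel[OF \<F>])
    show "0 \<le> \<bar>C\<bar>" by (rule abs_ge_zero)
    let ?p = "\<lambda>x. \<Sum>G\<in>\<F>. cnj (d G) * complex_of_real (walsh G x)"
    have "\<psi> (ae_class M ?p) = (\<Sum>G\<in>\<F>. cnj (d G) * d G)"
      unfolding d_def by (rule bounded_functional_sum[OF \<psi> \<F>(1)]) simp
    also have "\<dots> = of_real (\<Sum>G\<in>\<F>. (cmod (d G))\<^sup>2)"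
      by (simp add: complex_norm_square mult.commute del: of_real_power)
    finally have "(\<Sum>G\<in>\<F>. (cmod (d G))\<^sup>2) = cmod (\<psi> (ae_class M ?p))"
      by (simp add: sum_nonneg del: of_real_sum of_real_power)
    also have "\<dots> \<le> C * (\<integral>x. cmod (?p x) \<partial>M)"
      using C[OF ae_class_in_carr[of M ?p]] by (simp add: vnorm_L1)
    also have "\<dots> \<le> \<bar>C\<bar> * (\<integral>x. cmod (?p x) \<partial>M)"
      by (intro mult_right_mono) auto
    finally show "(\<Sum>G\<in>\<F>. (cmod (d G))\<^sup>2) \<le> \<bar>C\<bar> * (\<integral>x. cmod (?p x) \<partial>M)" .
  qed
  show "(\<lambda>n. \<psi> (walsh_class (F n))) \<longlonglongrightarrow> 0"
  proof (rule LIMSEQ_I)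
    fix e :: real assume e: "e > 0"
    define X where "X = {G. finite G \<and> cmod (d G) \<ge> e}"
    have "finite X"
    proof (rule ccontr)
      assume "infinite X"
      obtain k :: nat where k: "(\<bar>C\<bar> * a)\<^sup>2 / e\<^sup>2 < real k" using reals_Archimedean2 by blast
      obtain \<F> where \<F>: "\<F> \<subseteq> X" "finite \<F>" "card \<F> = k"
        using infinite_arbitrarily_large[OF \<open>infinite X\<close>] by blast
      have "real k * e\<^sup>2 = (\<Sum>G\<in>\<F>. e\<^sup>2)" using \<F> by simp
      also have "\<dots> \<le> (\<Sum>G\<in>\<F>. (cmod (d G))\<^sup>2)"
        using \<F> e by (intro sum_mono power_mono) (auto simp: X_def)
      also have "\<dots> \<le> (\<bar>C\<bar> * a)\<^sup>2" using \<F> by (intro bessel) (auto simp: X_def)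
      finally show False using k e by (simp add: field_simps)
    qed
    then have "finite (\<Union>X)" by (auto simp: X_def)
    then obtain n0 where n0: "\<Union>X \<subseteq> {..<n0}" using finite_nat_iff_bounded by blast
    have "norm (\<psi> (walsh_class (F n)) - 0) < e" if "n \<ge> n0" for n
    proof (rule ccontr)
      assume "\<not> ?thesis"
      then have "F n \<in> X" using F(1) by (simp add: X_def d_def)
      moreover obtain i where "i \<in> F n" using F(2) by blast
      ultimately show False using F(3)[of n] n0 that by fastforce
    qed
    then show "\<exists>no. \<forall>n\<ge>no. norm (\<psi> (walsh_class (F n)) - 0) < e" by blast
  qed
qed

text \<open>Bad sets at every level \<open>N\<close> would form a weakly null sequence whose images
  stay away from 0. The sequential definition thus yields a bound uniform over all far sets, as the
  trace argument requires.\<close>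

lemma DP_walsh_null:
  assumes T: "T \<in> DP (L1 M)" and \<theta>: "\<theta> > 0"
  shows "\<exists>N. \<forall>F. finite F \<longrightarrow> F \<noteq> {} \<longrightarrow> F \<subseteq> {N..} \<longrightarrow> vnorm (L1 M) (T (walsh_class F)) \<le> \<theta>"
proof (rule ccontr)
  assume "\<not> ?thesis"
  then have "\<forall>N. \<exists>F. finite F \<and> F \<noteq> {} \<and> F \<subseteq> {N..} \<and> vnorm (L1 M) (T (walsh_class F)) > \<theta>"
    by (simp add: not_le)
  then obtain F where F: "\<And>n. finite (F n)" "\<And>n. F n \<noteq> {}" "\<And>n. F n \<subseteq> {n..}"
    "\<And>n. vnorm (L1 M) (T (walsh_class (F n))) > \<theta>" by metis
  have "(\<lambda>n. vnorm (L1 M) (T (walsh_class (F n)))) \<longlonglongrightarrow> 0"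
    using T walsh_weakly_null[OF F(1-3)] by (auto simp: DP_def norm_null_def)
  then have "eventually (\<lambda>n. vnorm (L1 M) (T (walsh_class (F n))) < \<theta>) sequentially"
    using \<theta> by (intro order_tendstoD(2)) auto
  then show False using F(4) by (auto simp: eventually_sequentially not_less[symmetric] dest: less_asym)
qed

section \<open>The operator on classes\<close>

definition riesz_class :: "('a \<Rightarrow> complex) set \<Rightarrow> ('a \<Rightarrow> complex) set" where
  "riesz_class v = ae_class M (riesz_op (rep v))"

lemma riesz_class_ae_class:
  assumes u: "integrable M u"
  shows "riesz_class (ae_class M u) = ae_class M (riesz_op u)"
proof -
  have "riesz_op u = riesz_op (rep (ae_class M u))"
    by (rule riesz_op_cong_AE[OF u rep_ae_class[OF u]])
  then show ?thesis by (simp add: riesz_class_def)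
qed

lemma riesz_class_bound:
  assumes "v \<in> carr (L1 M)"
  shows "vnorm (L1 M) (riesz_class v) \<le> vnorm (L1 M) v"
  using rep_carr(1)[OF assms] assms
  by (simp add: riesz_class_def vnorm_L1 vnorm_rep riesz_op_contraction)

lemma bounded_operator_riesz_class: "bounded_operator (L1 M) riesz_class"
  unfolding bounded_operator_def
proof (intro conjI ballI allI)
  fix u assume "u \<in> carr (L1 M)"
  then show "riesz_class u \<in> carr (L1 M)"
    unfolding riesz_class_def by (intro ae_class_in_carr riesz_op_integrable rep_carr)
next
  fix u v assume "u \<in> carr (L1 M)" "v \<in> carr (L1 M)"
  then obtain f g where f: "integrable M f" "u = ae_class M f" and g: "integrable M g" "v = ae_class M g"
    by (auto simp: carr_L1)
  have "ae_class M (riesz_op (\<lambda>x. f x + g x)) = ae_class M (\<lambda>x. riesz_op f x + riesz_op g x)"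
    using f g by (intro ae_class_cong riesz_op_add) auto
  then show "riesz_class (vadd (L1 M) u v) = vadd (L1 M) (riesz_class u) (riesz_class v)"
    using f g by (simp add: vadd_L1 riesz_class_ae_class)
next
  fix c u assume "u \<in> carr (L1 M)"
  then obtain f where f: "integrable M f" "u = ae_class M f"
    by (auto simp: carr_L1)
  have "ae_class M (riesz_op (\<lambda>x. c * f x)) = ae_class M (\<lambda>x. c * riesz_op f x)"
    using f by (intro ae_class_cong riesz_op_mult) auto
  then show "riesz_class (smul (L1 M) c u) = smul (L1 M) c (riesz_class u)"
    using f by (simp add: smul_L1 riesz_class_ae_class)
next
  show "\<exists>C. \<forall>u\<in>carr (L1 M). vnorm (L1 M) (riesz_class u) \<le> C * vnorm (L1 M) u"
    by (intro exI[of _ 1]) (simp add: riesz_class_bound)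
qed

lemma riesz_class_walsh:
  assumes "finite F"
  shows "riesz_class (walsh_class F) = smul (L1 M) (of_real (Eps F)) (walsh_class F)"
proof -
  have "ae_class M (riesz_op (\<lambda>x. of_real (walsh F x))) = ae_class M (\<lambda>x. of_real (Eps F) * of_real (walsh F x))"
    by (intro ae_class_cong riesz_op_walsh assms) auto
  then show ?thesis by (simp add: riesz_class_ae_class smul_L1)
qed

lemma riesz_class_DP: "riesz_class \<in> DP (L1 M)"
  unfolding DP_def
proof (intro CollectI conjI bounded_operator_riesz_class allI impI)
  fix x assume x: "weakly_null (L1 M) x"
  then have xc: "x n \<in> carr (L1 M)" for n by (simp add: weakly_null_def)
  have "(\<lambda>n. \<integral>y. cmod (riesz_op (rep (x n)) y) \<partial>M) \<longlonglongrightarrow> 0"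
  proof (rule riesz_op_weakly_null)
    show "integrable M (rep (x n))" for n by (rule rep_carr(1)[OF xc])
    fix \<phi> assume "\<phi> \<in> borel_measurable M" "\<And>x. cmod (\<phi> x) \<le> 1"
    then have "bounded_functional (L1 M) (pairing M \<phi>)" by (rule bounded_functional_pairing)
    then have "(\<lambda>n. pairing M \<phi> (x n)) \<longlonglongrightarrow> 0" using x by (simp add: weakly_null_def)
    then show "(\<lambda>n. \<integral>y. \<phi> y * rep (x n) y \<partial>M) \<longlonglongrightarrow> 0" by (simp add: pairing_def)
  qed
  then show "norm_null (L1 M) (\<lambda>n. riesz_class (x n))"
    using bounded_operator_riesz_class xc rep_carr(1)[OF xc]
    by (simp add: norm_null_def bounded_operator_def riesz_class_def vnorm_L1)
qed

lemma op_norm_riesz_class: "op_norm (L1 M) riesz_class = 1"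
proof (rule antisym)
  \<comment> \<open>The zero class shows that the supremum runs over a nonempty set.\<close>
  have "smul (L1 M) 0 (walsh_class {}) \<in> {u \<in> carr (L1 M). vnorm (L1 M) u \<le> 1}"
    by (simp add: smul_in_carr walsh_class_in_carr vnorm_smul[OF walsh_class_in_carr])
  then show "op_norm (L1 M) riesz_class \<le> 1"
    unfolding op_norm_def by (intro cSUP_least) (auto intro: order_trans[OF riesz_class_bound])
  \<comment> \<open>As \<open>Eps {} = 1\<close>, the class of the indicator of \<open>A\<close> is
    a nonzero fixed vector, which forces norm at least 1.\<close>
  have "vnorm (L1 M) (walsh_class {}) = a"
    using A by (simp add: vnorm_L1 abs_walsh)
  then have "a \<le> op_norm (L1 M) riesz_class * a"
    using op_norm_bound[OF bounded_operator_riesz_class walsh_class_in_carr[of "{}"]]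
    by (simp add: riesz_class_walsh vnorm_smul[OF walsh_class_in_carr] Eps_def)
  then show "1 \<le> op_norm (L1 M) riesz_class" using A_pos by simp
qed

lemma DP_coef_null:
  assumes T: "T \<in> DP (L1 M)" and \<theta>: "\<theta> > 0"
  shows "\<exists>N. \<forall>F. finite F \<longrightarrow> F \<noteq> {} \<longrightarrow> F \<subseteq> {N..} \<longrightarrow> cmod (coef F (rep (T (walsh_class F)))) \<le> \<theta>"
proof -
  have TZ: "T (walsh_class F) \<in> carr (L1 M)" for F
    using T walsh_class_in_carr unfolding DP_def bounded_operator_def by blast
  have "cmod (coef F (rep (T (walsh_class F)))) \<le> vnorm (L1 M) (T (walsh_class F))" for F
    unfolding vnorm_rep[OF TZ] by (rule coef_bound[OF rep_carr(1)[OF TZ]])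
  then show ?thesis using DP_walsh_null[OF T \<theta>] by (meson order_trans)
qed

text \<open>The two products use different facts. In \<open>S T\<close> the operator
  \<open>S\<close> acts last and multiplies every coefficient; in \<open>T S\<close> it acts first,
  and \<open>walsh F\<close> is an eigenvector. Both lead to the same \<open>\<tau> F\<close>, the
  diagonal coefficient of \<open>T\<close>.\<close>

lemma riesz_class_lower_bound:
  assumes T: "T \<in> DP (L1 M)"
  shows "op_norm (L1 M) (op_minus (L1 M) riesz_class (riesz_class \<circ> T)) \<ge> 1"
    and "op_norm (L1 M) (op_minus (L1 M) riesz_class (T \<circ> riesz_class)) \<ge> 1"
proof -
  have Tb: "bounded_operator (L1 M) T" using T by (simp add: DP_def)
  have TZ: "T (walsh_class F) \<in> carr (L1 M)" for F
    using Tb walsh_class_in_carr unfolding bounded_operator_def by blast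
  define \<tau> where "\<tau> F = coef F (rep (T (walsh_class F)))" for F
  define t where "t F = rep (T (walsh_class F))" for F
  have t: "integrable M (t F)" "T (walsh_class F) = ae_class M (t F)" for F
    using rep_carr[OF TZ] by (simp_all add: t_def)
  have wi: "integrable M (\<lambda>x. complex_of_real (Eps F) * of_real (walsh F x))" for F by simp
  have coef_w: "coef F (\<lambda>x. complex_of_real (Eps F) * of_real (walsh F x)) = of_real (Eps F) * of_real a"
    if "finite F" for F using that by (simp add: coef_mult coef_walsh)
  have \<tau>_null: "\<exists>N. \<forall>F. finite F \<longrightarrow> F \<noteq> {} \<longrightarrow> F \<subseteq> {N..} \<longrightarrow> cmod (\<tau> F) \<le> \<theta>" if "\<theta> > 0" for \<theta>
    unfolding \<tau>_def by (rule DP_coef_null[OF T that])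
  show "op_norm (L1 M) (op_minus (L1 M) riesz_class (riesz_class \<circ> T)) \<ge> 1"
  proof (rule op_norm_ge_1[OF _ _ \<tau>_null])
    show "bounded_operator (L1 M) (op_minus (L1 M) riesz_class (riesz_class \<circ> T))"
      by (intro bounded_operator_minus bounded_operator_comp bounded_operator_riesz_class Tb)
    fix F :: "nat set" assume F: "finite F"
    have "op_minus (L1 M) riesz_class (riesz_class \<circ> T) (walsh_class F)
        = ae_class M (\<lambda>x. of_real (Eps F) * of_real (walsh F x) - riesz_op (t F) x)"
      using t by (simp add: op_minus_def riesz_class_walsh[OF F] smul_L1 riesz_class_ae_class vminus_L1)
    then show "coef F (rep (op_minus (L1 M) riesz_class (riesz_class \<circ> T) (walsh_class F)))
        = of_real (Eps F) * (of_real a - \<tau> F)"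
      using t wi[of F] F
      by (simp add: coef_rep_ae_class coef_diff coef_w coef_riesz_op \<tau>_def t_def[symmetric] right_diff_distrib)
  qed
  show "op_norm (L1 M) (op_minus (L1 M) riesz_class (T \<circ> riesz_class)) \<ge> 1"
  proof (rule op_norm_ge_1[OF _ _ \<tau>_null])
    show "bounded_operator (L1 M) (op_minus (L1 M) riesz_class (T \<circ> riesz_class))"
      by (intro bounded_operator_minus bounded_operator_comp bounded_operator_riesz_class Tb)
    fix F :: "nat set" assume F: "finite F"
    have "T (smul (L1 M) (of_real (Eps F)) (walsh_class F)) = smul (L1 M) (of_real (Eps F)) (T (walsh_class F))"
      using Tb walsh_class_in_carr unfolding bounded_operator_def by blast
    then have "op_minus (L1 M) riesz_class (T \<circ> riesz_class) (walsh_class F)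
        = vminus (L1 M) (smul (L1 M) (of_real (Eps F)) (walsh_class F)) (smul (L1 M) (of_real (Eps F)) (T (walsh_class F)))"
      by (simp add: op_minus_def riesz_class_walsh[OF F])
    also have "\<dots> = ae_class M (\<lambda>x. of_real (Eps F) * of_real (walsh F x) - of_real (Eps F) * t F x)"
      using t by (simp add: smul_L1 vminus_L1)
    finally show "coef F (rep (op_minus (L1 M) riesz_class (T \<circ> riesz_class) (walsh_class F)))
        = of_real (Eps F) * (of_real a - \<tau> F)"
      using t wi[of F] F
      by (simp add: coef_rep_ae_class coef_diff coef_mult coef_walsh \<tau>_def t_def[symmetric] right_diff_distrib)
  qed
qed

end

section \<open>From the lower bounds to approximate identities\<close>

lemma op_norm_minus_commute:
  assumes "bounded_operator (L1 M) S" "bounded_operator (L1 M) T"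
  shows "op_norm (L1 M) (op_minus (L1 M) S T) = op_norm (L1 M) (op_minus (L1 M) T S)"
proof -
  have "S u \<in> carr (L1 M)" "T u \<in> carr (L1 M)" if "u \<in> carr (L1 M)" for u
    using assms that unfolding bounded_operator_def by blast+
  then show ?thesis
    unfolding op_norm_def op_minus_def by (intro SUP_cong refl vnorm_vminus_commute) auto
qed

text \<open>By reflexivity the index that should start the tail belongs to the tail, and it already
  violates the bound.\<close>

lemma net_null_not_bounded_below:
  assumes "directed_set D r" "\<And>i. i \<in> D \<Longrightarrow> a i \<ge> 1"
  shows "\<not> net_null D r a"
proof
  assume "net_null D r a"
  then obtain i where i: "i \<in> D" "\<And>j. j \<in> D \<Longrightarrow> (i, j) \<in> r \<Longrightarrow> \<bar>a j\<bar> < 1"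
    unfolding net_null_def by (meson zero_less_one)
  have "(i, i) \<in> r" using assms(1) i(1) by (auto simp: directed_set_def preorder_on_def refl_on_def)
  then show False using i assms(2)[OF i(1)] by force
qed

theorem theorem6p1:
  fixes M :: "'a measure"
  assumes "finite_measure M"
    and "has_atomless_part M"
  shows "(\<exists>S\<in>DP (L1 M). op_norm (L1 M) S = 1 \<and>
            (\<forall>T\<in>DP (L1 M). op_norm (L1 M) (op_minus (L1 M) S (S \<circ> T)) \<ge> 1 \<and>
                             op_norm (L1 M) (op_minus (L1 M) S (T \<circ> S)) \<ge> 1)) \<and>
         \<not> (\<exists>(D :: 'i set) r e. right_approx_identity (L1 M) (DP (L1 M)) D r e) \<and>
         \<not> (\<exists>(D :: 'i set) r e. left_approx_identity (L1 M) (DP (L1 M)) D r e)"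
proof -
  interpret finite_measure M by (rule assms(1))
  obtain A where A: "A \<in> sets M" "emeasure M A > 0" "\<And>B. B \<subseteq> A \<Longrightarrow> \<not> is_atom M B"
    using assms(2) unfolding has_atomless_part_def by blast
  obtain r :: "nat \<Rightarrow> 'a \<Rightarrow> real" where r: "\<And>n. r n \<in> borel_measurable M"
    "\<And>n x. r n x = 1 \<or> r n x = -1"
    "\<And>F. finite F \<Longrightarrow> F \<noteq> {} \<Longrightarrow> (\<integral>x. indicator A x * (\<Prod>i\<in>F. r i x) \<partial>M) = 0"
    by (rule atomless_Rademacher[OF A(3) A(1)]) (assumption, rule that)
  interpret rademacher_system M A r
    by unfold_locales (use A r in \<open>auto simp: emeasure_eq_measure\<close>)
  have bounded: "bounded_operator (L1 M) T" if "T \<in> DP (L1 M)" for T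
    using that by (simp add: DP_def)
  have right: "\<not> right_approx_identity (L1 M) (DP (L1 M)) D r e" for D :: "'i set" and r e
  proof
    assume *: "right_approx_identity (L1 M) (DP (L1 M)) D r e"
    have "\<not> net_null D r (\<lambda>i. op_norm (L1 M) (op_minus (L1 M) (riesz_class \<circ> e i) riesz_class))"
    proof (rule net_null_not_bounded_below)
      show "directed_set D r" using * by (simp add: right_approx_identity_def)
      fix i assume "i \<in> D"
      then have "e i \<in> DP (L1 M)" using * by (simp add: right_approx_identity_def)
      \<comment> \<open>Approximate identities measure \<open>S e - S\<close>, whereas the lower
        bound concerns \<open>S - S e\<close>.\<close>
      then show "1 \<le> op_norm (L1 M) (op_minus (L1 M) (riesz_class \<circ> e i) riesz_class)"
        using riesz_class_lower_bound(1)[of "e i"] bounded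
        by (subst op_norm_minus_commute) (auto intro: bounded_operator_comp bounded_operator_riesz_class)
    qed
    then show False using * riesz_class_DP by (auto simp: right_approx_identity_def)
  qed
  have left: "\<not> left_approx_identity (L1 M) (DP (L1 M)) D r e" for D :: "'i set" and r e
  proof
    assume *: "left_approx_identity (L1 M) (DP (L1 M)) D r e"
    have "\<not> net_null D r (\<lambda>i. op_norm (L1 M) (op_minus (L1 M) (e i \<circ> riesz_class) riesz_class))"
    proof (rule net_null_not_bounded_below)
      show "directed_set D r" using * by (simp add: left_approx_identity_def)
      fix i assume "i \<in> D"
      then have "e i \<in> DP (L1 M)" using * by (simp add: left_approx_identity_def)
      then show "1 \<le> op_norm (L1 M) (op_minus (L1 M) (e i \<circ> riesz_class) riesz_class)"
        using riesz_class_lower_bound(2)[of "e i"] bounded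
        by (subst op_norm_minus_commute) (auto intro: bounded_operator_comp bounded_operator_riesz_class)
    qed
    then show False using * riesz_class_DP by (auto simp: left_approx_identity_def)
  qed
  show ?thesis
    using riesz_class_DP op_norm_riesz_class riesz_class_lower_bound right left by blast
qed

end
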